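(* Let $X \subset \mathbb{P}^3$ (homogeneous coordinates $[a:b:x:y]$) be the surface defined by $$x (a^2 + b^2) (a^2 + b^2 - 2 a x - 2 b y) = a (x^2 + y^2) (x^2 + y^2 - 2 a x - 2 b y).$$ Then $X$ is a (singular) rational elliptic surface: the map $X \dashrightarrow \mathbb{P}^1$, $[a:b:x:y]\mapsto[a:b]$, whose fiber over $[a:b]$ is the curve $C(a,b)$, together with the identity section $[a:b]\mapsto[a:b:0:0]$ (i.e. $(x,y)=(0,0)$ in each fiber), is an elliptic fibration. The singular fibers over $\overline{\mathbb{Q}}$ occur exactly at $[a:b]=[0:1],[\pm i:1],[\pm 2i:1]$.
   Context: For fixed $(a,b)$, $C(a,b)$ denotes the affine plane curve in coordinates $(x,y)$ defined by the displayed equation. An elliptic surface here means a surface with a map to $\mathbb{P}^1$ whose generic fiber has geometric genus $1$, together with a chosen identity section; neither the surface nor the fibers are assumed smooth. A fiber is called singular when the Weierstrass model of (the normalization of) the fiber is singular, i.e. its discriminant vanishes. *)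

theory Defs
  imports
    "HOL-Analysis.Cartesian_Space"
    "HOL-Algebra.Algebraic_Closure_Type"
    "HOL-Computational_Algebra.Computational_Algebra"
begin

section \<open>Projective varieties over a field\<close>

definition proj_pt :: "'k::field ^ 'n \<Rightarrow> ('k ^ 'n) set" where
  "proj_pt v = {c *s v | c. c \<noteq> 0}"

definition proj_space :: "('k::field ^ 'n) set set" where
  "proj_space = {proj_pt v | v. v \<noteq> 0}"

text \<open>Polynomial functions that are homogeneous of degree \<open>d\<close> with coefficients in the
  subfield \<open>A\<close>; over an infinite field these are the same as homogeneous polynomials.\<close>

inductive form :: "'k::field set \<Rightarrow> nat \<Rightarrow> ('k ^ 'n \<Rightarrow> 'k) \<Rightarrow> bool" for A where
  form_const: "c \<in> A \<Longrightarrow> form A 0 (\<lambda>v. c)"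
| form_var: "form A 1 (\<lambda>v. v $ i)"
| form_add: "form A d F \<Longrightarrow> form A d G \<Longrightarrow> form A d (\<lambda>v. F v + G v)"
| form_mult: "form A d F \<Longrightarrow> form A e G \<Longrightarrow> form A (d + e) (\<lambda>v. F v * G v)"

definition zariski_closed :: "('k::field ^ 'n) set set \<Rightarrow> bool" where
  "zariski_closed Z \<longleftrightarrow> (\<exists>Fs. (\<forall>F\<in>Fs. \<exists>d. form UNIV d F) \<and>
     Z = {proj_pt v | v. v \<noteq> 0 \<and> (\<forall>F\<in>Fs. F v = 0)})"

definition irreducible_closed :: "('k::field ^ 'n) set set \<Rightarrow> bool" where
  "irreducible_closed S \<longleftrightarrow> zariski_closed S \<and> S \<noteq> {} \<and>
     (\<forall>Y Z. zariski_closed Y \<longrightarrow> zariski_closed Z \<longrightarrow> S = Y \<union> Z \<longrightarrow> S = Y \<or> S = Z)"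

definition nonempty_open_in :: "('k::field ^ 'n) set set \<Rightarrow> ('k ^ 'n) set set \<Rightarrow> bool" where
  "nonempty_open_in S U \<longleftrightarrow> U \<noteq> {} \<and> (\<exists>Z. zariski_closed Z \<and> U = S - Z)"

text \<open>Birational equivalence by maps defined over the subfield \<open>A\<close>: mutually inverse maps between
  nonempty open sets, each given by a tuple of forms of one degree. It is meant for irreducible
  closed sets. Membership of \<open>proj_pt (\<Phi> v)\<close> in \<open>V\<close> entails that \<open>\<Phi> v\<close> is nonzero.\<close>

definition birational_over ::
  "'k::field set \<Rightarrow> ('k ^ 'm) set set \<Rightarrow> ('k ^ 'n) set set \<Rightarrow> bool" where
  "birational_over A S T \<longleftrightarrow> (\<exists>\<Phi> \<Psi> d e U V.
     (\<forall>i. form A d (\<lambda>v. \<Phi> v $ i)) \<and> (\<forall>j. form A e (\<lambda>w. \<Psi> w $ j)) \<and>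
     nonempty_open_in S U \<and> nonempty_open_in T V \<and>
     (\<forall>v. proj_pt v \<in> U \<longrightarrow> proj_pt (\<Phi> v) \<in> V \<and> proj_pt (\<Psi> (\<Phi> v)) = proj_pt v) \<and>
     (\<forall>w. proj_pt w \<in> V \<longrightarrow> proj_pt (\<Psi> w) \<in> U \<and> proj_pt (\<Phi> (\<Psi> w)) = proj_pt w))"

definition rational_surface_over :: "'k::field set \<Rightarrow> ('k ^ 'n) set set \<Rightarrow> bool" where
  "rational_surface_over A S \<longleftrightarrow>
     irreducible_closed S \<and> birational_over A S (proj_space :: ('k ^ 3) set set)"

section \<open>Function fields of plane curves\<close>

text \<open>A polynomial in \<open>x, y\<close> has type \<open>'k poly poly\<close>, with \<open>x\<close> the inner and \<open>y\<close> the outer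
  variable. The function field of an integral plane curve over \<open>'k\<close> is finitely generated of
  transcendence degree 1, so it embeds over \<open>'k\<close> into the algebraic closure of \<open>'k(s)\<close>.\<close>

type_synonym 'k univ = "'k poly fract alg_closure"

definition emb :: "'k::field \<Rightarrow> 'k univ" where
  "emb c = to_ac (Fract [:c:] 1)"

definition eval2 :: "('k::field \<Rightarrow> 'l::field) \<Rightarrow> 'k poly poly \<Rightarrow> 'l \<Rightarrow> 'l \<Rightarrow> 'l" where
  "eval2 h f u v = poly (map_poly (\<lambda>p. poly (map_poly h p) u) f) v"

text \<open>The kernel of evaluation at \<open>(u, v)\<close> is the ideal of \<open>f\<close>, so that the field generated by
  \<open>u, v\<close> is the fraction field of \<open>'k[x,y]/(f)\<close>. In particular \<open>f\<close> is irreducible.\<close>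

definition generic_point :: "'k::field poly poly \<Rightarrow> 'k univ \<Rightarrow> 'k univ \<Rightarrow> bool" where
  "generic_point f u v \<longleftrightarrow> (\<forall>g. eval2 emb g u v = 0 \<longleftrightarrow> f dvd g)"

definition is_subring :: "'l::field set \<Rightarrow> bool" where
  "is_subring R \<longleftrightarrow> 1 \<in> R \<and> (\<forall>x\<in>R. \<forall>y\<in>R. x - y \<in> R \<and> x * y \<in> R)"

definition is_subfield :: "'l::field set \<Rightarrow> bool" where
  "is_subfield L \<longleftrightarrow> is_subring L \<and> (\<forall>x\<in>L. inverse x \<in> L)"

definition function_field :: "'k::field univ \<Rightarrow> 'k univ \<Rightarrow> 'k univ set" where
  "function_field u v = \<Inter>{L. is_subfield L \<and> range emb \<subseteq> L \<and> u \<in> L \<and> v \<in> L}"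

text \<open>The valuation rings of \<open>L\<close> over \<open>'k\<close> are the local rings at the closed points of the
  normalization of the projective curve with function field \<open>L\<close>.\<close>

definition places :: "'k::field univ set \<Rightarrow> 'k univ set set" where
  "places L = {R. is_subring R \<and> range emb \<subseteq> R \<and> R \<subset> L \<and> (\<forall>z\<in>L. z \<in> R \<or> inverse z \<in> R)}"

definition max_ideal :: "'l::field set \<Rightarrow> 'l set" where
  "max_ideal R = {z\<in>R. z = 0 \<or> inverse z \<notin> R}"

section \<open>Geometric genus\<close>

definition derivation_on :: "'k::field univ set \<Rightarrow> ('k univ \<Rightarrow> 'k univ) \<Rightarrow> bool" where
  "derivation_on L D \<longleftrightarrow> (\<forall>z\<in>L. D z \<in> L) \<and> (\<forall>c. D (emb c) = 0) \<and>
     (\<forall>x\<in>L. \<forall>y\<in>L. D (x + y) = D x + D y \<and> D (x * y) = D x * y + x * D y)"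

text \<open>For \<open>'k\<close> algebraically closed, the derivations of \<open>L\<close> over \<open>'k\<close> form a one-dimensional
  \<open>L\<close>-space, whose dual is the space of differentials; so contraction with a fixed nonzero
  derivation \<open>D\<close> identifies the differentials of \<open>L\<close> with \<open>L\<close>, and \<open>dg\<close> becomes \<open>D g\<close>. Under
  this identification, the following is the space of differentials that at each place \<open>R\<close> lie in
  the \<open>R\<close>-module generated by all \<open>dg\<close> with \<open>g\<close> in \<open>R\<close>, i.e. the global regular differentials.\<close>

definition regular_differentials ::
  "'k::field univ set \<Rightarrow> ('k univ \<Rightarrow> 'k univ) \<Rightarrow> 'k univ set" where
  "regular_differentials L D = {h\<in>L. \<forall>R\<in>places L.
     \<exists>(n::nat) r g. (\<forall>i<n. r i \<in> R \<and> g i \<in> R) \<and> h = (\<Sum>i<n. r i * D (g i))}"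

text \<open>The curve \<open>f = 0\<close> over \<open>'k\<close> is geometrically integral and the normalization of its
  projective closure over the algebraic closure of \<open>'k\<close> has \<open>g\<close> independent regular
  differentials.\<close>

definition has_geometric_genus :: "'k::field poly poly \<Rightarrow> nat \<Rightarrow> bool" where
  "has_geometric_genus f g \<longleftrightarrow> (\<exists>u v D.
     generic_point (map_poly (map_poly to_ac) f) u v \<and>
     derivation_on (function_field u v) D \<and> (\<exists>z\<in>function_field u v. D z \<noteq> 0) \<and>
     vector_space.dim (\<lambda>c z. emb c * z) (regular_differentials (function_field u v) D) = g)"

section \<open>Weierstrass models\<close>

datatype 'k weierstrass =
  Weierstrass (wa1: 'k) (wa2: 'k) (wa3: 'k) (wa4: 'k) (wa6: 'k)

abbreviation (input) cst :: "'k::field \<Rightarrow> 'k poly poly" where "cst c \<equiv> [:[:c:]:]"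
abbreviation (input) var_x :: "'k::field poly poly" where "var_x \<equiv> [:[:0, 1:]:]"
abbreviation (input) var_y :: "'k::field poly poly" where "var_y \<equiv> [:0, 1:]"

definition weierstrass_poly :: "'k::field weierstrass \<Rightarrow> 'k poly poly" where
  "weierstrass_poly W =
     var_y ^ 2 + cst (wa1 W) * var_x * var_y + cst (wa3 W) * var_y
     - (var_x ^ 3 + cst (wa2 W) * var_x ^ 2 + cst (wa4 W) * var_x + cst (wa6 W))"

definition discriminant :: "'k::field weierstrass \<Rightarrow> 'k" where
  "discriminant W =
     (let a1 = wa1 W; a2 = wa2 W; a3 = wa3 W; a4 = wa4 W; a6 = wa6 W;
          b2 = a1^2 + 4 * a2;
          b4 = 2 * a4 + a1 * a3;
          b6 = a3^2 + 4 * a6;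
          b8 = a1^2 * a6 + 4 * a2 * a6 - a1 * a3 * a4 + a2 * a3^2 - a4^2
      in - (b2^2 * b8) - 8 * b4^3 - 27 * b6^2 + 9 * b2 * b4 * b6)"

text \<open>\<open>W\<close> is a Weierstrass equation over \<open>'k\<close> for the normalization of the curve \<open>f = 0\<close>, where
  the rational point \<open>(x0, y0)\<close> of the curve, assumed to have a single place above it, becomes the
  point at infinity. The pole of the \<open>x\<close>-coordinate \<open>u'\<close> is the place at infinity of \<open>W\<close>.\<close>

definition weierstrass_model ::
  "'k::field poly poly \<Rightarrow> 'k \<Rightarrow> 'k \<Rightarrow> 'k weierstrass \<Rightarrow> bool" where
  "weierstrass_model f x0 y0 W \<longleftrightarrow> (\<exists>u v u' v'.
     generic_point f u v \<and> generic_point (weierstrass_poly W) u' v' \<and>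
     function_field u v = function_field u' v' \<and>
     (\<forall>R\<in>places (function_field u v).
        u - emb x0 \<in> max_ideal R \<and> v - emb y0 \<in> max_ideal R \<longleftrightarrow> u' \<notin> R))"

section \<open>Fibers of a fibration over the projective line\<close>

text \<open>The value at \<open>(a, b)\<close> of the degree \<open>n\<close> homogenization of \<open>p\<close>, for the coordinate
  \<open>t = a / b\<close> on the projective line.\<close>

definition hom_eval :: "nat \<Rightarrow> 'k::field poly \<Rightarrow> 'k \<Rightarrow> 'k \<Rightarrow> 'k" where
  "hom_eval n p a b = (\<Sum>i\<le>n. coeff p i * a ^ i * b ^ (n - i))"

definition regular_at :: "'k::field \<Rightarrow> 'k \<Rightarrow> 'k poly fract \<Rightarrow> bool" where
  "regular_at a b r \<longleftrightarrow> (\<exists>p q n. r = Fract p q \<and> degree p \<le> n \<and> degree q \<le> n \<and>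
     hom_eval n q a b \<noteq> 0)"

definition vanishes_at :: "'k::field \<Rightarrow> 'k \<Rightarrow> 'k poly fract \<Rightarrow> bool" where
  "vanishes_at a b r \<longleftrightarrow> (\<exists>p q n. r = Fract p q \<and> degree p \<le> n \<and> degree q \<le> n \<and>
     hom_eval n q a b \<noteq> 0 \<and> hom_eval n p a b = 0)"

definition regular_weierstrass_at :: "'k::field \<Rightarrow> 'k \<Rightarrow> 'k poly fract weierstrass \<Rightarrow> bool" where
  "regular_weierstrass_at a b W \<longleftrightarrow> (\<forall>r\<in>set_weierstrass W. regular_at a b r)"

text \<open>Weierstrass models of the generic fiber with coefficients regular at \<open>[a:b]\<close> whose
  discriminant has the least possible order of vanishing there.\<close>

definition minimal_weierstrass_model_at ::
  "'k::field poly fract poly poly \<Rightarrow> 'k poly fract \<Rightarrow> 'k poly fract \<Rightarrow> 'k \<Rightarrow> 'k \<Rightarrow>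
   'k poly fract weierstrass \<Rightarrow> bool" where
  "minimal_weierstrass_model_at f x0 y0 a b W \<longleftrightarrow>
     weierstrass_model f x0 y0 W \<and> discriminant W \<noteq> 0 \<and> regular_weierstrass_at a b W \<and>
     (\<forall>W'. weierstrass_model f x0 y0 W' \<and> regular_weierstrass_at a b W' \<longrightarrow>
        regular_at a b (discriminant W' / discriminant W))"

text \<open>The fiber over \<open>[a:b]\<close> of the Weierstrass model of the fibration with generic fiber \<open>f = 0\<close>
  and identity section \<open>(x0, y0)\<close> has vanishing discriminant.\<close>

definition singular_fiber_at ::
  "'k::field poly fract poly poly \<Rightarrow> 'k poly fract \<Rightarrow> 'k poly fract \<Rightarrow> 'k \<Rightarrow> 'k \<Rightarrow> bool" where
  "singular_fiber_at f x0 y0 a b \<longleftrightarrow>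
     (\<exists>W. minimal_weierstrass_model_at f x0 y0 a b W \<and> vanishes_at a b (discriminant W))"

section \<open>The surface and its fibration\<close>

definition quintic :: "'r::comm_ring_1 \<Rightarrow> 'r \<Rightarrow> 'r \<Rightarrow> 'r \<Rightarrow> 'r" where
  "quintic a b x y =
     x * (a^2 + b^2) * (a^2 + b^2 - 2 * a * x - 2 * b * y)
     - a * (x^2 + y^2) * (x^2 + y^2 - 2 * a * x - 2 * b * y)"

definition surface_X :: "('k::field ^ 4) set set" where
  "surface_X = {proj_pt (vector [a, b, x, y]) | a b x y.
     (vector [a, b, x, y] :: 'k ^ 4) \<noteq> 0 \<and> quintic a b x y = 0}"

definition singular_point_X :: "'k::field \<Rightarrow> 'k \<Rightarrow> 'k \<Rightarrow> 'k \<Rightarrow> bool" where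
  "singular_point_X a b x y \<longleftrightarrow> (vector [a, b, x, y] :: 'k ^ 4) \<noteq> 0 \<and> quintic a b x y = 0 \<and>
     poly (pderiv (quintic [:0, 1:] [:b:] [:x:] [:y:])) a = 0 \<and>
     poly (pderiv (quintic [:a:] [:0, 1:] [:x:] [:y:])) b = 0 \<and>
     poly (pderiv (quintic [:a:] [:b:] [:0, 1:] [:y:])) x = 0 \<and>
     poly (pderiv (quintic [:a:] [:b:] [:x:] [:0, 1:])) y = 0"

definition curve_C :: "'k::field \<Rightarrow> 'k \<Rightarrow> ('k \<times> 'k) set" where
  "curve_C a b = {(x, y). quintic a b x y = 0}"

definition curve_C_poly :: "'k::field \<Rightarrow> 'k \<Rightarrow> 'k poly poly" where
  "curve_C_poly a b = quintic (cst a) (cst b) var_x var_y"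

text \<open>The curve \<open>C(t,1)\<close> over \<open>'k(t)\<close>.\<close>

definition generic_fiber :: "'k::field poly fract poly poly" where
  "generic_fiber = curve_C_poly (Fract [:0, 1:] 1) 1"

text \<open>The maps \<open>[a:b:x:y] \<mapsto> [a:b]\<close> and \<open>[a:b] \<mapsto> [a:b:0:0]\<close>, applied to the equivalence class of
  a coordinate vector. Where the former map is undefined (\<open>a = b = 0\<close>) it returns \<open>{0}\<close>, which is
  not a point of the projective line.\<close>

definition pencil_map :: "('k::field ^ 4) set \<Rightarrow> ('k ^ 2) set" where
  "pencil_map P = (\<lambda>v. vector [v $ 1, v $ 2]) ` P"

definition zero_section :: "('k::field ^ 2) set \<Rightarrow> ('k ^ 4) set" where
  "zero_section p = (\<lambda>w. vector [w $ 1, w $ 2, 0, 0]) ` p"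

end

theory Submission
  imports Defs
begin

text \<open>With \<open>c = a + ib\<close> and \<open>z = x + iy\<close>, the equation of the surface is linear in \<open>c\<close> and its conjugate
  once \<open>w = z / c\<close> is fixed, so the surface is birational to the plane of \<open>w\<close>.

  Inversion in the circle turns the fiber into a plane cubic with Weierstrass form
  \<open>y\<^sup>2 = x (x\<^sup>2 + (a\<^sup>2 - 2 b\<^sup>2) x + (a\<^sup>2 + b\<^sup>2)\<^sup>2)\<close>, where the new \<open>x\<close> is \<open>a (x\<^sup>2 + y\<^sup>2 - 2 b y) / x - a\<^sup>2 + b\<^sup>2\<close> in the
  old coordinates. Its discriminant is \<open>- 48 a\<^sup>2 (a\<^sup>2 + b\<^sup>2)\<^sup>4 (a\<^sup>2 + 4 b\<^sup>2)\<close>. The functions without poles away from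
  the point at infinity form the ring \<open>K[x, y]\<close> (they are integral over \<open>K[x]\<close>), and comparing pole
  orders shows that any two Weierstrass equations differ by an affine substitution; their discriminants
  differ by a twelfth power. As the above discriminant vanishes to order less than 12 at each point, the
  model is minimal, and its singular fibers are the zeros of the discriminant.

  The derivation with \<open>x \<mapsto> 2 y\<close> preserves the local ring at every place and maps a uniformizer to a
  unit. Under the identification given by this derivation, the regular differentials are the functions
  without poles, which are constant; hence the genus is 1.\<close>

text \<open>Places are arbitrary valuation rings, so nothing can be read off from coordinates at the
  start. Two facts bridge the gap. By Zorn's lemma there are enough valuation rings that an element
  lying in all places above a ring is integral over it. And over an algebraically closed field,
  every nonzero function is, at a place where x is finite, an integer power of an explicit parameter
  times a unit. The genus is computed over the algebraic closure of k(t), the Weierstrass models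
  over k(t) itself; one development with constants in a field of characteristic 0 serves both.

  Irreducibility of X does not follow from the birational map alone: the map controls only an open
  chart, and a component could lie outside it. The obstacle is to show that a form vanishing on the
  chart vanishes on X. Every point of X is therefore exhibited as a specialization of points of the
  chart.\<close>

instantiation fract :: (idom)
  "{unique_euclidean_ring, normalization_euclidean_semiring, normalization_semidom_multiplicative}"
begin

definition [simp]: "normalize_fract = (normalize_field :: 'a fract \<Rightarrow> _)"
definition [simp]: "unit_factor_fract = (unit_factor_field :: 'a fract \<Rightarrow> _)"
definition [simp]: "modulo_fract = (mod_field :: 'a fract \<Rightarrow> _)"
definition [simp]: "euclidean_size_fract = (euclidean_size_field :: 'a fract \<Rightarrow> _)"
definition [simp]: "division_segment (x :: 'a fract) = 1"

instance
  by standard (simp_all add: dvd_field_iff field_split_simps split: if_splits)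

end

instantiation fract :: (idom) euclidean_ring_gcd
begin

definition gcd_fract :: "'a fract \<Rightarrow> 'a fract \<Rightarrow> 'a fract" where
  "gcd_fract = Euclidean_Algorithm.gcd"
definition lcm_fract :: "'a fract \<Rightarrow> 'a fract \<Rightarrow> 'a fract" where
  "lcm_fract = Euclidean_Algorithm.lcm"
definition Gcd_fract :: "'a fract set \<Rightarrow> 'a fract" where
  "Gcd_fract = Euclidean_Algorithm.Gcd"
definition Lcm_fract :: "'a fract set \<Rightarrow> 'a fract" where
  "Lcm_fract = Euclidean_Algorithm.Lcm"

instance
  by standard (simp_all add: gcd_fract_def lcm_fract_def Gcd_fract_def Lcm_fract_def)

end

text \<open>The constants of the curve will be k(t) or its algebraic closure; class
  \<open>field_gcd\<close> makes greatest common divisors and Gauss's lemma available for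
  polynomials over both.\<close>

instance fract :: (idom) field_gcd ..

instance alg_closure :: (field) field_gcd ..

instance fract :: ("{idom,ring_char_0}") field_char_0
proof
  have "of_nat n = Fract (of_nat n :: 'a) 1" for n
    by (induction n) (simp_all add: Zero_fract_def One_fract_def)
  thus "inj (of_nat :: nat \<Rightarrow> 'a fract)"
    by (auto simp: inj_def eq_fract)
qed

section \<open>Ring homomorphisms and evaluation of polynomials\<close>

locale rhom =
  fixes h :: "'a::comm_ring_1 \<Rightarrow> 'b::comm_ring_1"
  assumes hom_add: "h (x + y) = h x + h y"
    and hom_mult: "h (x * y) = h x * h y"
    and hom_1: "h 1 = 1"
begin

lemma hom_0: "h 0 = 0"
  using hom_add[of 0 0] by simp

lemma hom_uminus: "h (- x) = - h x"
  using hom_add[of x "- x"] by (simp add: hom_0 eq_neg_iff_add_eq_0 add.commute)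

lemma hom_diff: "h (x - y) = h x - h y"
  using hom_add[of x "- y"] by (simp add: hom_uminus)

lemma hom_power: "h (x ^ n) = h x ^ n"
  by (induction n) (simp_all add: hom_1 hom_mult)

lemma hom_of_nat: "h (of_nat n) = of_nat n"
  by (induction n) (simp_all add: hom_0 hom_add hom_1)

lemma hom_numeral: "h (numeral n) = numeral n"
  using hom_of_nat[of "numeral n"] by simp

lemma hom_sum: "h (sum f A) = (\<Sum>i\<in>A. h (f i))"
  by (induction A rule: infinite_finite_induct) (simp_all add: hom_0 hom_add)

lemmas hom_simps = hom_0 hom_1 hom_add hom_mult hom_uminus hom_diff hom_power hom_numeral

lemma hom_quintic: "h (quintic a b x y) = quintic (h a) (h b) (h x) (h y)"
  by (simp add: quintic_def hom_simps)

lemma rhom_map_poly: "rhom (map_poly h)"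
proof
  show "map_poly h (p + q) = map_poly h p + map_poly h q" for p q
    by (rule poly_eqI) (simp add: coeff_map_poly hom_0 hom_add)
  show "map_poly h (p * q) = map_poly h p * map_poly h q" for p q
    by (rule poly_eqI) (simp add: coeff_map_poly hom_0 hom_sum hom_mult coeff_mult)
  show "map_poly h 1 = 1"
    by (simp add: one_pCons hom_1 hom_0 map_poly_pCons)
qed

lemma rhom_poly_map_poly: "rhom (\<lambda>p. poly (map_poly h p) x)"
proof -
  interpret m: rhom "map_poly h" by (rule rhom_map_poly)
  show ?thesis
    by standard (simp_all add: m.hom_simps)
qed

end

lemma rhom_eval2:
  fixes h :: "'a::field \<Rightarrow> 'b::field"
  assumes "rhom h"
  shows "rhom (\<lambda>f. eval2 h f u v)"
  unfolding eval2_def by (intro rhom.rhom_poly_map_poly assms)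

lemma rhom_emb: "rhom (emb :: 'k::field \<Rightarrow> 'k univ)"
  by standard (simp_all add: emb_def mult.commute one_pCons [symmetric] One_fract_def [symmetric]
      flip: to_ac_add to_ac_mult)

interpretation emb: rhom emb
  by (rule rhom_emb)

lemma emb_eq_0_iff [simp]: "emb c = 0 \<longleftrightarrow> c = 0"
  by (simp add: emb_def Zero_fract_def eq_fract)

lemma emb_eq_iff [simp]: "emb c = emb d \<longleftrightarrow> c = d"
  using emb_eq_0_iff[of "c - d"] by (simp add: emb.hom_diff del: emb_eq_0_iff)

lemma emb_inverse: "emb (inverse c) = inverse (emb c)"
proof (cases "c = 0")
  case False
  hence "emb c * emb (inverse c) = 1"
    by (simp add: emb.hom_1 flip: emb.hom_mult)
  thus ?thesis
    using inverse_unique by metis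
qed (simp add: emb.hom_0)

lemma emb_divide: "emb (c / d) = emb c / emb d"
  by (simp add: field_class.field_divide_inverse emb.hom_mult emb_inverse)

lemmas emb_simps = emb.hom_simps emb_inverse emb_divide

definition ev :: "'k::field poly \<Rightarrow> 'k univ \<Rightarrow> 'k univ" where
  "ev p u = poly (map_poly emb p) u"

interpretation ev: rhom "\<lambda>p. ev p u" for u
  unfolding ev_def by (rule emb.rhom_poly_map_poly)

interpretation eval2: rhom "\<lambda>f. eval2 emb f u v" for u v
  by (rule rhom_eval2) (rule rhom_emb)

lemma ev_pCons [simp]: "ev (pCons a p) u = emb a + u * ev p u"
  by (simp add: ev_def map_poly_pCons emb.hom_0)

lemma ev_0 [simp]: "ev 0 u = 0"
  by (simp add: ev_def)

lemma ev_1 [simp]: "ev 1 u = 1"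
  by (rule ev.hom_1)

lemma ev_smult: "ev (smult c p) u = emb c * ev p u"
  using ev.hom_mult[of "[:c:]" p u] by simp

lemma eval2_0 [simp]: "eval2 emb 0 u v = 0"
  by (rule eval2.hom_0)

lemma eval2_pCons [simp]: "eval2 emb (pCons p g) u v = ev p u + v * eval2 emb g u v"
  by (simp add: eval2_def map_poly_pCons ev_def)

definition transcendental :: "'k::field univ \<Rightarrow> bool" where
  "transcendental u \<longleftrightarrow> (\<forall>p. ev p u = 0 \<longrightarrow> p = 0)"

lemma transcendental_ev_eq_0_iff: "transcendental u \<Longrightarrow> ev p u = 0 \<longleftrightarrow> p = 0"
  by (auto simp: transcendental_def)

lemma transcendental_ev_eq_iff: "transcendental u \<Longrightarrow> ev p u = ev q u \<longleftrightarrow> p = q"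
  using transcendental_ev_eq_0_iff[of u "p - q"] by (simp add: ev.hom_diff)

lemma transcendental_exists: "\<exists>u :: 'k::field univ. transcendental u"
proof
  have "ev p (to_ac (Fract [:0, 1:] 1)) = to_ac (Fract p 1)" for p :: "'k poly"
  proof (induction p)
    case (pCons a p)
    have "Fract (pCons a p) 1 = Fract [:a:] 1 + Fract [:0, 1:] 1 * Fract p 1"
      by simp
    thus ?case
      by (simp only: ev_pCons pCons.IH emb_def to_ac_add to_ac_mult)
  qed (simp flip: Zero_fract_def)
  thus "transcendental (to_ac (Fract [:0, 1:] 1) :: 'k univ)"
    by (simp add: transcendental_def Zero_fract_def eq_fract)
qed

section \<open>Valuation rings\<close>

lemma is_subringD:
  assumes "is_subring R"
  shows "1 \<in> R" "0 \<in> R" "x \<in> R \<Longrightarrow> y \<in> R \<Longrightarrow> x - y \<in> R" "x \<in> R \<Longrightarrow> y \<in> R \<Longrightarrow> x * y \<in> R"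
    "x \<in> R \<Longrightarrow> y \<in> R \<Longrightarrow> x + y \<in> R" "x \<in> R \<Longrightarrow> - x \<in> R" "x \<in> R \<Longrightarrow> x ^ n \<in> R"
proof -
  show 1: "1 \<in> R" and d: "x \<in> R \<Longrightarrow> y \<in> R \<Longrightarrow> x - y \<in> R"
    and m: "x \<in> R \<Longrightarrow> y \<in> R \<Longrightarrow> x * y \<in> R" for x y
    using assms by (auto simp: is_subring_def)
  show 0: "0 \<in> R" using d[OF 1 1] by simp
  show u: "x \<in> R \<Longrightarrow> - x \<in> R" for x using d[OF 0] by fastforce
  show "x \<in> R \<Longrightarrow> y \<in> R \<Longrightarrow> x + y \<in> R" using d[OF _ u] by fastforce
  show "x \<in> R \<Longrightarrow> x ^ n \<in> R" by (induction n) (auto intro: 1 m)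
qed

lemma is_subring_sum: "is_subring R \<Longrightarrow> (\<And>i. i \<in> A \<Longrightarrow> f i \<in> R) \<Longrightarrow> sum f A \<in> R"
  by (induction A rule: infinite_finite_induct) (auto intro: is_subringD)

lemma is_subfieldD:
  assumes "is_subfield L"
  shows "is_subring L" "x \<in> L \<Longrightarrow> inverse x \<in> L" "x \<in> L \<Longrightarrow> y \<in> L \<Longrightarrow> x / y \<in> L"
  using assms is_subringD(4)[of L x "inverse y"]
  by (auto simp: is_subfield_def field_class.field_divide_inverse)

lemma is_subring_poly:
  assumes "is_subring R" "\<And>i. coeff p i \<in> R" "w \<in> R"
  shows "poly p w \<in> R"
  unfolding poly_altdef by (intro is_subring_sum is_subringD assms)

text \<open>The ring R[w]. With w = 1/z it encodes integrality: multiplied by a power of z, the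
  membership \<open>z \<in> adjoin R (inverse z)\<close> becomes a monic equation for z over
  R.\<close>

definition adjoin :: "'l::field set \<Rightarrow> 'l \<Rightarrow> 'l set" where
  "adjoin R w = {poly p w | p. \<forall>i. coeff p i \<in> R}"

lemma is_subring_adjoin:
  assumes "is_subring R"
  shows "is_subring (adjoin R w)"
  unfolding is_subring_def
proof (intro conjI ballI)
  note R = is_subringD[OF assms]
  show "1 \<in> adjoin R w"
    unfolding adjoin_def by (rule CollectI, rule exI[of _ 1]) (auto intro: R)
  fix x y
  assume "x \<in> adjoin R w" "y \<in> adjoin R w"
  then obtain p q where pq: "x = poly p w" "y = poly q w" "\<forall>i. coeff p i \<in> R" "\<forall>i. coeff q i \<in> R"
    by (auto simp: adjoin_def)
  show "x - y \<in> adjoin R w"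
    unfolding adjoin_def using pq by (intro CollectI exI[of _ "p - q"]) (auto intro: R)
  show "x * y \<in> adjoin R w"
    unfolding adjoin_def using pq
    by (intro CollectI exI[of _ "p * q"]) (auto intro!: R is_subring_sum[OF assms] simp: coeff_mult)
qed

lemma subset_adjoin: "is_subring R \<Longrightarrow> R \<subseteq> adjoin R w"
proof
  fix x assume "is_subring R" "x \<in> R"
  thus "x \<in> adjoin R w"
    unfolding adjoin_def
    by (intro CollectI exI[of _ "[:x:]"]) (auto simp: coeff_pCons is_subringD split: nat.split)
qed

lemma in_adjoin: "is_subring R \<Longrightarrow> w \<in> adjoin R w"
  unfolding adjoin_def
  by (intro CollectI exI[of _ "[:0, 1:]"]) (auto simp: coeff_pCons is_subringD split: nat.split)

lemma adjoin_subset: "is_subring S \<Longrightarrow> R \<subseteq> S \<Longrightarrow> w \<in> S \<Longrightarrow> adjoin R w \<subseteq> S"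
  by (auto simp: adjoin_def intro!: is_subring_poly)

lemma adjoinE:
  assumes "z \<in> adjoin R w"
  obtains n :: nat and a where "\<And>i. a i \<in> R" "z = (\<Sum>i\<le>n. a i * w ^ i)"
  using assms that by (auto simp: adjoin_def poly_altdef)

text \<open>The constant term of the relation in 1/v can be absorbed on the left, because 1 - b 0 /
  z is a unit of R. Multiplying what remains by v^(n+1) rewrites this power through lower ones,
  which shortens the relation in v.\<close>

lemma adjoin_reduce:
  fixes v z :: "'l::field"
  assumes R: "is_subring R" and unit: "\<And>b. b \<in> R \<Longrightarrow> inverse (1 - b * inverse z) \<in> R"
    and z: "inverse z \<in> R" "z \<noteq> 0" and v: "v \<noteq> 0"
    and a: "\<And>i. a i \<in> R" "z = (\<Sum>i\<le>Suc n. a i * v ^ i)"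
    and b: "\<And>i. b i \<in> R" "z = (\<Sum>j\<le>m. b j * inverse v ^ j)" and mn: "m \<le> Suc n"
    and nz: "1 - b 0 * inverse z \<noteq> 0"
  shows "\<exists>a'. (\<forall>i. a' i \<in> R) \<and> z = (\<Sum>i\<le>n. a' i * v ^ i)"
proof -
  define w where "w = inverse z"
  define c where "c = 1 - b 0 * w"
  define g where "g j = b j * w * inverse c" for j
  note RD = is_subringD[OF R]
  have g: "g j \<in> R" for j
    unfolding g_def c_def w_def by (intro RD(4) unit b z)
  have cnz: "c \<noteq> 0" using nz by (simp add: c_def w_def)
  have "1 = w * z" using z by (simp add: w_def)
  also have "z = b 0 + (\<Sum>j=1..m. b j * inverse v ^ j)"
    unfolding b(2) by (simp add: sum.atLeast_Suc_atMost atLeast0AtMost[symmetric])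
  finally have "c = (\<Sum>j=1..m. w * (b j * inverse v ^ j))"
    by (simp add: c_def algebra_simps sum_distrib_left)
  hence "1 = (\<Sum>j=1..m. w * (b j * inverse v ^ j)) * inverse c"
    using cnz by simp
  hence "1 = (\<Sum>j=1..m. g j * inverse v ^ j)"
    by (simp add: sum_distrib_left sum_distrib_right g_def algebra_simps)
  hence "v ^ Suc n = (\<Sum>j=1..m. g j * inverse v ^ j) * v ^ Suc n"
    by simp
  also have "\<dots> = (\<Sum>j=1..m. g j * v ^ (Suc n - j))"
    unfolding sum_distrib_right
  proof (intro sum.cong refl)
    fix j assume "j \<in> {1..m}"
    hence "v ^ Suc n = v ^ j * v ^ (Suc n - j)"
      using mn by (simp flip: power_add)
    thus "g j * inverse v ^ j * v ^ Suc n = g j * v ^ (Suc n - j)"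
      using v by (simp add: power_inverse)
  qed
  also have "\<dots> = (\<Sum>i\<in>(\<lambda>j. Suc n - j) ` {1..m}. g (Suc n - i) * v ^ i)"
    using mn by (subst sum.reindex) (auto simp: inj_on_def)
  also have "\<dots> = (\<Sum>i\<le>n. (if i \<in> (\<lambda>j. Suc n - j) ` {1..m} then g (Suc n - i) else 0) * v ^ i)"
    by (rule sum.mono_neutral_cong_left) auto
  finally have vn: "v ^ Suc n = \<dots>" .
  define a' where "a' i = a i + a (Suc n) * (if i \<in> (\<lambda>j. Suc n - j) ` {1..m} then g (Suc n - i) else 0)" for i
  have "a' i \<in> R" for i
    unfolding a'_def using a g by (auto intro: RD)
  moreover have "z = (\<Sum>i\<le>n. a' i * v ^ i)"
    unfolding a(2) sum.atMost_Suc vn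
    by (simp add: a'_def sum.distrib sum_distrib_left algebra_simps)
  ultimately show ?thesis by blast
qed

text \<open>A subring maximal among those that contain \<open>A\<close> and \<open>1/z\<close> but not \<open>z\<close> is a valuation ring.\<close>

lemma valuation_ring_exists:
  fixes L A :: "'l::field set"
  assumes L: "is_subfield L" and A: "is_subring A" "A \<subseteq> L" and z: "z \<in> L" "z \<notin> adjoin A (inverse z)"
  shows "\<exists>R. is_subring R \<and> A \<subseteq> R \<and> R \<subseteq> L \<and> z \<notin> R \<and> (\<forall>v\<in>L. v \<in> R \<or> inverse v \<in> R)"
proof -
  define P where "P = {R. is_subring R \<and> adjoin A (inverse z) \<subseteq> R \<and> R \<subseteq> L \<and> z \<notin> R}"
  have "adjoin A (inverse z) \<in> P"
    unfolding P_def
    using z is_subring_adjoin[OF A(1)] adjoin_subset[OF is_subfieldD(1)[OF L] A(2) is_subfieldD(2)[OF L z(1)]]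
    by auto
  hence "P \<noteq> {}" by auto
  have "\<Union>C \<in> P" if C: "C \<noteq> {}" "subset.chain P C" for C
  proof -
    have CP: "C \<subseteq> P" and ch: "\<And>S S'. S \<in> C \<Longrightarrow> S' \<in> C \<Longrightarrow> S \<subseteq> S' \<or> S' \<subseteq> S"
      using C unfolding subset.chain_def by auto
    have "is_subring (\<Union>C)"
      unfolding is_subring_def
    proof (intro conjI ballI)
      show "1 \<in> \<Union>C" using C CP by (auto simp: P_def is_subring_def)
      fix x y assume "x \<in> \<Union>C" "y \<in> \<Union>C"
      then obtain S where "S \<in> C" "x \<in> S" "y \<in> S" using ch by blast
      moreover from this have "is_subring S" using CP by (auto simp: P_def)
      ultimately show "x - y \<in> \<Union>C" "x * y \<in> \<Union>C" by (blast dest: is_subringD)+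
    qed
    thus ?thesis using C CP unfolding P_def by blast
  qed
  then obtain R where R: "R \<in> P" and max: "\<And>S. S \<in> P \<Longrightarrow> R \<subseteq> S \<Longrightarrow> S = R"
    using subset_Zorn_nonempty[OF \<open>P \<noteq> {}\<close>] by blast
  have sr: "is_subring R" and RL: "R \<subseteq> L" and zR: "z \<notin> R" and AR: "A \<subseteq> R" "inverse z \<in> R"
    using R A subset_adjoin[of A] in_adjoin[of A] unfolding P_def by blast+
  note RD = is_subringD[OF sr]
  have z0: "z \<noteq> 0" using zR RD by auto
  have adj: "z \<in> adjoin R v" if "v \<in> L" "v \<notin> R" for v
  proof (rule ccontr)
    assume "z \<notin> adjoin R v"
    moreover have "adjoin A (inverse z) \<subseteq> adjoin R v"
      using subset_adjoin[OF sr] AR by (intro adjoin_subset is_subring_adjoin sr) auto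
    ultimately have "adjoin R v \<in> P"
      unfolding P_def
      using is_subring_adjoin[OF sr] adjoin_subset[OF is_subfieldD(1)[OF L] RL that(1)] by simp
    thus False using max[OF _ subset_adjoin[OF sr]] in_adjoin[OF sr] that by blast
  qed
  have nz: "1 - b * inverse z \<noteq> 0" if "b \<in> R" for b
    using that zR z0 by (auto simp: field_simps)
  \<comment> \<open>If 1/c were outside R for c = 1 - b/z, maximality would put z in R[1/c], so z *
    c^n is in R. But z * (1 - c^n) is in R as well, since z * (1 - c) = b, and the sum of the two is
    z.\<close>
  have unit: "inverse (1 - b * inverse z) \<in> R" if b: "b \<in> R" for b
  proof (rule ccontr)
    define c where "c = 1 - b * inverse z"
    assume "inverse (1 - b * inverse z) \<notin> R"
    moreover have "inverse c \<in> L"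
      unfolding c_def using RD(3)[OF RD(1) RD(4)[OF b AR(2)]] RL by (intro is_subfieldD(2)[OF L]) auto
    ultimately have "z \<in> adjoin R (inverse c)" by (intro adj) (auto simp: c_def)
    then obtain n :: nat and a where a: "\<And>i. a i \<in> R" "z = (\<Sum>i\<le>n. a i * inverse c ^ i)"
      by (rule adjoinE) blast
    have cR: "c \<in> R" unfolding c_def using b AR by (intro RD)
    have "z * c ^ n = (\<Sum>i\<le>n. a i * c ^ (n - i))"
      unfolding a(2) sum_distrib_right
    proof (intro sum.cong refl)
      fix i assume "i \<in> {..n}"
      hence "c ^ n = c ^ i * c ^ (n - i)" by (simp flip: power_add)
      thus "a i * inverse c ^ i * c ^ n = a i * c ^ (n - i)"
        using nz[OF b] by (simp add: power_inverse c_def)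
    qed
    also have "\<dots> \<in> R" by (intro is_subring_sum[OF sr] RD a cR)
    finally have zc: "z * c ^ n \<in> R" .
    have "z * (1 - c ^ k) \<in> R" for k
    proof (induction k)
      case (Suc k)
      have "z * (1 - c ^ Suc k) = z * (1 - c ^ k) + c ^ k * b"
        using z0 by (simp add: c_def algebra_simps)
      thus ?case using RD(5)[OF Suc RD(4)[OF RD(7)[OF cR] b]] by metis
    qed (use RD in simp)
    from RD(5)[OF this[of n] zc] show False using zR by (simp add: algebra_simps)
  qed
  have "v \<in> R \<or> inverse v \<in> R" if v: "v \<in> L" for v
  proof (rule ccontr)
    assume "\<not> (v \<in> R \<or> inverse v \<in> R)"
    hence vR: "v \<notin> R" "inverse v \<notin> R" by auto
    hence v0: "v \<noteq> 0" using RD by auto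
    \<comment> \<open>Take relations of least degree for z in R[v] and in R[1/v];
      \<open>adjoin_reduce\<close> shortens the longer one.\<close>
    define Q where "Q v n \<longleftrightarrow> (\<exists>a. (\<forall>i. a i \<in> R) \<and> z = (\<Sum>i\<le>n. a i * v ^ i))" for v and n :: nat
    have ex: "\<exists>n. Q x n" if "x \<in> L" "x \<notin> R" for x
      using adj[OF that] by (rule adjoinE) (auto simp: Q_def)
    have "\<exists>n. Q v n" "\<exists>n. Q (inverse v) n"
      using ex v vR is_subfieldD(2)[OF L v] by auto
    then obtain n m where n: "Q v n" "\<And>k. k < n \<Longrightarrow> \<not> Q v k" and m: "Q (inverse v) m" "\<And>k. k < m \<Longrightarrow> \<not> Q (inverse v) k"
      unfolding exists_least_iff[of "Q v"] exists_least_iff[of "Q (inverse v)"] by blast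
    have pos: "k > 0" if "Q x k" for x k
      using that zR by (cases k) (auto simp: Q_def)
    obtain n' m' where S: "n = Suc n'" "m = Suc m'" using pos n(1) m(1) gr0_implies_Suc by metis
    obtain a where a: "\<And>i. a i \<in> R" "z = (\<Sum>i\<le>n. a i * v ^ i)" using n(1) by (auto simp: Q_def)
    obtain b where b: "\<And>i. b i \<in> R" "z = (\<Sum>i\<le>m. b i * inverse v ^ i)" using m(1) by (auto simp: Q_def)
    show False
    proof (cases "m \<le> n")
      case True
      have "\<exists>a'. (\<forall>i. a' i \<in> R) \<and> z = (\<Sum>i\<le>n'. a' i * v ^ i)"
        by (rule adjoin_reduce[OF sr unit AR(2) z0 v0 a(1) a(2)[unfolded S(1)] b True[unfolded S(1)] nz[OF b(1)]])
      thus False using n(2)[of n'] S by (simp add: Q_def)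
    next
      case False
      hence le: "n \<le> Suc m'" and v1: "inverse v \<noteq> 0" using S v0 by auto
      have a': "z = (\<Sum>j\<le>n. a j * inverse (inverse v) ^ j)" using a(2) by simp
      have "\<exists>a'. (\<forall>i. a' i \<in> R) \<and> z = (\<Sum>i\<le>m'. a' i * inverse v ^ i)"
        by (rule adjoin_reduce[OF sr unit AR(2) z0 v1 b(1) b(2)[unfolded S(2)] a(1) a' le nz[OF a(1)]])
      thus False using m(2)[of m'] S by (simp add: Q_def)
    qed
  qed
  thus ?thesis using sr RL zR AR by blast
qed


section \<open>Places of a function field\<close>

lemma is_subfield_function_field: "is_subfield (function_field u v)"
  unfolding is_subfield_def is_subring_def function_field_def
  by (intro conjI ballI InterI) (auto dest!: is_subfieldD is_subringD)

lemma function_field_gens: "emb c \<in> function_field u v" "u \<in> function_field u v" "v \<in> function_field u v"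
  by (auto simp: function_field_def)

lemma function_field_subset:
  assumes "is_subfield M" "\<And>c. emb c \<in> M" "u \<in> M" "v \<in> M"
  shows "function_field u v \<subseteq> M"
  using assms by (auto simp: function_field_def)

lemma function_field_eqI:
  assumes "u \<in> function_field u' v'" "v \<in> function_field u' v'"
    "u' \<in> function_field u v" "v' \<in> function_field u v"
  shows "function_field u v = function_field u' v'"
  using assms by (intro equalityI function_field_subset is_subfield_function_field function_field_gens)

locale place =
  fixes L :: "'k::field univ set" and R :: "'k univ set"
  assumes L: "is_subfield L" and R: "R \<in> places L"
begin

abbreviation "m \<equiv> max_ideal R"

lemma R_subring: "is_subring R"
  using R by (simp add: places_def)

lemmas R_closed = is_subringD[OF R_subring]

lemma emb_R: "emb c \<in> R" and R_L: "z \<in> R \<Longrightarrow> z \<in> L" and R_total: "z \<in> L \<Longrightarrow> z \<in> R \<or> inverse z \<in> R"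
  using R by (auto simp: places_def)

lemma numeral_R: "numeral n \<in> R"
  using emb_R[of "numeral n"] by (simp add: emb_simps)

lemma m_R: "z \<in> m \<Longrightarrow> z \<in> R"
  by (simp add: max_ideal_def)

lemma zero_m: "0 \<in> m"
  by (simp add: max_ideal_def R_closed)

lemma m_mult: "z \<in> m \<Longrightarrow> r \<in> R \<Longrightarrow> r * z \<in> m"
proof -
  assume z: "z \<in> m" and r: "r \<in> R"
  have "inverse z \<in> R" if "r * z \<noteq> 0" "inverse (r * z) \<in> R"
    using R_closed(4)[OF r that(2)] that(1) by (simp add: field_simps)
  thus ?thesis
    using z r by (auto simp: max_ideal_def R_closed)
qed

lemma m_mult': "z \<in> m \<Longrightarrow> r \<in> R \<Longrightarrow> z * r \<in> m"
  by (metis m_mult mult.commute)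

lemma one_notin_m: "1 \<notin> m"
  by (simp add: max_ideal_def R_closed)

lemma unitD: "z \<in> R \<Longrightarrow> z \<notin> m \<Longrightarrow> z \<noteq> 0 \<and> inverse z \<in> R \<and> inverse z \<notin> m"
  by (auto simp: max_ideal_def R_closed)

lemma unitI: "z \<noteq> 0 \<Longrightarrow> inverse z \<in> R \<Longrightarrow> z \<notin> m"
  by (auto simp: max_ideal_def)

lemma m_add: "z \<in> m \<Longrightarrow> w \<in> m \<Longrightarrow> z + w \<in> m"
proof -
  have *: "z + w \<in> m" if z: "z \<in> m" "w \<in> m" "w \<noteq> 0" "z / w \<in> R" for z w
  proof -
    have "z + w = (z / w + 1) * w" using that by (simp add: field_simps)
    thus ?thesis using that by (metis m_mult R_closed(1,5))
  qed
  assume z: "z \<in> m" "w \<in> m"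
  show ?thesis
  proof (cases "z = 0 \<or> w = 0")
    case False
    have "z / w \<in> L" using z m_R R_L is_subfieldD[OF L] by blast
    hence "z / w \<in> R \<or> w / z \<in> R" using R_total by fastforce
    thus ?thesis using *[of z w] *[of w z] z False by (auto simp: add.commute)
  qed (use z in auto)
qed

lemma m_uminus: "z \<in> m \<Longrightarrow> - z \<in> m"
  using m_mult[of z "-1"] R_closed by simp

lemma m_diff: "z \<in> m \<Longrightarrow> w \<in> m \<Longrightarrow> z - w \<in> m"
  using m_add[OF _ m_uminus, of z w] by simp

lemma unit_add: "z \<in> R \<Longrightarrow> z \<notin> m \<Longrightarrow> w \<in> m \<Longrightarrow> z + w \<in> R \<and> z + w \<notin> m"
  using m_diff[of "z + w" w] R_closed m_R by auto

lemma unit_mult: "z \<in> R \<Longrightarrow> z \<notin> m \<Longrightarrow> w \<in> R \<Longrightarrow> w \<notin> m \<Longrightarrow> z * w \<in> R \<and> z * w \<notin> m"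
proof -
  assume z: "z \<in> R" "z \<notin> m" and w: "w \<in> R" "w \<notin> m"
  have "inverse z \<in> R" using unitD z by blast
  hence "z * w \<in> m \<Longrightarrow> w \<in> m"
    using m_mult[of "z * w" "inverse z"] unitD[OF z] by (simp flip: mult.assoc)
  thus ?thesis using z w R_closed by blast
qed

lemma m_prime: "z * w \<in> m \<Longrightarrow> z \<in> R \<Longrightarrow> w \<in> R \<Longrightarrow> z \<in> m \<or> w \<in> m"
  using unit_mult by blast

lemma emb_unit: "c \<noteq> 0 \<Longrightarrow> emb c \<notin> m"
  using emb_R[of "inverse c"] by (intro unitI) (simp_all add: emb_inverse)

lemma inverse_m: "z \<in> L \<Longrightarrow> z \<notin> R \<Longrightarrow> inverse z \<in> m"
  using R_total[of z] R_closed(2) by (auto simp: max_ideal_def)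

lemma power2_m: "z \<in> L \<Longrightarrow> z ^ 2 \<in> m \<Longrightarrow> z \<in> m"
proof -
  assume z: "z \<in> L" "z ^ 2 \<in> m"
  have "z \<in> R"
  proof (rule ccontr)
    assume "z \<notin> R"
    hence "inverse z \<in> R" "z \<noteq> 0" using R_total z R_closed(2) by auto
    hence "inverse z ^ 2 * z ^ 2 \<in> m" using z R_closed by (intro m_mult) auto
    thus False using one_notin_m \<open>z \<noteq> 0\<close> by (simp flip: power_mult_distrib)
  qed
  thus ?thesis using m_prime[of z z] z by (auto simp: power2_eq_square)
qed

text \<open>If 1/z lies in R, so does A[1/z], and with it z.\<close>

lemma integrally_closed:
  assumes "z \<in> L" "z \<in> adjoin A (inverse z)" "A \<subseteq> R"
  shows "z \<in> R"
  using R_total[OF assms(1)] adjoin_subset[OF R_subring assms(3), of "inverse z"] assms by blast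

lemma ev_R: "x \<in> R \<Longrightarrow> ev p x \<in> R"
  by (induction p) (auto intro: R_closed emb_R)

end

text \<open>Converse of \<open>integrally_closed\<close>: a z that is not integral over A is
  excluded by the ring from \<open>valuation_ring_exists\<close>, which is a place because z makes
  it a proper subset of L.\<close>

lemma in_adjoin_if_in_places:
  fixes L :: "'k::field univ set"
  assumes "is_subfield L" "is_subring A" "range emb \<subseteq> A" "A \<subseteq> L" "z \<in> L"
    and "\<And>R. R \<in> places L \<Longrightarrow> A \<subseteq> R \<Longrightarrow> z \<in> R"
  shows "z \<in> adjoin A (inverse z)"
proof (rule ccontr)
  assume "z \<notin> adjoin A (inverse z)"
  then obtain R where "is_subring R" "A \<subseteq> R" "R \<subseteq> L" "z \<notin> R" "\<forall>v\<in>L. v \<in> R \<or> inverse v \<in> R"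
    using valuation_ring_exists assms by metis
  moreover from this have "R \<in> places L"
    using assms by (auto simp: places_def)
  ultimately show False using assms by blast
qed

section \<open>The function field of an elliptic curve in Weierstrass form\<close>

lemma function_field_quotient:
  assumes "z \<in> function_field u v"
  shows "\<exists>g h. eval2 emb h u v \<noteq> 0 \<and> z = eval2 emb g u v / eval2 emb h u v"
proof -
  define M where "M = {eval2 emb g u v / eval2 emb h u v | g h. eval2 emb h u v \<noteq> 0}"
  have M: "eval2 emb g u v / eval2 emb h u v \<in> M" if "eval2 emb h u v \<noteq> 0" for g h
    using that by (auto simp: M_def)
  have M1: "eval2 emb g u v \<in> M" for g
    using M[of 1 g] by (simp add: eval2.hom_1)
  have "is_subfield M"
    unfolding is_subfield_def is_subring_def
  proof (intro conjI ballI)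
    show "1 \<in> M" using M1[of 1] by (simp add: eval2.hom_1)
    fix z w assume "z \<in> M" "w \<in> M"
    then obtain g h g' h' where *: "z = eval2 emb g u v / eval2 emb h u v" "eval2 emb h u v \<noteq> 0"
      "w = eval2 emb g' u v / eval2 emb h' u v" "eval2 emb h' u v \<noteq> 0"
      by (auto simp: M_def)
    have "z - w = eval2 emb (g * h' - g' * h) u v / eval2 emb (h * h') u v"
      using *(2,4) unfolding *(1,3) by (simp add: eval2.hom_simps field_simps)
    moreover have "z * w = eval2 emb (g * g') u v / eval2 emb (h * h') u v"
      using *(2,4) unfolding *(1,3) by (simp add: eval2.hom_simps)
    ultimately show "z - w \<in> M" "z * w \<in> M"
      using M[of "h * h'" "g * h' - g' * h"] M[of "h * h'" "g * g'"] *(2,4) by (simp_all add: eval2.hom_mult)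
  next
    fix z assume "z \<in> M"
    then obtain g h where *: "z = eval2 emb g u v / eval2 emb h u v" "eval2 emb h u v \<noteq> 0"
      by (auto simp: M_def)
    show "inverse z \<in> M"
    proof (cases "z = 0")
      case True
      thus ?thesis using M1[of 0] by simp
    next
      case False
      thus ?thesis using * M[of g h] by simp
    qed
  qed
  moreover have "emb c \<in> M" "u \<in> M" "v \<in> M" for c
    using M1[of "[:[:c:]:]"] M1[of "[:[:0, 1:]:]"] M1[of "[:0, 1:]"] by (simp_all add: emb_simps)
  ultimately have "function_field u v \<subseteq> M"
    by (rule function_field_subset)
  hence "z \<in> M" using assms by blast
  thus ?thesis unfolding M_def by blast
qed

lemma monic_quadratic_reduce:
  fixes c0 c1 :: "'r::comm_ring_1"
  shows "\<exists>k p q. g = [:c0, c1, 1:] * k + [:p, q:]"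
proof (induction g)
  case 0
  show ?case by (rule exI[of _ 0], rule exI[of _ 0], rule exI[of _ 0]) simp
next
  case (pCons a g)
  then obtain k p q where g: "g = [:c0, c1, 1:] * k + [:p, q:]" by blast
  have "pCons a g = [:c0, c1, 1:] * (pCons 0 k + [:q:]) + [:a - c0 * q, p - c1 * q:]"
    unfolding g by (simp add: algebra_simps)
  thus ?case by blast
qed

lemma is_unit_if_dvd_const: "S dvd [:c:] \<Longrightarrow> c \<noteq> 0 \<Longrightarrow> is_unit (S :: 'k::field poly)"
  by (metis dvd_trans is_unit_pCons_iff dvd_field_iff)

text \<open>S divides the cubic and its derivative. Explicit combinations eliminate down to the
  constant \<alpha>^2 - 4 \<beta>, the discriminant of the quadratic factor \<open>G\<close>; that
  \<beta> is nonzero makes \<open>G\<close> coprime to the other factor x.\<close>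

lemma squarefree_cubic:
  fixes \<alpha> \<beta> :: "'k::field" and S :: "'k poly"
  assumes "\<beta> \<noteq> 0" "\<alpha>\<^sup>2 \<noteq> 4 * \<beta>" "S\<^sup>2 dvd [:0, \<beta>, \<alpha>, 1:]"
  shows "is_unit S"
proof -
  define G where "G = [:\<beta>, \<alpha>, 1:]"
  define G' where "G' = [:\<alpha>, 2:]"
  define F where "F = [:0, 1:] * G"
  obtain H where H: "F = S\<^sup>2 * H"
    using assms by (auto simp: F_def G_def elim!: dvdE)
  have F': "pderiv F = G + [:0, 1:] * G'"
    by (simp add: F_def G_def G'_def pderiv_pCons)
  have "pderiv F = S * (2 * pderiv S * H + S * pderiv H)"
    unfolding H by (simp add: pderiv_mult power2_eq_square algebra_simps)
  hence 1: "S dvd pderiv F" by (metis dvd_triv_left)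
  have 2: "S dvd F" unfolding H by (simp add: power2_eq_square)
  have "smult \<beta> G = pderiv F * G - F * G' - F * [:\<alpha>, 1:]"
    unfolding F' by (simp add: F_def G_def G'_def algebra_simps)
  hence "S dvd smult \<beta> G" using 1 2 by (metis dvd_diff dvd_mult2)
  hence 3: "S dvd G" using assms(1) by (simp add: dvd_smult_iff)
  have 4: "S dvd [:0, 1:] * G'" using 1 3 unfolding F' by (simp add: dvd_add_right_iff)
  have "smult \<beta> G' = G * G' - [:\<alpha>, 1:] * ([:0, 1:] * G')"
    by (simp add: G_def G'_def algebra_simps)
  hence "S dvd smult \<beta> G'" using 3 4 by (metis dvd_diff dvd_mult2 dvd_mult)
  hence 5: "S dvd G'" using assms(1) by (simp add: dvd_smult_iff)
  have "[:\<alpha>\<^sup>2 - 4 * \<beta>:] = G' * G' - 4 * G"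
    by (simp add: G_def G'_def algebra_simps power2_eq_square numeral_poly)
  hence "S dvd [:\<alpha>\<^sup>2 - 4 * \<beta>:]" using 3 5 by simp
  thus ?thesis using assms by (auto intro: is_unit_if_dvd_const)
qed

locale elliptic =
  fixes \<alpha> \<beta> :: "'k::{field_gcd,field_char_0}" and x y :: "'k univ"
  assumes y2: "y\<^sup>2 = x ^ 3 + emb \<alpha> * x\<^sup>2 + emb \<beta> * x"
    and transc: "transcendental x"
    and nonsing: "\<beta> \<noteq> 0" "\<alpha>\<^sup>2 \<noteq> 4 * \<beta>"
begin

definition F :: "'k poly" where "F = [:0, \<beta>, \<alpha>, 1:]"

abbreviation L :: "'k univ set" where "L \<equiv> function_field x y"

text \<open>Normal form in k[x, y]: squares of y are replaced by F(x). Its uniqueness is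
  \<open>el_eq_iff\<close>.\<close>

definition el :: "'k poly \<Rightarrow> 'k poly \<Rightarrow> 'k univ" where
  "el p q = ev p x + ev q x * y"

lemma ev_F: "ev F x = y\<^sup>2"
  unfolding y2 F_def by (simp add: algebra_simps power2_eq_square power3_eq_cube emb_simps)

lemma degree_F: "degree F = 3" and F_nz: "F \<noteq> 0"
  by (simp_all add: F_def)

lemma L_subfield: "is_subfield L" and x_L: "x \<in> L" and y_L: "y \<in> L" and emb_L: "emb c \<in> L"
  by (rule is_subfield_function_field function_field_gens)+

lemmas L_closed = is_subringD[OF is_subfieldD(1)[OF L_subfield]] is_subfieldD(2,3)[OF L_subfield]

lemma ev_L: "ev p x \<in> L"
  by (induction p) (auto intro: L_closed emb_L x_L)

lemma el_L: "el p q \<in> L"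
  unfolding el_def by (intro L_closed ev_L y_L)

lemma el_mult: "el p q * el p' q' = el (p * p' + q * q' * F) (p * q' + p' * q)"
  by (simp add: el_def ev.hom_simps ev_F algebra_simps power2_eq_square)

lemma el_add: "el p q + el p' q' = el (p + p') (q + q')"
  and el_diff: "el p q - el p' q' = el (p - p') (q - q')"
  by (simp_all add: el_def ev.hom_simps algebra_simps)

lemma el_norm: "el p q * el p (- q) = ev (p\<^sup>2 - q\<^sup>2 * F) x"
  by (simp add: el_def ev.hom_simps ev_F algebra_simps power2_eq_square)

text \<open>The two terms have degrees of different parity and cannot cancel. The numbers 2 deg p
  and 2 deg q + 3 are the pole orders at infinity of p(x) and q(x) y.\<close>

lemma degree_norm:
  "degree (p\<^sup>2 - q\<^sup>2 * F) = max (2 * degree p) (if q = 0 then 0 else 2 * degree q + 3)"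
proof (cases "q = 0")
  case False
  have "degree (q\<^sup>2 * F) = 2 * degree q + 3"
    using False by (simp add: degree_mult_eq F_nz degree_F degree_power_eq)
  moreover have "degree (p\<^sup>2) = 2 * degree p"
    by (cases "p = 0") (simp_all add: degree_power_eq)
  moreover have "2 * degree p \<noteq> 2 * degree q + 3" by presburger
  ultimately show ?thesis
    using False degree_add_eq_left[of "- (q\<^sup>2 * F)" "p\<^sup>2"] degree_add_eq_right[of "p\<^sup>2" "- (q\<^sup>2 * F)"]
    by (cases "2 * degree p < 2 * degree q + 3") (auto simp: max_def)
qed (cases "p = 0"; simp add: degree_power_eq)

lemma norm_eq_0_iff: "p\<^sup>2 - q\<^sup>2 * F = 0 \<longleftrightarrow> p = 0 \<and> q = 0"
proof
  assume 0: "p\<^sup>2 - q\<^sup>2 * F = 0"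
  hence "q = 0" using degree_norm[of p q] by (auto split: if_splits)
  thus "p = 0 \<and> q = 0" using 0 by simp
qed simp

lemma el_eq_0_iff: "el p q = 0 \<longleftrightarrow> p = 0 \<and> q = 0"
  using el_norm[of p q] norm_eq_0_iff[of p q]
  by (auto simp: transcendental_ev_eq_0_iff[OF transc] el_def)

lemma el_eq_iff: "el p q = el p' q' \<longleftrightarrow> p = p' \<and> q = q'"
  using el_eq_0_iff[of "p - p'" "q - q'"] by (simp flip: el_diff)

lemma eval2_linear: "eval2 emb [:p, q:] x y = el p q"
  by (simp add: el_def algebra_simps)

definition Wp :: "'k poly poly" where "Wp = [:- F, 0, 1:]"

lemma weierstrass_poly_eq: "weierstrass_poly (Weierstrass 0 \<alpha> 0 \<beta> 0) = Wp"
  by (simp add: weierstrass_poly_def F_def Wp_def power2_eq_square power3_eq_cube)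

lemma eval2_W: "eval2 emb Wp x y = 0" "eval2 emb Wp x (- y) = 0"
  by (simp_all add: Wp_def ev.hom_uminus ev_F power2_eq_square)

lemma eval2_reduce: "\<exists>k p q. g = Wp * k + [:p, q:] \<and> eval2 emb g x y = el p q"
proof -
  obtain k p q where "g = Wp * k + [:p, q:]"
    using monic_quadratic_reduce[of g "- F" 0] unfolding Wp_def by blast
  moreover from this have "eval2 emb g x y = el p q"
    by (simp only: eval2.hom_add eval2.hom_mult eval2_W eval2_linear mult_zero_left add_0)
  ultimately show ?thesis by blast
qed

lemma generic: "generic_point (weierstrass_poly (Weierstrass 0 \<alpha> 0 \<beta> 0)) x y"
  unfolding generic_point_def weierstrass_poly_eq
proof (intro allI iffI)
  fix g
  assume "eval2 emb g x y = 0"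
  thus "Wp dvd g" using eval2_reduce[of g] by (auto simp: el_eq_0_iff)
next
  fix g
  assume "Wp dvd g"
  thus "eval2 emb g x y = 0" using eval2_W by (auto simp: dvd_def eval2.hom_mult)
qed

text \<open>Conjugation y -> -y on the level of relations: a relation is a multiple of
  \<open>Wp\<close>, which contains y only through its square.\<close>

lemma eval2_conj: "eval2 emb g x y = 0 \<Longrightarrow> eval2 emb g x (- y) = 0"
  using generic eval2_W(2)
  by (auto simp: generic_point_def weierstrass_poly_eq dvd_def eval2.hom_mult)

text \<open>Multiplying by the conjugate turns the denominator into its norm, a polynomial in
  x.\<close>

lemma L_elem:
  assumes "z \<in> L"
  obtains p q r where "r \<noteq> 0" "z = el p q / ev r x"
proof -
  obtain p q p' q' where 1: "z = el p q / el p' q'" "el p' q' \<noteq> 0"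
    using function_field_quotient[OF assms] eval2_reduce by metis
  define r where "r = p'\<^sup>2 - q'\<^sup>2 * F"
  have r: "r \<noteq> 0" unfolding r_def using 1(2) norm_eq_0_iff[of p' q'] el_eq_0_iff[of p' q'] by blast
  have "el p' (- q') \<noteq> 0" using 1 by (simp add: el_eq_0_iff)
  hence "z = el p q * el p' (- q') / ev r x"
    using 1 r unfolding r_def el_norm[symmetric] by (simp add: field_simps)
  thus ?thesis using that[OF r] unfolding el_mult by blast
qed

lemma ev_x_subring: "is_subring (range (\<lambda>p. ev p x))"
  unfolding is_subring_def
  by (auto simp flip: ev.hom_diff ev.hom_mult intro: range_eqI[of _ _ 1])

lemma in_adjoin_ev_iff:
  assumes "z \<in> L" "z \<noteq> 0"
  shows "z \<in> adjoin (range (\<lambda>p. ev p x)) (inverse z) \<longleftrightarrow>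
    (\<exists>(n::nat) a. z ^ Suc n = (\<Sum>i\<le>n. ev (a i) x * z ^ (n - i)))"
proof -
  have *: "(z = (\<Sum>i\<le>n. ev (a i) x * inverse z ^ i)) \<longleftrightarrow> z ^ Suc n = (\<Sum>i\<le>n. ev (a i) x * z ^ (n - i))"
    for n :: nat and a
  proof -
    have "(z = (\<Sum>i\<le>n. ev (a i) x * inverse z ^ i)) \<longleftrightarrow> z ^ n * z = z ^ n * (\<Sum>i\<le>n. ev (a i) x * inverse z ^ i)"
      using assms by simp
    also have "z ^ n * (\<Sum>i\<le>n. ev (a i) x * inverse z ^ i) = (\<Sum>i\<le>n. ev (a i) x * z ^ (n - i))"
      unfolding sum_distrib_left
    proof (intro sum.cong refl)
      fix i assume "i \<in> {..n}"
      hence "z ^ n = z ^ i * z ^ (n - i)" by (simp flip: power_add)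
      thus "z ^ n * (ev (a i) x * inverse z ^ i) = ev (a i) x * z ^ (n - i)"
        using assms by (simp add: power_inverse)
    qed
    finally show ?thesis by (simp add: mult.commute)
  qed
  show ?thesis
  proof
    assume "z \<in> adjoin (range (\<lambda>p. ev p x)) (inverse z)"
    then obtain n :: nat and a where a: "\<And>i. a i \<in> range (\<lambda>p. ev p x)" "z = (\<Sum>i\<le>n. a i * inverse z ^ i)"
      by (rule adjoinE) blast
    from a(1) have "\<forall>i. \<exists>p. a i = ev p x" by blast
    then obtain a' where "\<forall>i. a i = ev (a' i) x" using choice[of "\<lambda>i p. a i = ev p x"] by blast
    hence "z = (\<Sum>i\<le>n. ev (a' i) x * inverse z ^ i)" using a(2) by simp
    thus "\<exists>(n::nat) a. z ^ Suc n = (\<Sum>i\<le>n. ev (a i) x * z ^ (n - i))" unfolding * by blast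
  next
    assume "\<exists>(n::nat) a. z ^ Suc n = (\<Sum>i\<le>n. ev (a i) x * z ^ (n - i))"
    then obtain n a where na: "z = (\<Sum>i\<le>n. ev (a i) x * inverse z ^ i)" using * by blast
    let ?A = "adjoin (range (\<lambda>p. ev p x)) (inverse z)"
    have A: "is_subring ?A" by (intro is_subring_adjoin ev_x_subring)
    have "(\<Sum>i\<le>n. ev (a i) x * inverse z ^ i) \<in> ?A"
      using subset_adjoin[OF ev_x_subring] in_adjoin[OF ev_x_subring]
      by (intro is_subring_sum[OF A] is_subringD[OF A]) auto
    thus "z \<in> ?A" using na by simp
  qed
qed

lemma integral_if_in_places:
  assumes "z \<in> L" "\<And>R. R \<in> places L \<Longrightarrow> x \<in> R \<Longrightarrow> z \<in> R"
  shows "z \<in> adjoin (range (\<lambda>p. ev p x)) (inverse z)"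
proof (rule in_adjoin_if_in_places[OF L_subfield ev_x_subring])
  show "range emb \<subseteq> range (\<lambda>p. ev p x)"
  proof
    fix z :: "'k univ" assume "z \<in> range emb"
    then obtain c where "z = ev [:c:] x" by auto
    thus "z \<in> range (\<lambda>p. ev p x)" by blast
  qed
  show "range (\<lambda>p. ev p x) \<subseteq> L" by (auto intro: ev_L)
  show "z \<in> L" by fact
  fix R assume "R \<in> places L" "range (\<lambda>p. ev p x) \<subseteq> R"
  moreover have "ev [:0, 1:] x = x" by (simp add: emb_simps)
  ultimately show "z \<in> R" using assms(2)[of R] by (metis rangeI subsetD)
qed

text \<open>The rational root argument: with P'/S' in lowest terms, the integral equation multiplied
  by S'^(n+1) shows that S' divides P'^(n+1).\<close>

lemma rational_in_places:
  assumes S: "S \<noteq> 0" and in_R: "\<And>R. R \<in> places L \<Longrightarrow> x \<in> R \<Longrightarrow> ev P x / ev S x \<in> R"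
  shows "\<exists>p. P = p * S"
proof (cases "P = 0")
  case False
  define z where "z = ev P x / ev S x"
  have nz: "ev P x \<noteq> 0" "ev S x \<noteq> 0" using False S by (simp_all add: transcendental_ev_eq_0_iff[OF transc])
  define g where "g = gcd P S"
  obtain P' S' where PS: "P = P' * g" "S = S' * g" "coprime P' S'"
    unfolding g_def using S gcd_coprime_exists[of P S] by auto
  have g: "g \<noteq> 0" using S by (simp add: g_def)
  hence z': "z = ev P' x / ev S' x" "ev S' x \<noteq> 0"
    using nz unfolding z_def PS by (auto simp: ev.hom_mult)
  have zL: "z \<in> L" unfolding z_def by (intro L_closed ev_L)
  have z0: "z \<noteq> 0" using nz by (simp add: z_def)
  obtain n :: nat and a where na: "z ^ Suc n = (\<Sum>i\<le>n. ev (a i) x * z ^ (n - i))"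
    using in_adjoin_ev_iff[OF zL z0] integral_if_in_places[OF zL in_R[folded z_def]] by blast
  have "ev (P' ^ Suc n) x = z ^ Suc n * ev S' x ^ Suc n"
    using z' by (simp add: ev.hom_power power_divide del: power_Suc)
  also have "\<dots> = (\<Sum>i\<le>n. ev (a i * P' ^ (n - i) * S' ^ Suc i) x)"
    unfolding na sum_distrib_right
  proof (intro sum.cong refl)
    fix i assume "i \<in> {..n}"
    hence "ev S' x ^ Suc n = ev S' x ^ (n - i) * ev S' x ^ Suc i" by (simp flip: power_add power_Suc)
    thus "ev (a i) x * z ^ (n - i) * ev S' x ^ Suc n = ev (a i * P' ^ (n - i) * S' ^ Suc i) x"
      using z' by (simp add: ev.hom_simps power_divide del: power_Suc)
  qed
  finally have "P' ^ Suc n = (\<Sum>i\<le>n. a i * P' ^ (n - i) * S' ^ Suc i)"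
    by (simp only: transcendental_ev_eq_iff[OF transc] flip: ev.hom_sum)
  also have "S' dvd \<dots>" by (intro dvd_sum) simp
  finally have "S' dvd P' ^ Suc n" .
  hence "is_unit S'" using PS(3) by (metis coprime_commute coprime_power_right_iff coprime_absorb_left)
  hence "S' dvd P'" by (rule unit_imp_dvd)
  thus ?thesis unfolding PS by (auto simp: dvd_def mult.commute mult.left_commute)
qed auto

text \<open>Trace and norm of z = (P + Q y) / S are integral over k[x], hence polynomials in x. This
  makes the square of the reduced denominator of Q/S divide the squarefree F, so k[x, y] is the
  integral closure of k[x].\<close>

lemma in_places_imp_el:
  assumes z: "z \<in> L" and in_R: "\<And>R. R \<in> places L \<Longrightarrow> x \<in> R \<Longrightarrow> z \<in> R"
  shows "\<exists>p q. z = el p q"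
proof (cases "z = 0")
  case True
  thus ?thesis using el_eq_0_iff[of 0 0] by auto
next
  case False
  obtain P Q S where S: "S \<noteq> 0" and zS: "z = el P Q / ev S x" using L_elem[OF z] .
  have evS: "ev S x \<noteq> 0" using S by (simp add: transcendental_ev_eq_0_iff[OF transc])
  define z' where "z' = el P (- Q) / ev S x"
  have z'L: "z' \<in> L" unfolding z'_def by (intro L_closed el_L ev_L)
  have z'0: "z' \<noteq> 0" using False evS by (auto simp: z'_def zS el_eq_0_iff)
  obtain n :: nat and a where na: "z ^ Suc n = (\<Sum>i\<le>n. ev (a i) x * z ^ (n - i))"
    using in_adjoin_ev_iff[OF z False] integral_if_in_places[OF z in_R] by blast
  \<comment> \<open>The integral equation of z with denominators cleared, as a polynomial in x and
    y; in this form \<open>eval2_conj\<close> carries it over to the conjugate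
    \<open>z'\<close>.\<close>
  define G where "G = [:P, Q:] ^ Suc n - (\<Sum>i\<le>n. [:a i * S ^ Suc i:] * [:P, Q:] ^ (n - i))"
  have G: "eval2 emb G x w = ev S x ^ Suc n * (Z ^ Suc n - (\<Sum>i\<le>n. ev (a i) x * Z ^ (n - i)))"
    if Z: "Z = (ev P x + w * ev Q x) / ev S x" for w Z
  proof -
    have 1: "eval2 emb [:P, Q:] x w = Z * ev S x" using Z evS by simp
    have "eval2 emb G x w = (Z * ev S x) ^ Suc n - (\<Sum>i\<le>n. ev (a i * S ^ Suc i) x * (Z * ev S x) ^ (n - i))"
      unfolding G_def eval2.hom_diff eval2.hom_sum eval2.hom_mult eval2.hom_power 1 by simp
    also have "(\<Sum>i\<le>n. ev (a i * S ^ Suc i) x * (Z * ev S x) ^ (n - i)) = (\<Sum>i\<le>n. ev S x ^ Suc n * (ev (a i) x * Z ^ (n - i)))"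
    proof (intro sum.cong refl)
      fix i assume "i \<in> {..n}"
      hence "ev S x ^ Suc n = ev S x ^ (n - i) * ev S x ^ Suc i" by (simp flip: power_add power_Suc)
      thus "ev (a i * S ^ Suc i) x * (Z * ev S x) ^ (n - i) = ev S x ^ Suc n * (ev (a i) x * Z ^ (n - i))"
        by (simp add: ev.hom_simps power_mult_distrib del: power_Suc)
    qed
    finally show ?thesis by (simp add: right_diff_distrib sum_distrib_left power_mult_distrib mult.commute del: power_Suc)
  qed
  have "eval2 emb G x y = 0"
    by (subst G[of z]) (use na in \<open>simp_all add: zS el_def mult.commute del: power_Suc\<close>)
  hence "eval2 emb G x (- y) = 0" by (rule eval2_conj)
  hence "ev S x ^ Suc n * (z' ^ Suc n - (\<Sum>i\<le>n. ev (a i) x * z' ^ (n - i))) = 0"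
    by (subst (asm) G[of z']) (simp_all add: z'_def el_def ev.hom_uminus mult.commute)
  hence "z' ^ Suc n = (\<Sum>i\<le>n. ev (a i) x * z' ^ (n - i))" using evS by simp
  hence int: "z' \<in> adjoin (range (\<lambda>p. ev p x)) (inverse z')"
    using in_adjoin_ev_iff[OF z'L z'0] by blast
  have z'R: "z' \<in> R" if "R \<in> places L" "x \<in> R" for R
  proof -
    interpret place L R using that by unfold_locales (auto intro: L_subfield)
    show ?thesis using int z'L that by (intro integrally_closed[OF z'L int]) (auto intro: ev_R)
  qed
  have "ev (2 * P) x / ev S x \<in> R" if pl: "R \<in> places L" "x \<in> R" for R
  proof -
    interpret place L R using that by unfold_locales (auto intro: L_subfield)
    have "ev (2 * P) x / ev S x = z + z'"
      by (simp add: zS z'_def el_def ev.hom_simps flip: add_divide_distrib)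
    thus ?thesis using z'R[OF pl] in_R[OF pl] R_closed by metis
  qed
  then obtain p where p: "2 * P = p * S" using rational_in_places[OF S] by blast
  have "ev (P\<^sup>2 - Q\<^sup>2 * F) x / ev (S\<^sup>2) x \<in> R" if pl: "R \<in> places L" "x \<in> R" for R
  proof -
    interpret place L R using that by unfold_locales (auto intro: L_subfield)
    have "ev (P\<^sup>2 - Q\<^sup>2 * F) x / ev (S\<^sup>2) x = z * z'"
      unfolding el_norm[symmetric] by (simp add: zS z'_def ev.hom_mult power2_eq_square)
    thus ?thesis using z'R[OF pl] in_R[OF pl] R_closed by metis
  qed
  then obtain h where h: "P\<^sup>2 - Q\<^sup>2 * F = h * S\<^sup>2" using rational_in_places[of "S\<^sup>2"] S by auto
  define p' where "p' = smult (1/2) p"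
  have P: "P = p' * S"
  proof -
    have "smult (1/2) (2 * P) = P" by (simp add: numeral_poly)
    thus ?thesis using p by (simp add: p'_def)
  qed
  obtain g Q' S' where QS: "Q = Q' * g" "S = S' * g" "coprime Q' S'" "g \<noteq> 0"
    using S gcd_coprime_exists[of Q S] by auto
  have "Q\<^sup>2 * F = (p'\<^sup>2 - h) * S\<^sup>2" using h unfolding P by (simp add: algebra_simps)
  hence "Q'\<^sup>2 * F * g\<^sup>2 = (p'\<^sup>2 - h) * S'\<^sup>2 * g\<^sup>2" unfolding QS by (simp add: algebra_simps)
  hence "Q'\<^sup>2 * F = (p'\<^sup>2 - h) * S'\<^sup>2" using QS(4) by simp
  hence "S'\<^sup>2 dvd Q'\<^sup>2 * F" by simp
  hence "S'\<^sup>2 dvd F" using QS(3) by (metis coprime_commute coprime_dvd_mult_right_iff coprime_power_left_iff coprime_power_right_iff)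
  hence "is_unit S'" using squarefree_cubic nonsing unfolding F_def by blast
  then obtain q where q: "Q' = q * S'" by (metis unit_imp_dvd dvdE mult.commute)
  have "z = el p' (q)"
    using evS unfolding zS P QS(1) q by (simp add: el_def ev.hom_mult QS(2) field_simps)
  thus ?thesis by blast
qed

end

lemma weierstrass_poly_pCons:
  "weierstrass_poly W = [:- [:wa6 W, wa4 W, wa2 W, 1:], [:wa3 W, wa1 W:], 1:]"
  by (simp add: weierstrass_poly_def power2_eq_square power3_eq_cube)

lemma eval2_weierstrass_poly:
  "eval2 emb (weierstrass_poly W) u v =
    v\<^sup>2 + emb (wa1 W) * u * v + emb (wa3 W) * v
      - (u ^ 3 + emb (wa2 W) * u\<^sup>2 + emb (wa4 W) * u + emb (wa6 W))"
  by (simp add: weierstrass_poly_pCons ev.hom_uminus emb_simps algebra_simps power2_eq_square power3_eq_cube)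

lemma generic_point_transcendental:
  fixes f :: "'k::field poly poly"
  assumes "generic_point f u v" "degree f > 0"
  shows "transcendental u"
  unfolding transcendental_def
proof (intro allI impI)
  fix p assume "ev p u = 0"
  hence "eval2 emb [:p:] u v = 0" by simp
  hence "f dvd [:p:]" using assms unfolding generic_point_def by blast
  hence "[:p:] = 0 \<or> degree f \<le> degree [:p:]" using dvd_imp_degree_le by blast
  thus "p = 0" using assms(2) by simp
qed

lemma transcendental_neq_emb:
  assumes "transcendental u"
  shows "u \<noteq> emb c"
proof
  assume "u = emb c"
  hence "ev [:- c, 1:] u = 0" by (simp add: emb_simps)
  hence "[:- c, 1:] = 0" using assms unfolding transcendental_def by blast
  thus False by simp
qed

lemma transcendental_nz: "transcendental u \<Longrightarrow> u \<noteq> 0"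
  using transcendental_neq_emb[of u 0] by (simp add: emb_simps)

section \<open>Pole orders at infinity\<close>

context elliptic
begin

text \<open>The pole order at infinity on k[x, y], where x has order 2 and y has order 3. The choice
  is unambiguous by uniqueness of the normal form; the value at 0 is 0.\<close>

definition dg :: "'k univ \<Rightarrow> nat" where
  "dg z = (SOME n. \<exists>p q. z = el p q \<and> n = max (2 * degree p) (if q = 0 then 0 else 2 * degree q + 3))"

lemma dg_el: "dg (el p q) = max (2 * degree p) (if q = 0 then 0 else 2 * degree q + 3)"
  unfolding dg_def by (rule some_equality) (auto simp: el_eq_iff)

definition B :: "'k univ set" where "B = {el p q | p q. True}"

lemma el_B: "el p q \<in> B"
  by (auto simp: B_def)

lemma emb_eq_el: "emb c = el [:c:] 0"
  by (simp add: el_def)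

lemma x_eq_el: "x = el [:0, 1:] 0" and y_eq_el: "y = el 0 1"
  by (simp_all add: el_def emb_simps)

lemma B_subring: "is_subring B"
  unfolding is_subring_def
proof (intro conjI ballI)
  show "1 \<in> B" using el_B[of 1 0] by (simp add: el_def)
  fix z w assume "z \<in> B" "w \<in> B"
  then obtain p q p' q' where e: "z = el p q" "w = el p' q'" by (auto simp: B_def)
  show "z - w \<in> B" "z * w \<in> B" unfolding e el_diff el_mult by (rule el_B)+
qed

lemmas B_closed = is_subringD[OF B_subring]

lemma emb_B: "emb c \<in> B" and x_B: "x \<in> B" and y_B: "y \<in> B"
  using el_B emb_eq_el x_eq_el y_eq_el by metis+

lemma dg_emb: "dg (emb c) = 0"
  by (simp add: emb_eq_el dg_el)

text \<open>By \<open>degree_norm\<close> the pole order is the degree of the norm, and the norm is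
  multiplicative.\<close>

lemma dg_mult:
  assumes "z \<in> B" "w \<in> B" "z \<noteq> 0" "w \<noteq> 0"
  shows "dg (z * w) = dg z + dg w"
proof -
  obtain p q p' q' where e: "z = el p q" "w = el p' q'" using assms by (auto simp: B_def)
  define p'' where "p'' = p * p' + q * q' * F"
  define q'' where "q'' = p * q' + p' * q"
  have m: "z * w = el p'' q''" by (simp add: e el_mult p''_def q''_def)
  have "p''\<^sup>2 - q''\<^sup>2 * F = (p\<^sup>2 - q\<^sup>2 * F) * (p'\<^sup>2 - q'\<^sup>2 * F)"
    by (simp add: p''_def q''_def algebra_simps power2_eq_square)
  moreover have "p\<^sup>2 - q\<^sup>2 * F \<noteq> 0" "p'\<^sup>2 - q'\<^sup>2 * F \<noteq> 0"
    using assms(3,4) unfolding e norm_eq_0_iff el_eq_0_iff by simp_all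
  ultimately have "degree (p''\<^sup>2 - q''\<^sup>2 * F) = degree (p\<^sup>2 - q\<^sup>2 * F) + degree (p'\<^sup>2 - q'\<^sup>2 * F)"
    by (simp add: degree_mult_eq)
  thus ?thesis unfolding m unfolding e dg_el degree_norm .
qed

lemma dg_add_le:
  assumes "z \<in> B" "w \<in> B"
  shows "dg (z + w) \<le> max (dg z) (dg w)"
proof -
  obtain p q p' q' where e: "z = el p q" "w = el p' q'" using assms by (auto simp: B_def)
  show ?thesis
    unfolding e el_add dg_el
    using degree_add_le_max[of p p'] degree_add_le_max[of q q'] by (auto simp: max_def split: if_splits)
qed

lemma dg_uminus: "z \<in> B \<Longrightarrow> dg (- z) = dg z"
proof -
  assume "z \<in> B"
  then obtain p q where "z = el p q" by (auto simp: B_def)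
  moreover from this have "- z = el (- p) (- q)" by (simp add: el_def ev.hom_uminus)
  ultimately show ?thesis by (simp add: dg_el)
qed

lemma dg_add_eq:
  assumes "z \<in> B" "w \<in> B" "dg w < dg z"
  shows "dg (z + w) = dg z"
proof (rule antisym)
  show "dg (z + w) \<le> dg z" using dg_add_le[OF assms(1,2)] assms(3) by simp
  have "dg (z + w + - w) \<le> max (dg (z + w)) (dg w)"
    using dg_add_le[of "z + w" "- w"] dg_uminus[of w] assms B_closed by simp
  thus "dg z \<le> dg (z + w)" using assms by simp
qed

lemma dg_eq_0D: "z \<in> B \<Longrightarrow> dg z = 0 \<Longrightarrow> \<exists>c. z = emb c"
proof -
  assume "z \<in> B" "dg z = 0"
  then obtain p q where z: "z = el p q" and "degree p = 0" "q = 0"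
    by (auto simp: B_def dg_el max_def split: if_splits)
  then obtain c where "p = [:c:]" by (auto elim: degree_eq_zeroE)
  thus ?thesis using \<open>q = 0\<close> by (auto simp: z el_def)
qed

lemma ev_B: "w \<in> B \<Longrightarrow> ev p w \<in> B"
  by (induction p) (auto intro: B_closed emb_B)

lemma dg_ev:
  assumes w: "w \<in> B" "transcendental w" "p \<noteq> 0"
  shows "dg (ev p w) = degree p * dg w"
  using assms(3)
proof (induction p)
  case (pCons a p)
  have w0: "w \<noteq> 0" using transcendental_nz w(2) .
  have wpos: "dg w > 0"
  proof (rule ccontr)
    assume "\<not> dg w > 0"
    thus False using dg_eq_0D[OF w(1)] transcendental_neq_emb[OF w(2)] by auto
  qed
  show ?case
  proof (cases "p = 0")
    case True
    thus ?thesis by (simp add: dg_emb)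
  next
    case False
    have nz: "ev p w \<noteq> 0" using w(2) False by (simp add: transcendental_ev_eq_0_iff)
    have "dg (w * ev p w) = dg w + degree p * dg w"
      using dg_mult[OF w(1) ev_B[OF w(1)] w0 nz] pCons.IH[OF False] by simp
    moreover have "dg (w * ev p w + emb a) = dg (w * ev p w)"
      by (rule dg_add_eq) (use w wpos in \<open>auto intro: B_closed ev_B emb_B simp: calculation dg_emb\<close>)
    ultimately show ?thesis using False by (simp add: add.commute)
  qed
qed simp

end

text \<open>The order of the pole at infinity of \<open>x'\<close> and \<open>y'\<close> is \<open>2k\<close> and \<open>3k\<close>; all elements of the
  field they generate have pole order divisible by \<open>k\<close>, which forces \<open>k = 1\<close>.\<close>

locale elliptic_change = elliptic +
  fixes W x' y'
  assumes W: "generic_point (weierstrass_poly W) x' y'"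
    and field_eq: "function_field x' y' = L"
    and places_eq: "R \<in> places L \<Longrightarrow> x' \<in> R \<longleftrightarrow> x \<in> R"
begin

lemma transc': "transcendental x'"
  by (rule generic_point_transcendental[OF W]) (simp add: weierstrass_poly_pCons)

lemma W_eq: "eval2 emb (weierstrass_poly W) x' y' = 0"
  using W by (simp add: generic_point_def)

lemma W_eq': "y'\<^sup>2 + (emb (wa1 W) * x' + emb (wa3 W)) * y' =
    x' ^ 3 + (emb (wa2 W) * x'\<^sup>2 + emb (wa4 W) * x' + emb (wa6 W))"
  using W_eq unfolding eval2_weierstrass_poly by (simp add: algebra_simps)

lemma x'_L: "x' \<in> L" and y'_L: "y' \<in> L"
  unfolding field_eq[symmetric] by (rule function_field_gens)+

lemma x'_B: "x' \<in> B"
  using in_places_imp_el[OF x'_L] places_eq by (auto simp: B_def)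

text \<open>A pole of y' where x' is finite would, after division of the Weierstrass equation by
  y'^2, put 1 in the maximal ideal.\<close>

lemma y'_B: "y' \<in> B"
proof -
  have "y' \<in> R" if pl: "R \<in> places L" "x \<in> R" for R
  proof (rule ccontr)
    assume "y' \<notin> R"
    interpret place L R using pl by unfold_locales (auto intro: L_subfield)
    have x': "x' \<in> R" using places_eq pl by simp
    define i where "i = inverse y'"
    have i: "i \<in> m" using inverse_m[OF y'_L \<open>y' \<notin> R\<close>] by (simp add: i_def)
    have y'0: "y' \<noteq> 0" using \<open>y' \<notin> R\<close> R_closed by auto
    define c1 where "c1 = emb (wa1 W) * x' + emb (wa3 W)"
    define c0 where "c0 = x' ^ 3 + (emb (wa2 W) * x'\<^sup>2 + emb (wa4 W) * x' + emb (wa6 W))"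
    have c: "c0 \<in> R" "c1 \<in> R" unfolding c0_def c1_def by (intro R_closed emb_R x')+
    have "(y'\<^sup>2 + c1 * y') * i\<^sup>2 = c0 * i\<^sup>2" using W_eq' by (simp add: c0_def c1_def)
    hence "1 + c1 * i = c0 * i * i"
      using y'0 by (simp add: i_def power2_eq_square field_simps)
    hence "1 = (c0 * i) * i - c1 * i" by (simp add: algebra_simps)
    moreover have "(c0 * i) * i - c1 * i \<in> m"
      using i c m_R by (intro m_diff m_mult R_closed) auto
    ultimately show False using one_notin_m by simp
  qed
  thus ?thesis using in_places_imp_el[OF y'_L] by (auto simp: B_def)
qed

lemma dg_x'_pos: "dg x' > 0"
  using dg_eq_0D[OF x'_B] transcendental_neq_emb[OF transc'] by auto

lemma dg_x'y': "3 * dg x' = 2 * dg y'" and y'_nz: "y' \<noteq> 0"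
proof -
  define r where "r = emb (wa2 W) * x'\<^sup>2 + emb (wa4 W) * x' + emb (wa6 W)"
  define l where "l = emb (wa1 W) * x' + emb (wa3 W)"
  have rB: "r \<in> B" and lB: "l \<in> B" unfolding r_def l_def by (intro B_closed emb_B x'_B)+
  have r: "r = ev [:wa6 W, wa4 W, wa2 W:] x'" and l: "l = ev [:wa3 W, wa1 W:] x'"
    by (simp_all add: r_def l_def algebra_simps power2_eq_square)
  have deg: "dg r \<le> 2 * dg x'" "dg l \<le> dg x'"
  proof -
    have *: "dg (ev p x') \<le> n * dg x'" if "degree p \<le> n" for p n
      using that dg_ev[OF x'_B transc', of p] dg_emb[of 0] by (cases "p = 0") (auto simp: emb_simps)
    show "dg r \<le> 2 * dg x'" unfolding r by (intro *) (simp add: degree_pCons_le le_trans[OF degree_pCons_le])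
    show "dg l \<le> dg x'" unfolding l using *[of "[:wa3 W, wa1 W:]" 1] by simp
  qed
  have x3: "dg (x' ^ 3) = 3 * dg x'"
    using dg_ev[OF x'_B transc', of "monom 1 3"]
    by (simp add: degree_monom_eq monom_altdef ev.hom_power emb_simps degree_power_eq)
  have "dg (x' ^ 3 + r) = 3 * dg x'"
    unfolding x3[symmetric] by (rule dg_add_eq) (use deg dg_x'_pos rB x'_B x3 in \<open>auto intro: B_closed\<close>)
  hence lhs: "dg (y' * y' + l * y') = 3 * dg x'"
    using W_eq' by (simp add: r_def l_def power2_eq_square)
  show y0: "y' \<noteq> 0"
  proof
    assume "y' = 0"
    thus False using lhs dg_x'_pos dg_emb[of 0] by (simp add: emb_simps)
  qed
  have yy: "dg (y' * y') = 2 * dg y'" using dg_mult[OF y'_B y'_B y0 y0] by simp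
  have ly: "dg (l * y') \<le> dg x' + dg y'"
    using dg_mult[OF lB y'_B _ y0] deg dg_emb[of 0] by (cases "l = 0") (auto simp: emb_simps)
  have B2: "y' * y' \<in> B" "l * y' \<in> B" by (intro B_closed y'_B lB)+
  \<comment> \<open>Otherwise the left side of the equation would have order at most 2 dg x', which
    is less than 3 dg x'.\<close>
  have "dg x' < dg y'"
    using dg_add_le[OF B2] ly yy dg_x'_pos unfolding lhs by (auto simp: max_def split: if_splits)
  hence "dg (y' * y' + l * y') = dg (y' * y')" using B2 ly yy by (intro dg_add_eq) auto
  thus "3 * dg x' = 2 * dg y'" using lhs yy by simp
qed

lemma dg_x'y'_eq: "dg x' = 2 \<and> dg y' = 3"
proof -
  \<comment> \<open>By 3 dg x' = 2 dg y' this difference satisfies dg x' = 2k and dg y' =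
    3k.\<close>
  define k where "k = dg y' - dg x'"
  have k: "dg x' = 2 * k" "dg y' = 3 * k" using dg_x'y' by (auto simp: k_def)
  have kpos: "k > 0" using dg_x'_pos k by simp
  have C_B: "eval2 emb g x' y' \<in> B" for g
    by (induction g) (auto intro!: B_closed x'_B y'_B ev_B)
  \<comment> \<open>Modulo the equation every polynomial is p(x') + q(x') y', with terms of orders k
    (2 deg p) and k (2 deg q + 3). These differ by parity, so the larger one is the order of the
    sum.\<close>
  have C: "k dvd dg (eval2 emb g x' y')" for g
  proof -
    obtain h p q where "g = weierstrass_poly W * h + [:p, q:]"
      using monic_quadratic_reduce unfolding weierstrass_poly_pCons by blast
    hence g: "eval2 emb g x' y' = ev p x' + ev q x' * y'"
      by (simp add: eval2.hom_add eval2.hom_mult W_eq mult.commute)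
    have P: "dg (ev p x') = degree p * (2 * k)" if "p \<noteq> 0"
      using dg_ev[OF x'_B transc' that] k by simp
    have Q: "dg (ev q x' * y') = degree q * (2 * k) + 3 * k" if "q \<noteq> 0"
      using dg_ev[OF x'_B transc' that] k dg_mult[OF ev_B[OF x'_B] y'_B _ y'_nz, of q] that
      by (simp add: transcendental_ev_eq_0_iff[OF transc'])
    have B2: "ev p x' \<in> B" "ev q x' * y' \<in> B" by (intro B_closed y'_B ev_B x'_B)+
    consider "p = 0" "q = 0" | "p = 0" "q \<noteq> 0" | "p \<noteq> 0" "q = 0" | "p \<noteq> 0" "q \<noteq> 0" by blast
    thus ?thesis
    proof cases
      case 1
      thus ?thesis using dg_emb[of 0] by (simp add: g emb_simps)
    next
      case 4
      have "degree p * (2 * k) = k * (2 * degree p)" "degree q * (2 * k) + 3 * k = k * (2 * degree q + 3)"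
        by (simp_all add: algebra_simps)
      moreover have "2 * degree p \<noteq> 2 * degree q + 3" by presburger
      ultimately have "dg (ev p x') \<noteq> dg (ev q x' * y')"
        using P[OF 4(1)] Q[OF 4(2)] kpos by (metis mult_cancel1 less_not_refl)
      then consider "dg (ev p x') < dg (ev q x' * y')" | "dg (ev q x' * y') < dg (ev p x')" by linarith
      thus ?thesis
      proof cases
        case 1
        thus ?thesis using dg_add_eq[OF B2(2,1) 1] Q[OF 4(2)] by (simp add: g add.commute)
      next
        case 2
        thus ?thesis using dg_add_eq[OF B2 2] P[OF 4(1)] by (simp add: g)
      qed
    qed (use P Q in \<open>auto simp: g\<close>)
  qed
  \<comment> \<open>Elements of k[x, y] are quotients of elements of k[x', y'], and orders are
    additive. Applied to x and y this gives that k divides 2 and 3.\<close>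
  have dvd: "k dvd dg z" if "z \<in> B" "z \<noteq> 0" for z
  proof -
    have "z \<in> function_field x' y'" using that el_L unfolding field_eq B_def by auto
    then obtain g h where gh: "eval2 emb h x' y' \<noteq> 0" "z = eval2 emb g x' y' / eval2 emb h x' y'"
      using function_field_quotient by blast
    hence "dg (z * eval2 emb h x' y') = dg z + dg (eval2 emb h x' y')"
      using that C_B by (intro dg_mult) auto
    moreover have "z * eval2 emb h x' y' = eval2 emb g x' y'" using gh by simp
    ultimately show ?thesis using C[of g] C[of h] by (metis dvd_add_left_iff)
  qed
  have x0: "x \<noteq> 0" using transcendental_nz transc .
  have y0: "y \<noteq> 0" using el_eq_0_iff[of 0 1] by (simp flip: y_eq_el)
  have dx: "dg x = 2" using dg_el[of "[:0, 1:]" 0] by (simp flip: x_eq_el)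
  have dy: "dg y = 3" using dg_el[of 0 1] by (simp flip: y_eq_el)
  have "k dvd 2" using dvd[OF x_B x0] dx by simp
  moreover have "k dvd 3" using dvd[OF y_B y0] dy by simp
  ultimately have "k dvd 3 - 2" by (intro dvd_diff_nat)
  thus ?thesis using k by simp
qed

text \<open>Pole order 2 leaves only linear polynomials in x; pole order 3 leaves a multiple of y
  plus a linear polynomial in x.\<close>

lemma affine_change:
  obtains p r g d e where "p \<noteq> 0" "g \<noteq> 0" "x' = emb p * x + emb r" "y' = emb g * y + emb d * x + emb e"
proof -
  have lin: "\<exists>a b. s = [:b, a:] \<and> (degree s = 1 \<longrightarrow> a \<noteq> 0)" if "degree s \<le> 1" for s :: "'a poly"
  proof -
    have "s = [:coeff s 0, coeff s 1:]"
      using that by (intro poly_eqI) (auto simp: coeff_pCons coeff_eq_0 split: nat.splits)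
    thus ?thesis by (metis coeff_pCons_0 coeff_pCons_Suc degree_pCons_0 pCons_0_0 zero_neq_one One_nat_def)
  qed
  obtain P Q where x': "x' = el P Q" using x'_B by (auto simp: B_def)
  hence "Q = 0" "degree P = 1"
    using dg_x'y'_eq dg_el[of P Q] by (auto simp: max_def split: if_splits)
  then obtain p r where P: "P = [:r, p:]" "p \<noteq> 0" using lin[of P] by auto
  obtain P' Q' where y': "y' = el P' Q'" using y'_B by (auto simp: B_def)
  have d3: "max (2 * degree P') (if Q' = 0 then 0 else 2 * degree Q' + 3) = 3"
    using dg_x'y'_eq dg_el[of P' Q'] by (simp add: y')
  have Q0: "Q' \<noteq> 0"
  proof
    assume "Q' = 0"
    hence "2 * degree P' = 3" using d3 by simp
    thus False by presburger
  qed
  hence "degree Q' = 0" "degree P' \<le> 1" using d3 by (auto simp: max_def split: if_splits)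
  then obtain d e g where P': "P' = [:e, d:]" "Q' = [:g:]" using lin[of P'] by (auto elim!: degree_eq_zeroE)
  show ?thesis
  proof (rule that[of p g r d e])
    show "g \<noteq> 0" using Q0 P' by simp
    show "x' = emb p * x + emb r" using \<open>Q = 0\<close> by (simp add: x' P el_def algebra_simps)
    show "y' = emb g * y + emb d * x + emb e" by (simp add: y' P' el_def algebra_simps)
  qed (use P in auto)
qed

lemma discriminant_change: "\<exists>u. u \<noteq> 0 \<and> discriminant W = u ^ 12 * (16 * \<beta>\<^sup>2 * (\<alpha>\<^sup>2 - 4 * \<beta>))"
proof -
  obtain p r g d e where pg: "p \<noteq> 0" "g \<noteq> 0" and x': "x' = emb p * x + emb r"
    and y': "y' = emb g * y + emb d * x + emb e"
    by (rule affine_change)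
  define a1 where "a1 = wa1 W" define a2 where "a2 = wa2 W" define a3 where "a3 = wa3 W"
  define a4 where "a4 = wa4 W" define a6 where "a6 = wa6 W"
  note a_defs = a1_def a2_def a3_def a4_def a6_def
  define A where "A = [:r, p:]"
  define C where "C = [:e, d:]"
  have x'A: "x' = ev A x" by (simp add: x' A_def algebra_simps)
  have y'C: "y' = emb g * y + ev C x" by (simp add: y' C_def algebra_simps)
  \<comment> \<open>P + Q y is the equation of W after the substitution, reduced by
    \<open>y\<^sup>2 = F(x)\<close>; it vanishes only if P and Q do.\<close>
  define P where "P = smult (g\<^sup>2) F + C\<^sup>2 + smult a1 (A * C) + smult a3 C
    - (A ^ 3 + smult a2 (A\<^sup>2) + smult a4 A + [:a6:])"
  define Q where "Q = smult g (smult 2 C + smult a1 A + [:a3:])"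
  have "el P Q = eval2 emb (weierstrass_poly W) x' y'"
    unfolding eval2_weierstrass_poly el_def P_def Q_def y'C a_defs[symmetric]
    unfolding x'A
    by (simp add: ev.hom_simps ev_smult emb_simps ev_F algebra_simps power2_eq_square)
  hence "P = 0" "Q = 0" using W_eq el_eq_0_iff by auto
  have Q0: "2 * e + a1 * r + a3 = 0" and Q1: "2 * d + a1 * p = 0"
  proof -
    have "[:2 * e + a1 * r + a3, 2 * d + a1 * p:] = 0"
      using \<open>Q = 0\<close> pg by (simp add: Q_def A_def C_def)
    thus "2 * e + a1 * r + a3 = 0" "2 * d + a1 * p = 0" by simp_all
  qed
  have cf: "poly P z = 0" for z using \<open>P = 0\<close> by simp
  have "P = [:e\<^sup>2 + a1 * r * e + a3 * e - (r ^ 3 + a2 * r\<^sup>2 + a4 * r + a6),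
      g\<^sup>2 * \<beta> + 2 * d * e + a1 * (r * d + p * e) + a3 * d - (3 * p * r\<^sup>2 + a2 * 2 * p * r + a4 * p),
      g\<^sup>2 * \<alpha> + d\<^sup>2 + a1 * p * d - (3 * p\<^sup>2 * r + a2 * p\<^sup>2),
      g\<^sup>2 - p ^ 3:]"
    unfolding P_def F_def A_def C_def
    by (simp add: power2_eq_square power3_eq_cube algebra_simps)
  from this[unfolded \<open>P = 0\<close>, symmetric] have c0: "e\<^sup>2 + a1 * r * e + a3 * e - (r ^ 3 + a2 * r\<^sup>2 + a4 * r + a6) = 0"
    and c1: "g\<^sup>2 * \<beta> + 2 * d * e + a1 * (r * d + p * e) + a3 * d - (3 * p * r\<^sup>2 + a2 * 2 * p * r + a4 * p) = 0"
    and c2: "g\<^sup>2 * \<alpha> + d\<^sup>2 + a1 * p * d - (3 * p\<^sup>2 * r + a2 * p\<^sup>2) = 0"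
    and c3: "g\<^sup>2 = p ^ 3"
    unfolding pCons_eq_0_iff right_minus_eq by blast+
  \<comment> \<open>These are the coefficients of 4 x^3 + b2 x^2 + 2 b4 x + b6, which arises by
    completing the square in y. They depend only on p and r: d and e drop out.\<close>
  define b2 where "b2 = a1\<^sup>2 + 4 * a2"
  define b4 where "b4 = 2 * a4 + a1 * a3"
  define b6 where "b6 = a3\<^sup>2 + 4 * a6"
  have "p\<^sup>2 * b2 = p\<^sup>2 * (4 * (p * \<alpha> - 3 * r))"
  proof -
    have "p\<^sup>2 * b2 - p\<^sup>2 * (4 * (p * \<alpha> - 3 * r)) = (2 * d + a1 * p)\<^sup>2
        - 4 * (p ^ 3 * \<alpha> + d\<^sup>2 + a1 * p * d - (3 * p\<^sup>2 * r + a2 * p\<^sup>2))"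
      by (simp add: b2_def algebra_simps power2_eq_square power3_eq_cube)
    thus ?thesis using c2[unfolded c3] Q1 by simp
  qed
  hence b2: "b2 = 4 * (p * \<alpha> - 3 * r)" using pg by simp
  have "p * (2 * b4) = p * (4 * (p\<^sup>2 * \<beta> - 3 * r\<^sup>2) - 2 * b2 * r)"
  proof -
    have "p * (2 * b4) - p * (4 * (p\<^sup>2 * \<beta> - 3 * r\<^sup>2) - 2 * b2 * r) =
        2 * (2 * d + a1 * p) * (2 * e + a1 * r + a3) - 4 * (p ^ 3 * \<beta> + 2 * d * e
          + a1 * (r * d + p * e) + a3 * d - (3 * p * r\<^sup>2 + a2 * 2 * p * r + a4 * p))"
      by (simp add: b2_def b4_def algebra_simps power2_eq_square power3_eq_cube)
    thus ?thesis using c1[unfolded c3] Q1 by simp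
  qed
  hence "2 * b4 = 4 * (p\<^sup>2 * \<beta> - 3 * r\<^sup>2) - 2 * b2 * r" using pg by simp
  hence "2 * b4 = 2 * (2 * (p\<^sup>2 * \<beta> - 3 * r\<^sup>2) - b2 * r)" by (simp add: algebra_simps)
  hence b4: "b4 = 2 * (p\<^sup>2 * \<beta> - 3 * r\<^sup>2) - b2 * r"
    unfolding mult_cancel_left by simp
  have b6: "b6 = - (4 * r ^ 3 + b2 * r\<^sup>2 + 2 * b4 * r)"
  proof -
    have "b6 - - (4 * r ^ 3 + b2 * r\<^sup>2 + 2 * b4 * r) = (2 * e + a1 * r + a3)\<^sup>2
        - 4 * (e\<^sup>2 + a1 * r * e + a3 * e - (r ^ 3 + a2 * r\<^sup>2 + a4 * r + a6))"
      by (simp add: b2_def b4_def b6_def algebra_simps power2_eq_square power3_eq_cube)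
    thus ?thesis using c0 Q0 by simp
  qed
  define b8 where "b8 = a1^2 * a6 + 4 * a2 * a6 - a1 * a3 * a4 + a2 * a3^2 - a4^2"
  have b8: "4 * b8 = b2 * b6 - b4\<^sup>2"
    by (simp add: b8_def b2_def b4_def b6_def algebra_simps power2_eq_square)
  \<comment> \<open>The factor 4 allows \<open>b8\<close> to be eliminated through 4 b8 = b2 b6 -
    b4^2.\<close>
  have "4 * discriminant W = - (b2\<^sup>2 * (4 * b8)) - 32 * b4 ^ 3 - 108 * b6\<^sup>2 + 36 * b2 * b4 * b6"
    by (simp add: discriminant_def Let_def b2_def b4_def b6_def b8_def a_defs algebra_simps)
  also have "\<dots> = 4 * (p ^ 6 * (16 * \<beta>\<^sup>2 * (\<alpha>\<^sup>2 - 4 * \<beta>)))"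
    unfolding b8 b6 b4 b2 by (simp add: algebra_simps power_numeral_reduce)
  finally have disc: "discriminant W = p ^ 6 * (16 * \<beta>\<^sup>2 * (\<alpha>\<^sup>2 - 4 * \<beta>))" by simp
  \<comment> \<open>Since \<open>g\<^sup>2 = p ^ 3\<close>, the number p is a square, so its sixth
    power is a twelfth power.\<close>
  have "p = (g / p)\<^sup>2" using c3 pg by (simp add: power_divide power2_eq_square power3_eq_cube)
  hence "p ^ 6 = ((g / p)\<^sup>2) ^ 6" by (rule arg_cong)
  also have "\<dots> = (g / p) ^ 12" by (simp only: power_mult[symmetric]) simp
  finally have "p ^ 6 = (g / p) ^ 12" .
  thus ?thesis using disc pg by (intro exI[of _ "g / p"]) simp
qed

end

section \<open>The invariant derivation and the regular differentials\<close>

lemma pderiv_sum: "pderiv (sum f A) = (\<Sum>i\<in>A. pderiv (f i))"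
  by (induction A rule: infinite_finite_induct) (simp_all add: pderiv_add)

lemma root_factor: "poly p a = 0 \<Longrightarrow> \<exists>s. p = [:- a, 1:] * (s :: 'a::idom poly)"
  unfolding poly_eq_0_iff_dvd dvd_def .

lemma map_poly_pderiv_add: "map_poly pderiv (g + h) = map_poly pderiv g + map_poly pderiv (h :: 'a::idom poly poly)"
  by (rule poly_eqI) (simp add: coeff_map_poly pderiv_add)

lemma map_poly_pderiv_mult:
  "map_poly pderiv (g * h) = map_poly pderiv g * h + g * map_poly pderiv (h :: 'a::idom poly poly)"
  by (rule poly_eqI)
    (simp add: coeff_map_poly coeff_mult pderiv_sum pderiv_mult sum.distrib, simp add: mult.commute add.commute)

context elliptic
begin

text \<open>The vector field 2y d/dx + F'(x) d/dy: \<open>map_poly pderiv\<close> differentiates in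
  the inner variable x, \<open>pderiv\<close> in y. It annihilates \<open>y\<^sup>2 - F\<close>, so
  it is tangent to the curve.\<close>

definition nabla :: "'k poly poly \<Rightarrow> 'k univ" where
  "nabla g = eval2 emb (map_poly pderiv g) x y * (2 * y) + eval2 emb (pderiv g) x y * ev (pderiv F) x"

lemma nabla_add: "nabla (g + h) = nabla g + nabla h"
  by (simp add: nabla_def map_poly_pderiv_add pderiv_add eval2.hom_add algebra_simps)

lemma nabla_mult: "nabla (g * h) = nabla g * eval2 emb h x y + eval2 emb g x y * nabla h"
  by (simp add: nabla_def map_poly_pderiv_mult pderiv_mult eval2.hom_add eval2.hom_mult algebra_simps)

lemma nabla_const: "nabla [:[:c:]:] = 0"
  by (simp add: nabla_def pderiv_pCons map_poly_pCons)

lemma nabla_uminus: "nabla (- g) = - nabla g"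
proof -
  have "[:[:-1:]:] * g = - g" by (rule poly_eqI) simp
  thus ?thesis using nabla_mult[of "[:[:-1:]:]" g] by (simp add: nabla_const emb_simps)
qed

lemma nabla_diff: "nabla (g - h) = nabla g - nabla h"
  using nabla_add[of g "- h"] by (simp add: nabla_uminus)

lemma nabla_eq_0: "eval2 emb g x y = 0 \<Longrightarrow> nabla g = 0"
proof -
  assume "eval2 emb g x y = 0"
  then obtain k where g: "g = Wp * k"
    using generic by (auto simp: generic_point_def weierstrass_poly_eq dvd_def)
  have "map_poly pderiv Wp = [:- pderiv F:]" "pderiv Wp = [:0, 2:]"
    by (simp_all add: Wp_def map_poly_pCons pderiv_minus pderiv_pCons)
  hence "nabla Wp = 0" by (simp add: nabla_def ev.hom_uminus ev.hom_numeral)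
  thus ?thesis by (simp add: g nabla_mult eval2_W)
qed

definition Der :: "'k univ \<Rightarrow> 'k univ" where
  "Der z = (SOME d. \<exists>g h. eval2 emb h x y \<noteq> 0 \<and> z = eval2 emb g x y / eval2 emb h x y \<and>
     d = (nabla g * eval2 emb h x y - eval2 emb g x y * nabla h) / (eval2 emb h x y)\<^sup>2)"

text \<open>If g/h = g'/h' on the curve, then g h' - g' h vanishes there, and so does
  \<open>nabla\<close> of it. This makes the quotient rule independent of the chosen
  fraction.\<close>

lemma Der_quotient:
  assumes "eval2 emb h x y \<noteq> 0"
  shows "Der (eval2 emb g x y / eval2 emb h x y) =
    (nabla g * eval2 emb h x y - eval2 emb g x y * nabla h) / (eval2 emb h x y)\<^sup>2"
  unfolding Der_def
proof (rule some_equality)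
  fix d
  assume "\<exists>g' h'. eval2 emb h' x y \<noteq> 0 \<and> eval2 emb g x y / eval2 emb h x y = eval2 emb g' x y / eval2 emb h' x y \<and>
    d = (nabla g' * eval2 emb h' x y - eval2 emb g' x y * nabla h') / (eval2 emb h' x y)\<^sup>2"
  then obtain g' h' where h': "eval2 emb h' x y \<noteq> 0"
    and eq: "eval2 emb g x y / eval2 emb h x y = eval2 emb g' x y / eval2 emb h' x y"
    and d: "d = (nabla g' * eval2 emb h' x y - eval2 emb g' x y * nabla h') / (eval2 emb h' x y)\<^sup>2"
    by blast
  define G where "G = eval2 emb g x y" define H where "H = eval2 emb h x y"
  define G' where "G' = eval2 emb g' x y" define H' where "H' = eval2 emb h' x y"
  have nz: "H \<noteq> 0" "H' \<noteq> 0" using assms h' by (simp_all add: H_def H'_def)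
  have e: "G * H' = G' * H" using eq nz by (simp add: G_def H_def G'_def H'_def field_simps)
  hence "nabla (g * h' - g' * h) = 0"
    by (intro nabla_eq_0) (simp add: eval2.hom_simps G_def H_def G'_def H'_def)
  hence n: "nabla g * H' + G * nabla h' = nabla g' * H + G' * nabla h"
    by (simp add: nabla_diff nabla_mult G_def H_def G'_def H'_def)
  define r where "r = G / H"
  have G: "G = r * H" "G' = r * H'" using e nz by (simp_all add: r_def field_simps)
  have "(nabla g' * H' - G' * nabla h') * H\<^sup>2 = (nabla g * H - G * nabla h) * H'\<^sup>2"
  proof -
    have "(nabla g' * H' - G' * nabla h') * H\<^sup>2 = H * H' * ((nabla g' * H + G' * nabla h) - r * H' * nabla h - r * H * nabla h')"
      unfolding G by (simp add: algebra_simps power2_eq_square)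
    also have "\<dots> = H * H' * ((nabla g * H' + G * nabla h') - r * H' * nabla h - r * H * nabla h')"
      by (simp only: n)
    also have "\<dots> = (nabla g * H - G * nabla h) * H'\<^sup>2"
      unfolding G by (simp add: algebra_simps power2_eq_square)
    finally show ?thesis .
  qed
  thus "d = (nabla g * eval2 emb h x y - eval2 emb g x y * nabla h) / (eval2 emb h x y)\<^sup>2"
    using nz unfolding d G_def[symmetric] H_def[symmetric] G'_def[symmetric] H'_def[symmetric]
    by (simp add: frac_eq_eq)
qed (use assms in blast)

lemma eval2_L: "eval2 emb g x y \<in> L"
  by (induction g) (auto intro!: L_closed x_L y_L ev_L)

lemma nabla_L: "nabla g \<in> L"
  unfolding nabla_def mult_2 by (intro L_closed eval2_L ev_L y_L)

lemma Der_eval2: "Der (eval2 emb g x y) = nabla g"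
  using Der_quotient[of 1 g] nabla_const[of 1] by (simp add: eval2.hom_1 flip: one_pCons)

lemma derivation_Der: "derivation_on L Der"
  unfolding derivation_on_def
proof (intro conjI ballI allI)
  fix z assume "z \<in> L"
  then obtain g h where z: "eval2 emb h x y \<noteq> 0" "z = eval2 emb g x y / eval2 emb h x y"
    using function_field_quotient by blast
  show "Der z \<in> L"
    unfolding z(2) Der_quotient[OF z(1)] by (intro L_closed eval2_L nabla_L)
next
  fix c
  show "Der (emb c) = 0" using Der_eval2[of "[:[:c:]:]"] by (simp add: nabla_const)
next
  fix z w assume "z \<in> L" "w \<in> L"
  then obtain g h g' h' where z: "eval2 emb h x y \<noteq> 0" "z = eval2 emb g x y / eval2 emb h x y"
    and w: "eval2 emb h' x y \<noteq> 0" "w = eval2 emb g' x y / eval2 emb h' x y"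
    using function_field_quotient by meson
  define G H G' H' where "G = eval2 emb g x y" and "H = eval2 emb h x y"
    and "G' = eval2 emb g' x y" and "H' = eval2 emb h' x y"
  note GH = this
  have nz: "H \<noteq> 0" "H' \<noteq> 0" using z w by (simp_all add: GH)
  have hh: "eval2 emb (h * h') x y \<noteq> 0" using z w by (simp add: eval2.hom_mult)
  have Dz: "Der z = (nabla g * H - G * nabla h) / H\<^sup>2" and Dw: "Der w = (nabla g' * H' - G' * nabla h') / H'\<^sup>2"
    unfolding z(2) w(2) Der_quotient[OF z(1)] Der_quotient[OF w(1)] by (simp_all add: GH)
  have "z + w = eval2 emb (g * h' + g' * h) x y / eval2 emb (h * h') x y"
    using z w by (simp add: eval2.hom_simps add_frac_eq)
  hence "Der (z + w) = ((nabla g * H' + G * nabla h' + (nabla g' * H + G' * nabla h)) * (H * H')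
      - (G * H' + G' * H) * (nabla h * H' + H * nabla h')) / (H * H')\<^sup>2"
    by (simp only: Der_quotient[OF hh] nabla_add nabla_mult) (simp add: eval2.hom_add eval2.hom_mult GH)
  also have "\<dots> = ((nabla g * H - G * nabla h) * H'\<^sup>2 + (nabla g' * H' - G' * nabla h') * H\<^sup>2) / (H * H')\<^sup>2"
    by (rule arg_cong2[where f = "(/)"]) (simp_all add: algebra_simps power2_eq_square)
  also have "\<dots> = Der z + Der w"
    using nz unfolding Dz Dw by (simp add: add_frac_eq power_mult_distrib)
  finally show "Der (z + w) = Der z + Der w" .
  have "z * w = eval2 emb (g * g') x y / eval2 emb (h * h') x y"
    using z w by (simp add: eval2.hom_simps)
  hence "Der (z * w) = ((nabla g * G' + G * nabla g') * (H * H')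
      - (G * G') * (nabla h * H' + H * nabla h')) / (H * H')\<^sup>2"
    by (simp only: Der_quotient[OF hh] nabla_mult) (simp add: eval2.hom_mult GH)
  also have "\<dots> = ((nabla g * H - G * nabla h) * (G' * H') + (G * H) * (nabla g' * H' - G' * nabla h')) / (H * H')\<^sup>2"
    by (rule arg_cong2[where f = "(/)"]) (simp_all add: algebra_simps power2_eq_square)
  also have "\<dots> = Der z * (G' / H') + (G / H) * Der w"
    using nz unfolding Dz Dw by (simp add: add_divide_distrib power2_eq_square mult_ac)
  finally show "Der (z * w) = Der z * w + z * Der w" by (simp add: z(2) w(2) GH)
qed

lemma Der_x: "Der x = 2 * y"
  using Der_eval2[of "[:[:0, 1:]:]"] by (simp add: nabla_def map_poly_pCons pderiv_pCons emb_simps)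

end

section \<open>Derivations and local parameters at a place\<close>

locale elliptic_derivation = elliptic +
  fixes D
  assumes deriv: "derivation_on L D" and D_x: "D x = 2 * y"
begin

lemma D_emb: "D (emb c) = 0"
  and D_add: "z \<in> L \<Longrightarrow> w \<in> L \<Longrightarrow> D (z + w) = D z + D w"
  and D_mult: "z \<in> L \<Longrightarrow> w \<in> L \<Longrightarrow> D (z * w) = D z * w + z * D w"
  using deriv by (auto simp: derivation_on_def)

lemma D_inverse: "z \<in> L \<Longrightarrow> z \<noteq> 0 \<Longrightarrow> D (inverse z) = - (D z * inverse z * inverse z)"
proof -
  assume z: "z \<in> L" "z \<noteq> 0"
  have "D (z * inverse z) = D z * inverse z + z * D (inverse z)"
    by (intro D_mult L_closed z)
  moreover have "D (z * inverse z) = 0" using D_emb[of 1] z by (simp add: emb_simps)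
  ultimately have *: "z * D (inverse z) = - (D z * inverse z)"
    by (simp add: eq_neg_iff_add_eq_0 add.commute)
  have "D (inverse z) = inverse z * (z * D (inverse z))" using z by simp
  thus ?thesis unfolding * by simp
qed

lemma D_ev: "D (ev p x) = ev (pderiv p) x * (2 * y)"
proof (induction p)
  case 0
  show ?case using D_emb[of 0] by (simp add: emb_simps)
next
  case (pCons a p)
  have "D (ev (pCons a p) x) = D (emb a) + D (x * ev p x)"
    unfolding ev_pCons by (intro D_add L_closed emb_L x_L ev_L)
  also have "D (x * ev p x) = D x * ev p x + x * D (ev p x)"
    by (intro D_mult x_L ev_L)
  finally show ?case
    by (simp add: D_emb D_x pCons.IH pderiv_pCons ev.hom_add algebra_simps)
qed

lemma y_nz: "y \<noteq> 0"
  using el_eq_0_iff[of 0 1] by (simp flip: y_eq_el)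

lemma D_y: "D y = ev (pderiv F) x"
proof -
  have "D (y * y) = D y * y + y * D y" by (intro D_mult y_L)
  moreover have "D (y * y) = ev (pderiv F) x * (2 * y)"
    using D_ev[of F] by (simp add: ev_F power2_eq_square)
  ultimately have "D y * y + y * D y = ev (pderiv F) x * (2 * y)" by (rule trans[OF sym])
  moreover have "D y * y + y * D y = D y * (2 * y)" by (simp add: algebra_simps)
  ultimately have "D y * (2 * y) = ev (pderiv F) x * (2 * y)" by metis
  thus ?thesis using y_nz mult_right_cancel[of "2 * y" "D y" "ev (pderiv F) x"] by simp
qed

lemma y_in_place:
  assumes "R \<in> places L" "x \<in> R"
  shows "y \<in> R"
proof (rule ccontr)
  assume "y \<notin> R"
  interpret place L R using assms by unfold_locales (auto intro: L_subfield)
  have "inverse y \<in> m" using inverse_m y_L \<open>y \<notin> R\<close> .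
  hence "ev F x * inverse y * inverse y \<in> m"
    by (intro m_mult R_closed ev_R assms) (auto intro: m_R)
  moreover have "ev F x * inverse y * inverse y = 1" using y_nz by (simp add: ev_F power2_eq_square field_simps)
  ultimately show False using one_notin_m by simp
qed

end

locale elliptic_place = elliptic_derivation + place "function_field x y" R for R +
  assumes algebraically_closed: "degree (p :: 'a poly) \<noteq> 0 \<Longrightarrow> \<exists>z. poly p z = 0"
    and x_R: "x \<in> R"
begin

lemma y_R: "y \<in> R"
  using y_in_place R x_R by blast

lemma el_R: "el p q \<in> R"
  unfolding el_def by (intro R_closed ev_R x_R y_R)

text \<open>Some function is not in R; its denominator r(x) must lie in the maximal ideal. That
  ideal is prime and r splits into linear factors, so one of these lies in it.\<close>

lemma ex_x0: "\<exists>x0. x - emb x0 \<in> m"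
proof -
  have root: "\<exists>x0. x - emb x0 \<in> m" if "r \<noteq> 0" "ev r x \<in> m" for r
    using that
  proof (induction "degree r" arbitrary: r)
    case 0
    then obtain c where "r = [:c:]" "c \<noteq> 0" by (auto elim: degree_eq_zeroE)
    thus ?case using 0 emb_unit[of c] by simp
  next
    case (Suc n)
    then obtain z where "poly r z = 0" using algebraically_closed[of r] by auto
    then obtain s where s: "r = [:- z, 1:] * s" using root_factor by blast
    have "s \<noteq> 0" using Suc s by auto
    hence "degree r = Suc (degree s)" unfolding s by (subst degree_mult_eq) auto
    moreover have "(x - emb z) * ev s x \<in> m"
      using Suc.prems(2) unfolding s ev.hom_mult by (simp add: emb_simps)
    hence "x - emb z \<in> m \<or> ev s x \<in> m"
      by (rule m_prime) (intro R_closed x_R emb_R ev_R)+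
    ultimately show ?case using Suc.hyps \<open>s \<noteq> 0\<close> by auto
  qed
  obtain z where z: "z \<in> L" "z \<notin> R" using R by (auto simp: places_def)
  obtain p q r where r: "r \<noteq> 0" "z = el p q / ev r x" using L_elem[OF z(1)] .
  have "ev r x \<in> m"
  proof (rule ccontr)
    assume "ev r x \<notin> m"
    hence "inverse (ev r x) \<in> R" using unitD ev_R x_R by blast
    hence "z \<in> R" unfolding r(2) field_class.field_divide_inverse by (intro R_closed el_R)
    thus False using z by simp
  qed
  thus ?thesis using root r by blast
qed

definition x0 where "x0 = (SOME x0. x - emb x0 \<in> m)"

lemma x0: "x - emb x0 \<in> m"
  unfolding x0_def using ex_x0 by (rule someI_ex)

lemma ev_x0: "ev p x - emb (poly p x0) \<in> m"
proof (induction p)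
  case 0
  show ?case by (simp add: zero_m emb_simps)
next
  case (pCons a p)
  have "ev (pCons a p) x - emb (poly (pCons a p) x0) =
    ev p x * (x - emb x0) + emb x0 * (ev p x - emb (poly p x0))"
    by (simp add: emb_simps algebra_simps)
  also have "\<dots> \<in> m" by (intro m_add m_mult x0 pCons.IH ev_R x_R emb_R)
  finally show ?case .
qed

lemma ex_y0: "\<exists>y0. y - emb y0 \<in> m \<and> y0\<^sup>2 = poly F x0"
proof -
  obtain z where z: "z\<^sup>2 = poly F x0"
    using algebraically_closed[of "[:- poly F x0, 0, 1:]"] by (auto simp: power2_eq_square)
  have "(y - emb z) * (y + emb z) = ev F x - emb (poly F x0)"
    by (simp add: ev_F emb_simps algebra_simps power2_eq_square flip: z)
  also have "\<dots> \<in> m" by (rule ev_x0)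
  finally have "y - emb z \<in> m \<or> y + emb z \<in> m"
    by (rule m_prime) (intro R_closed y_R emb_R)+
  thus ?thesis
  proof
    assume "y + emb z \<in> m"
    thus ?thesis using z by (intro exI[of _ "- z"]) (simp add: emb_simps)
  qed (use z in auto)
qed

definition y0 where "y0 = (SOME y0. y - emb y0 \<in> m \<and> y0\<^sup>2 = poly F x0)"

lemma y0: "y - emb y0 \<in> m" "y0\<^sup>2 = poly F x0"
  using someI_ex[OF ex_y0] by (simp_all flip: y0_def)

text \<open>On k[x, y], reduction modulo the maximal ideal is evaluation at the point (x0, y0), and
  nonzero constants are units.\<close>

lemma el_in_m_iff: "el p q \<in> m \<longleftrightarrow> poly p x0 + poly q x0 * y0 = 0"
proof -
  define c where "c = poly p x0 + poly q x0 * y0"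
  have "el p q - emb c = (ev p x - emb (poly p x0)) + (emb y0 * (ev q x - emb (poly q x0)) + ev q x * (y - emb y0))"
    by (simp add: el_def c_def emb_simps algebra_simps)
  also have "\<dots> \<in> m" by (intro m_add m_mult ev_x0 emb_R ev_R x_R y0)
  finally have *: "el p q - emb c \<in> m" .
  have "el p q \<in> m \<longleftrightarrow> emb c \<in> m"
    using m_diff[OF _ *, of "el p q"] m_add[OF *, of "emb c"] by auto
  also have "\<dots> \<longleftrightarrow> c = 0" using emb_unit[of c] zero_m by (auto simp: emb_simps)
  finally show ?thesis by (simp add: c_def)
qed

lemma ev_in_m_iff: "ev p x \<in> m \<longleftrightarrow> poly p x0 = 0"
  using el_in_m_iff[of p 0] by (simp add: el_def)

text \<open>The part of R that D maps into R. It is closed under sums, products and inverses of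
  units; the goal is that it is all of R.\<close>

definition O' where "O' = {z \<in> R. D z \<in> R}"

lemma O_R: "z \<in> O' \<Longrightarrow> z \<in> R"
  by (simp add: O'_def)

lemma O_mult: "z \<in> O' \<Longrightarrow> w \<in> O' \<Longrightarrow> z * w \<in> O'"
  using R_L by (auto simp: O'_def D_mult intro!: R_closed)

lemma O_add: "z \<in> O' \<Longrightarrow> w \<in> O' \<Longrightarrow> z + w \<in> O'"
  using R_L by (auto simp: O'_def D_add intro!: R_closed)

lemma O_inverse: "z \<in> O' \<Longrightarrow> z \<notin> m \<Longrightarrow> inverse z \<in> O'"
  using R_L unitD[of z] by (auto simp: O'_def D_inverse intro!: R_closed)

lemma O_one: "1 \<in> O'"
  using D_emb[of 1] R_closed by (simp add: O'_def emb_simps)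

lemma O_power: "z \<in> O' \<Longrightarrow> z ^ n \<in> O'"
  by (induction n) (auto intro: O_one O_mult)

lemma two_y_R: "2 * y \<in> R"
  by (intro R_closed numeral_R y_R)

lemma O_ev: "ev p x \<in> O'"
  by (auto simp: O'_def D_ev intro!: R_closed ev_R x_R two_y_R)

lemma O_y: "y \<in> O'"
  by (auto simp: O'_def D_y intro!: y_R ev_R x_R)

lemma O_el: "el p q \<in> O'"
  unfolding el_def by (intro O_add O_mult O_ev O_y)

definition F1 where "F1 = F div [:- x0, 1:]"

lemma F1: "y0 = 0 \<Longrightarrow> F = [:- x0, 1:] * F1 \<and> poly F1 x0 \<noteq> 0"
proof -
  assume "y0 = 0"
  hence "[:- x0, 1:] dvd F" using y0(2) by (simp add: poly_eq_0_iff_dvd)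
  hence F: "F = [:- x0, 1:] * F1" unfolding F1_def by (rule dvd_mult_div_cancel[symmetric])
  moreover have "poly F1 x0 \<noteq> 0"
  proof
    assume "poly F1 x0 = 0"
    hence "[:- x0, 1:] dvd F1" by (simp add: poly_eq_0_iff_dvd)
    hence "[:- x0, 1:]\<^sup>2 dvd F" unfolding power2_eq_square by (subst F) (intro mult_dvd_mono dvd_refl)
    thus False using squarefree_cubic[of \<beta> \<alpha> "[:- x0, 1:]"] nonsing by (auto simp: F_def is_unit_pCons_iff)
  qed
  ultimately show ?thesis by simp
qed

text \<open>At a point with y0 = 0, x - x0 is y^2 divided by the unit F1(x), so y is the parameter;
  elsewhere x - x0 is. The derivative of the parameter has value F'(x0) = F1(x0) or 2 y0, nonzero in
  either case.\<close>

definition \<pi> where "\<pi> = (if y0 = 0 then y else x - emb x0)"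

lemma ev_linear: "ev [:- x0, 1:] x = x - emb x0"
  by (simp add: emb_simps)

lemma \<pi>_m: "\<pi> \<in> m" and \<pi>_O: "\<pi> \<in> O'" and \<pi>_nz: "\<pi> \<noteq> 0"
proof -
  show "\<pi> \<in> m" using x0 y0(1) by (auto simp: \<pi>_def emb_simps)
  show "\<pi> \<in> O'" using O_y O_ev[of "[:- x0, 1:]"] unfolding ev_linear by (simp add: \<pi>_def)
  show "\<pi> \<noteq> 0" using y_nz transcendental_neq_emb[OF transc] by (simp add: \<pi>_def)
qed

lemma D_\<pi>_unit: "D \<pi> \<in> R \<and> D \<pi> \<notin> m"
proof (cases "y0 = 0")
  case True
  have "pderiv F = F1 + [:- x0, 1:] * pderiv F1"
    using F1[OF True] by (metis (no_types, lifting) pderiv_mult pderiv_pCons pderiv_0 pderiv_1 add.commute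
      mult.commute mult_1 one_pCons pCons_0_0 add_0)
  hence "poly (pderiv F) x0 \<noteq> 0" using F1[OF True] by simp
  thus ?thesis using True by (simp add: \<pi>_def D_y ev_in_m_iff ev_R x_R)
next
  case False
  have "D (x - emb x0) = 2 * y"
    using D_ev[of "[:- x0, 1:]"] unfolding ev_linear by (simp add: pderiv_pCons emb_simps)
  moreover have "2 * y = el 0 2" by (simp add: el_def ev.hom_numeral)
  ultimately show ?thesis using False el_in_m_iff[of 0 2] using two_y_R by (simp add: \<pi>_def)
qed

text \<open>An integer power of \<pi> times a unit of \<open>O'\<close>, the exponent being the
  difference j - i of two naturals. Once all nonzero functions have this shape, membership in R is
  decided by the sign of the exponent.\<close>

definition rep where "rep z \<longleftrightarrow> (\<exists>i j \<epsilon>. z * \<pi> ^ i = \<pi> ^ j * \<epsilon> \<and> \<epsilon> \<in> O' \<and> \<epsilon> \<notin> m)"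

lemma rep_unit: "z \<in> O' \<Longrightarrow> z \<notin> m \<Longrightarrow> rep z"
  unfolding rep_def by (rule exI[of _ 0], rule exI[of _ 0]) auto

lemma rep_\<pi>: "rep \<pi>"
  unfolding rep_def by (rule exI[of _ 0], rule exI[of _ 1], rule exI[of _ 1]) (auto simp: O_one one_notin_m)

lemma rep_mult: "rep z \<Longrightarrow> rep w \<Longrightarrow> rep (z * w)"
proof -
  assume "rep z" "rep w"
  then obtain i j e i' j' e' where *: "z * \<pi> ^ i = \<pi> ^ j * e" "e \<in> O'" "e \<notin> m"
    "w * \<pi> ^ i' = \<pi> ^ j' * e'" "e' \<in> O'" "e' \<notin> m"
    unfolding rep_def by blast
  have "(z * w) * \<pi> ^ (i + i') = (z * \<pi> ^ i) * (w * \<pi> ^ i')"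
    by (simp add: power_add algebra_simps)
  also have "\<dots> = \<pi> ^ (j + j') * (e * e')" unfolding * by (simp add: power_add algebra_simps)
  finally show ?thesis unfolding rep_def using * O_mult unit_mult O_R by blast
qed

lemma rep_inverse: "rep z \<Longrightarrow> z \<noteq> 0 \<Longrightarrow> rep (inverse z)"
proof -
  assume "rep z" "z \<noteq> 0"
  then obtain i j e where *: "z * \<pi> ^ i = \<pi> ^ j * e" "e \<in> O'" "e \<notin> m"
    unfolding rep_def by blast
  have e: "e \<noteq> 0" using * zero_m by auto
  have "inverse z * \<pi> ^ j = \<pi> ^ i * inverse e"
    using *(1) \<open>z \<noteq> 0\<close> e by (simp add: field_simps)
  moreover have "inverse e \<notin> m" using unitD * O_R by blast
  ultimately show ?thesis unfolding rep_def using * O_inverse by blast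
qed

lemma rep_x: "rep (x - emb x0)"
proof (cases "y0 = 0")
  case True
  have "ev F1 x \<notin> m" using F1[OF True] by (simp add: ev_in_m_iff)
  hence u: "inverse (ev F1 x) \<in> O'" "inverse (ev F1 x) \<notin> m" and nz: "ev F1 x \<noteq> 0"
    using O_inverse[OF O_ev] unitD[OF ev_R[OF x_R]] by blast+
  have "y * y = (x - emb x0) * ev F1 x"
    using ev_F F1[OF True] by (metis ev.hom_mult ev_linear power2_eq_square)
  hence "x - emb x0 = y * y * inverse (ev F1 x)" using nz by simp
  thus ?thesis using rep_mult[OF rep_mult[OF rep_\<pi> rep_\<pi>] rep_unit[OF u]] True by (simp add: \<pi>_def)
next
  case False
  thus ?thesis using rep_\<pi> by (simp add: \<pi>_def)
qed

lemma rep_ev: "p \<noteq> 0 \<Longrightarrow> rep (ev p x)"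
proof (induction "degree p" arbitrary: p rule: less_induct)
  case less
  show ?case
  proof (cases "poly p x0 = 0")
    case False
    thus ?thesis by (intro rep_unit O_ev) (simp add: ev_in_m_iff)
  next
    case True
    then obtain s where s: "p = [:- x0, 1:] * s" using root_factor by blast
    have s0: "s \<noteq> 0" using less s by auto
    hence "degree p = Suc (degree s)" unfolding s by (subst degree_mult_eq) auto
    hence "rep (ev s x)" using less s0 by simp
    thus ?thesis unfolding s ev.hom_mult ev_linear by (intro rep_mult rep_x)
  qed
qed

text \<open>A common factor x - x0 of p and q is split off by induction. If p + q y still vanishes
  at the point, then either y0 = 0 and a factor y splits off with a unit left over, or the conjugate
  p - q y is a unit and the norm is handled by \<open>rep_ev\<close>.\<close>

lemma rep_el: "p \<noteq> 0 \<or> q \<noteq> 0 \<Longrightarrow> rep (el p q)"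
proof (induction "degree p + degree q" arbitrary: p q rule: less_induct)
  case less
  have nz: "el p q \<noteq> 0" using less.prems by (auto simp: el_eq_0_iff)
  consider "el p q \<notin> m" | "poly p x0 = 0" "poly q x0 = 0" |
    "el p q \<in> m" "\<not> (poly p x0 = 0 \<and> poly q x0 = 0)" by blast
  thus ?case
  proof cases
    case 1
    thus ?thesis by (intro rep_unit O_el)
  next
    case 2
    then obtain s t where st: "p = [:- x0, 1:] * s" "q = [:- x0, 1:] * t" using root_factor by meson
    have deg: "degree ([:- x0, 1:] * w) = (if w = 0 then 0 else Suc (degree w))" for w
      by (cases "w = 0") (auto simp: degree_mult_eq simp del: mult_pCons_left)
    have st0: "s \<noteq> 0 \<or> t \<noteq> 0" using less.prems st by auto
    hence "degree s + degree t < degree p + degree q" unfolding st deg by auto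
    hence "rep (el s t)" using less.hyps st0 by blast
    moreover have "el p q = (x - emb x0) * el s t"
      unfolding st el_def ev.hom_mult ev_linear by (simp add: algebra_simps)
    ultimately show ?thesis using rep_mult rep_x by simp
  next
    case 3
    hence v: "poly p x0 + poly q x0 * y0 = 0" by (simp add: el_in_m_iff)
    show ?thesis
    proof (cases "y0 = 0")
      case True
      hence p0: "poly p x0 = 0" and q0: "poly q x0 \<noteq> 0" using v 3 by auto
      then obtain s where s: "p = [:- x0, 1:] * s" using root_factor by blast
      have F1m: "ev F1 x \<notin> m" using F1[OF True] by (simp add: ev_in_m_iff)
      hence u: "inverse (ev F1 x) \<in> O'" and F1nz: "ev F1 x \<noteq> 0"
        using O_inverse[OF O_ev] unitD[OF ev_R[OF x_R]] by blast+
      have "y * y = (x - emb x0) * ev F1 x"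
        using ev_F F1[OF True] by (metis ev.hom_mult ev_linear power2_eq_square)
      hence "x - emb x0 = y * y * inverse (ev F1 x)" using F1nz by simp
      hence "el p q = (y * y * inverse (ev F1 x)) * ev s x + ev q x * y"
        unfolding s el_def ev.hom_mult ev_linear by (rule arg_cong)
      hence "el p q = y * (ev q x + (ev s x * inverse (ev F1 x)) * y)"
        by (simp add: algebra_simps)
      moreover have "ev q x + (ev s x * inverse (ev F1 x)) * y \<notin> m"
        using \<pi>_m True u O_R q0
        by (intro conjunct2[OF unit_add] m_mult R_closed ev_R x_R) (auto simp: ev_in_m_iff \<pi>_def)
      moreover have "ev q x + (ev s x * inverse (ev F1 x)) * y \<in> O'"
        by (intro O_add O_mult O_ev u O_y)
      ultimately show ?thesis using rep_mult[OF rep_\<pi> rep_unit] True by (simp add: \<pi>_def)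
    next
      case False
      have "poly p x0 - poly q x0 * y0 \<noteq> 0"
      proof
        assume "poly p x0 - poly q x0 * y0 = 0"
        hence "2 * poly p x0 = 0" "2 * (poly q x0 * y0) = 0" using v by (simp_all add: algebra_simps)
        thus False using 3 False by simp
      qed
      hence u: "el p (- q) \<notin> m" by (simp add: el_in_m_iff)
      hence unz: "el p (- q) \<noteq> 0" using zero_m by auto
      have "rep (ev (p\<^sup>2 - q\<^sup>2 * F) x)" using less.prems norm_eq_0_iff by (intro rep_ev) blast
      moreover have "rep (inverse (el p (- q)))"
        by (intro rep_inverse rep_unit O_el u unz)
      ultimately have "rep (ev (p\<^sup>2 - q\<^sup>2 * F) x * inverse (el p (- q)))" by (rule rep_mult)
      thus ?thesis unfolding el_norm[symmetric] using unz by (simp add: mult.assoc)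
    qed
  qed
qed

lemma R_subset_O: "z \<in> R \<Longrightarrow> z \<in> O'"
proof (cases "z = 0")
  case True
  thus ?thesis using O_ev[of 0] by simp
next
  case False
  assume z: "z \<in> R"
  obtain p q r where r: "r \<noteq> 0" "z = el p q / ev r x" using L_elem[OF R_L[OF z]] .
  have "rep (el p q)" using False r(2) el_eq_0_iff[of p q] by (intro rep_el) auto
  moreover have "rep (inverse (ev r x))" using r(1) transc
    by (intro rep_inverse rep_ev) (simp_all add: transcendental_ev_eq_0_iff)
  ultimately have "rep z" unfolding r(2) field_class.field_divide_inverse by (rule rep_mult)
  then obtain i j e where *: "z * \<pi> ^ i = \<pi> ^ j * e" "e \<in> O'" "e \<notin> m" unfolding rep_def by blast
  show ?thesis
  proof (cases "i \<le> j")
    case True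
    hence "z * \<pi> ^ i = (\<pi> ^ (j - i) * e) * \<pi> ^ i"
      unfolding *(1) by (simp add: algebra_simps flip: power_add)
    hence "z = \<pi> ^ (j - i) * e" using \<pi>_nz by simp
    thus ?thesis using O_mult O_power \<pi>_O * by simp
  next
    case False
    hence "(z * \<pi> ^ (i - j)) * \<pi> ^ j = e * \<pi> ^ j"
      using *(1) by (simp add: algebra_simps flip: power_add)
    hence "e = z * \<pi> ^ (i - j)" using \<pi>_nz by simp
    also have "\<dots> = (z * \<pi> ^ (i - j - 1)) * \<pi>"
      using False by (cases "i - j") auto
    also have "\<dots> \<in> m" using z \<pi>_m m_R by (intro m_mult R_closed) auto
    finally show ?thesis using * by simp
  qed
qed

lemma D_R: "z \<in> R \<Longrightarrow> D z \<in> R"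
  using R_subset_O by (auto simp: O'_def)

lemma D_unit: "\<exists>g\<in>R. D g \<noteq> 0 \<and> inverse (D g) \<in> R"
  using D_\<pi>_unit unitD O_R[OF \<pi>_O] by blast

end

section \<open>Translation by a 2-torsion point and functions without poles\<close>

lemma ev_monom: "ev (monom a n) u = emb a * u ^ n"
  by (induction n) (simp_all add: monom_Suc monom_0 emb_simps algebra_simps)

text \<open>The polynomial q is p with its coefficients reversed and rescaled. The bound n may
  exceed the degree of p, so that two polynomials can be cleared by one power of u.\<close>

lemma ev_reciprocal:
  assumes "degree p \<le> n" "u \<noteq> 0" "c \<noteq> 0"
  shows "\<exists>q. degree q \<le> n \<and> u ^ n * ev p (emb c / u) = ev q u \<and> (p \<noteq> 0 \<longrightarrow> q \<noteq> 0)"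
  using assms(1)
proof (induction p arbitrary: n)
  case 0
  thus ?case by (intro exI[of _ 0]) simp
next
  case (pCons a p)
  show ?case
  proof (cases "p = 0")
    case True
    thus ?thesis using pCons by (intro exI[of _ "monom a n"]) (simp add: degree_monom_le ev_monom monom_eq_0_iff)
  next
    case False
    then obtain n' where n: "n = Suc n'" and "degree p \<le> n'"
      using pCons.prems by (cases n) auto
    then obtain q where q: "degree q \<le> n'" "u ^ n' * ev p (emb c / u) = ev q u" "q \<noteq> 0"
      using pCons.IH False by blast
    have "u ^ n * ev (pCons a p) (emb c / u) = emb a * u ^ n + emb c * (u ^ n' * ev p (emb c / u))"
    proof -
      define t where "t = emb c / u"
      have c: "emb c = u * t" using assms(2) by (simp add: t_def)
      show ?thesis unfolding t_def[symmetric] unfolding c by (simp add: n algebra_simps)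
    qed
    also have "\<dots> = ev (monom a n + smult c q) u"
      unfolding q(2) by (simp add: ev.hom_add ev_monom ev_smult)
    finally have "u ^ n * ev (pCons a p) (emb c / u) = ev (monom a n + smult c q) u" .
    moreover have "degree (monom a n + smult c q) \<le> n"
      using q(1) n by (intro degree_add_le degree_monom_le order_trans[OF degree_smult_le]) auto
    moreover have "monom a n + smult c q \<noteq> 0"
    proof
      assume 0: "monom a n + smult c q = 0"
      have "coeff q n = 0" using q(1) n by (intro coeff_eq_0) auto
      hence "coeff (monom a n + smult c q) n = a" by simp
      hence "a = 0" using 0 by simp
      thus False using 0 q(3) assms(3) by simp
    qed
    ultimately show ?thesis by blast
  qed
qed

lemma transcendental_reciprocal:
  assumes "transcendental u" "c \<noteq> 0"
  shows "transcendental (emb c / u)"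
  unfolding transcendental_def
proof (intro allI impI, rule ccontr)
  fix p assume p: "ev p (emb c / u) = 0" "p \<noteq> 0"
  obtain q where q: "u ^ degree p * ev p (emb c / u) = ev q u" "q \<noteq> 0"
    using ev_reciprocal[OF order_refl transcendental_nz[OF assms(1)] assms(2), of p] p(2) by blast
  have "ev q u = 0" using q(1) p(1) by simp
  thus False using q(2) transcendental_ev_eq_0_iff[OF assms(1)] by blast
qed

text \<open>Translation by the 2-torsion point \<open>(0, 0)\<close> moves the point at infinity to a finite point
  and preserves the invariant derivation.\<close>

context elliptic
begin

definition tx where "tx = emb \<beta> / x"
definition ty where "ty = - (emb \<beta> * y / x\<^sup>2)"

lemma x_nz: "x \<noteq> 0"
  by (rule transcendental_nz[OF transc])

lemma translate: "elliptic \<alpha> \<beta> tx ty"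
proof
  have b: "emb \<beta> \<noteq> 0" using nonsing by simp
  have "ty\<^sup>2 = (emb \<beta>)\<^sup>2 * y\<^sup>2 / x ^ 4"
    by (simp add: ty_def power_divide power_mult_distrib flip: power_mult)
  also have "\<dots> = tx ^ 3 + emb \<alpha> * tx\<^sup>2 + emb \<beta> * tx"
    using x_nz unfolding y2 tx_def
    by (simp add: field_simps power2_eq_square power3_eq_cube power4_eq_xxxx)
  finally show "ty\<^sup>2 = tx ^ 3 + emb \<alpha> * tx\<^sup>2 + emb \<beta> * tx" .
  show "transcendental tx" unfolding tx_def by (rule transcendental_reciprocal[OF transc nonsing(1)])
qed (rule nonsing)+

lemma translate_field: "function_field tx ty = L"
proof (rule function_field_eqI)
  have b: "emb \<beta> \<noteq> 0" using nonsing by simp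
  show "tx \<in> L" unfolding tx_def by (intro L_closed emb_L x_L)
  show "ty \<in> L" unfolding ty_def by (intro L_closed emb_L x_L y_L)
  note M = is_subfield_function_field[of tx ty]
  note M' = is_subringD[OF is_subfieldD(1)[OF M]] is_subfieldD(3)[OF M] function_field_gens
  have x: "x = emb \<beta> / tx" using b x_nz by (simp add: tx_def)
  show xM: "x \<in> function_field tx ty" by (subst x) (intro M')
  have "y = - (ty * x\<^sup>2 / emb \<beta>)" using b x_nz by (simp add: ty_def)
  moreover have "- (ty * x\<^sup>2 / emb \<beta>) \<in> function_field tx ty" by (intro M' xM)
  ultimately show "y \<in> function_field tx ty" by simp
qed

end

context elliptic_derivation
begin

lemma translate_derivation: "elliptic_derivation \<alpha> \<beta> tx ty D"
proof -
  interpret t: elliptic \<alpha> \<beta> tx ty by (rule translate)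
  show ?thesis
  proof
    show "derivation_on (function_field tx ty) D" unfolding translate_field by (rule deriv)
    have "D (emb \<beta> * inverse x) = emb \<beta> * D (inverse x)"
      using D_mult[OF emb_L L_closed(8)[OF x_L]] by (simp add: D_emb)
    also have "\<dots> = 2 * ty"
      unfolding D_inverse[OF x_L x_nz] D_x ty_def
      by (simp add: power2_eq_square field_class.field_divide_inverse)
    finally show "D tx = 2 * ty" by (simp add: tx_def field_class.field_divide_inverse)
  qed
qed

end

text \<open>Being finite where x is, z is p(x) + q(x) y; being finite where \<open>tx\<close> is, it
  is also p'(tx) + q'(tx) ty. Multiplication by x^(n+2), with n bounding the degrees of p' and q',
  and comparison of degrees leave only a constant p and q = 0.\<close>

lemma (in elliptic) in_all_places_imp_const:
  assumes z: "z \<in> L" "\<And>R. R \<in> places L \<Longrightarrow> z \<in> R"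
  shows "\<exists>c. z = emb c"
proof -
  interpret t: elliptic \<alpha> \<beta> tx ty by (rule translate)
  obtain p q where pq: "z = el p q" using in_places_imp_el z by blast
  obtain p' q' where pq': "z = t.el p' q'" using t.in_places_imp_el z unfolding translate_field by blast
  define n where "n = max (degree p') (degree q')"
  obtain s where s: "degree s \<le> n" "x ^ n * ev p' tx = ev s x"
    unfolding tx_def using ev_reciprocal[OF _ x_nz nonsing(1), of p' n] by (auto simp: n_def)
  obtain r where r: "degree r \<le> n" "x ^ n * ev q' tx = ev r x"
    unfolding tx_def using ev_reciprocal[OF _ x_nz nonsing(1), of q' n] by (auto simp: n_def)
  have "el (monom 1 (n + 2) * p) (monom 1 (n + 2) * q) = x ^ (n + 2) * z"
    by (simp add: pq el_def ev.hom_mult ev_monom emb_simps algebra_simps)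
  also have "\<dots> = x\<^sup>2 * (x ^ n * ev p' tx) + (x ^ n * ev q' tx) * (x\<^sup>2 * ty)"
    by (simp add: pq' t.el_def power_add power2_eq_square algebra_simps)
  also have "x\<^sup>2 * ty = - (emb \<beta> * y)" using x_nz by (simp add: ty_def)
  also have "x\<^sup>2 * (x ^ n * ev p' tx) + (x ^ n * ev q' tx) * - (emb \<beta> * y) = el (monom 1 2 * s) (smult (- \<beta>) r)"
    unfolding s(2) r(2) el_def by (simp add: ev.hom_mult ev_monom ev_smult ev.hom_uminus emb_simps)
  finally have eq: "monom 1 (n + 2) * p = monom 1 2 * s" "monom 1 (n + 2) * q = smult (- \<beta>) r"
    by (simp_all add: el_eq_iff)
  have dm: "degree (monom 1 k * w) = k + degree w" if "w \<noteq> 0" for w :: "'k poly" and k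
    using that by (subst degree_mult_eq) (auto simp: degree_monom_eq monom_eq_0_iff)
  have "degree p = 0"
  proof (cases "p = 0")
    case False
    hence "s \<noteq> 0" using eq(1) by (auto simp: monom_eq_0_iff)
    thus ?thesis using arg_cong[OF eq(1), of degree] s(1) dm[of p "n + 2"] dm[of s 2] False by simp
  qed simp
  moreover have "q = 0"
  proof (rule ccontr)
    assume "q \<noteq> 0"
    hence "n + 2 \<le> degree (smult (- \<beta>) r)" using arg_cong[OF eq(2), of degree] dm[of q "n + 2"] by simp
    also have "\<dots> \<le> n" using r(1) degree_smult_le le_trans by blast
    finally show False by simp
  qed
  ultimately obtain c where "p = [:c:]" "q = 0" by (auto elim: degree_eq_zeroE)
  thus ?thesis using pq by (auto simp: el_def)
qed

text \<open>Every place contains x or \<open>tx = \<beta> / x\<close>, so the local analysis applies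
  in one of the two coordinate systems, with the same D. Constants c are regular because c = (c / D
  g) D g for a g whose derivative is a unit.\<close>

lemma (in elliptic_derivation) regular_differentials_eq:
  assumes ac: "\<And>p :: 'a poly. degree p \<noteq> 0 \<Longrightarrow> \<exists>z. poly p z = 0"
  shows "regular_differentials L D = range emb"
proof -
  have place: "(\<forall>z\<in>R. D z \<in> R) \<and> (\<exists>g\<in>R. D g \<noteq> 0 \<and> inverse (D g) \<in> R)" if pl: "R \<in> places L" for R
  proof (cases "x \<in> R")
    case True
    interpret elliptic_place \<alpha> \<beta> x y D R
      using pl True ac by unfold_locales (auto intro: L_subfield)
    show ?thesis using D_R D_unit by blast
  next
    case False
    interpret t: elliptic_derivation \<alpha> \<beta> tx ty D by (rule translate_derivation)
    have "inverse x \<in> R" using pl False x_L by (auto simp: places_def)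
    moreover have "is_subring R" "emb \<beta> \<in> R" using pl by (auto simp: places_def)
    ultimately have "tx \<in> R" unfolding tx_def field_class.field_divide_inverse by (intro is_subringD(4))
    then interpret t: elliptic_place \<alpha> \<beta> tx ty D R
      using pl ac by unfold_locales (auto simp: translate_field intro: L_subfield)
    show ?thesis using t.D_R t.D_unit by blast
  qed
  show ?thesis
  proof (intro equalityI subsetI)
    fix h assume h: "h \<in> regular_differentials L D"
    have "h \<in> R" if pl: "R \<in> places L" for R
    proof -
      obtain n :: nat and r g where rg: "\<forall>i<n. r i \<in> R \<and> g i \<in> R" "h = (\<Sum>i<n. r i * D (g i))"
        using h pl unfolding regular_differentials_def by blast
      have sr: "is_subring R" using pl by (simp add: places_def)
      show ?thesis unfolding rg(2)
        by (rule is_subring_sum[OF sr], rule is_subringD(4)[OF sr]) (use rg(1) place[OF pl] in auto)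
    qed
    moreover have "h \<in> L" using h by (simp add: regular_differentials_def)
    ultimately show "h \<in> range emb" using in_all_places_imp_const by blast
  next
    fix h :: "'a univ" assume "h \<in> range emb"
    then obtain c where h: "h = emb c" by blast
    have "\<exists>(n::nat) r g. (\<forall>i<n. r i \<in> R \<and> g i \<in> R) \<and> h = (\<Sum>i<n. r i * D (g i))"
      if pl: "R \<in> places L" for R
    proof -
      obtain g where g: "g \<in> R" "D g \<noteq> 0" "inverse (D g) \<in> R" using place[OF pl] by blast
      have "is_subring R" "emb c \<in> R" using pl by (auto simp: places_def)
      hence "emb c * inverse (D g) \<in> R" using g by (intro is_subringD(4))
      thus ?thesis using g h
        by (intro exI[of _ 1] exI[of _ "\<lambda>_. emb c * inverse (D g)"] exI[of _ "\<lambda>_. g"]) simp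
    qed
    thus "h \<in> regular_differentials L D" unfolding regular_differentials_def using h emb_L by blast
  qed
qed

lemma dim_range_emb: "vector_space.dim (\<lambda>c z. emb c * z) (range (emb :: 'k::field \<Rightarrow> 'k univ)) = 1"
proof -
  interpret vs: vector_space "\<lambda>c z. emb c * z :: 'k univ"
    by standard (simp_all add: emb_simps algebra_simps)
  have "vs.dim (range emb) = card {1 :: 'k univ}"
  proof (rule vs.dim_unique)
    show "{1 :: 'k univ} \<subseteq> range emb" using emb.hom_1 by (metis rangeI empty_subsetI insert_subset)
    have "vs.span {1} = range emb"
      unfolding vs.span_singleton by simp
    thus "range emb \<subseteq> vs.span {1}" by simp
    show "vs.independent {1}" by (simp add: vs.dependent_single)
  qed simp
  thus ?thesis by simp
qed

section \<open>Algebraic elements\<close>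

lemma is_subfield_UNIV: "is_subfield UNIV"
  by (simp add: is_subfield_def is_subring_def)

lemma algebraic_in_place:
  assumes R: "R \<in> places UNIV" and p: "p \<noteq> 0" "ev p z = 0"
  shows "z \<in> R"
proof (rule ccontr)
  assume z: "z \<notin> R"
  interpret place UNIV R using R by unfold_locales (simp_all add: is_subfield_UNIV)
  have w: "inverse z \<in> m" using inverse_m z by simp
  have z0: "z \<noteq> 0" using z R_closed by auto
  have "\<exists>r\<in>R. inverse z ^ degree p * ev p z = emb (lead_coeff p) + r * inverse z" if "p \<noteq> 0" for p
    using that
  proof (induction p)
    case (pCons a p)
    show ?case
    proof (cases "p = 0")
      case True
      thus ?thesis using R_closed by (intro bexI[of _ 0]) simp_all
    next
      case False
      then obtain r where r: "r \<in> R" "inverse z ^ degree p * ev p z = emb (lead_coeff p) + r * inverse z"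
        using pCons.IH by blast
      have "inverse z ^ degree (pCons a p) * ev (pCons a p) z =
        emb a * inverse z ^ degree p * inverse z + inverse z ^ degree p * ev p z"
        using False z0 by (simp add: algebra_simps)
      also have "\<dots> = emb (lead_coeff (pCons a p)) + (emb a * inverse z ^ degree p + r) * inverse z"
        unfolding r(2) using False by (simp add: algebra_simps)
      finally show ?thesis by (rule bexI) (intro R_closed emb_R r(1) m_R[OF w])
    qed
  qed simp
  then obtain r where r: "r \<in> R" "0 = emb (lead_coeff p) + r * inverse z" using p by (metis mult_zero_right)
  hence "emb (lead_coeff p) = - (r * inverse z)" by (simp add: eq_neg_iff_add_eq_0)
  hence "emb (lead_coeff p) \<in> m" using m_uminus m_mult w r(1) by simp
  thus False using emb_unit p(1) by simp
qed

text \<open>Algebraic means integral over the constants, which is tested on the valuation rings of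
  the whole universe. The algebraic elements become an intersection of rings, so their closure under
  sums and products is immediate.\<close>

lemma algebraic_iff_in_places:
  fixes z :: "'k::field univ"
  shows "(\<exists>p. p \<noteq> 0 \<and> ev p z = 0) \<longleftrightarrow> (\<forall>R\<in>places UNIV. z \<in> R)"
proof
  assume *: "\<forall>R\<in>places UNIV. z \<in> R"
  show "\<exists>p. p \<noteq> 0 \<and> ev p z = 0"
  proof (cases "z = 0")
    case True
    thus ?thesis by (intro exI[of _ "[:0, 1:]"]) simp
  next
    case False
    have A: "is_subring (range (emb :: 'k \<Rightarrow> 'k univ))"
      unfolding is_subring_def
      using emb.hom_1 by (auto simp flip: emb.hom_diff emb.hom_mult)
    have "z \<in> adjoin (range emb) (inverse z)"
      by (rule in_adjoin_if_in_places[OF is_subfield_UNIV A]) (use * in auto)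
    then obtain n :: nat and a where a: "\<And>i. a i \<in> range emb" "z = (\<Sum>i\<le>n. a i * inverse z ^ i)"
      by (rule adjoinE) blast
    from a(1) have "\<forall>i. \<exists>c. a i = emb c" by blast
    then obtain c where c: "\<And>i. a i = emb (c i)"
      using choice[of "\<lambda>i c. a i = emb c"] \<open>\<forall>i. \<exists>c. a i = emb c\<close> by blast
    define p where "p = monom 1 (Suc n) - (\<Sum>i\<le>n. monom (c i) (n - i))"
    have "coeff (\<Sum>i\<le>n. monom (c i) (n - i)) (Suc n) = 0"
      by (auto simp: coeff_sum intro!: sum.neutral)
    hence "coeff p (Suc n) = 1" by (simp add: p_def)
    hence "p \<noteq> 0" by auto
    moreover have "ev p z = 0"
    proof -
      have "z ^ Suc n = z ^ n * (\<Sum>i\<le>n. a i * inverse z ^ i)" using a(2) by simp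
      also have "\<dots> = (\<Sum>i\<le>n. a i * z ^ (n - i))"
        unfolding sum_distrib_left
      proof (intro sum.cong refl)
        fix i assume "i \<in> {..n}"
        hence "z ^ n = z ^ i * z ^ (n - i)" by (simp flip: power_add)
        thus "z ^ n * (a i * inverse z ^ i) = a i * z ^ (n - i)"
          using False by (simp add: power_inverse)
      qed
      finally show ?thesis
        by (simp add: p_def ev.hom_diff ev.hom_sum ev_monom c emb_simps)
    qed
    ultimately show ?thesis by blast
  qed
qed (use algebraic_in_place in blast)

definition algebraic_elements :: "'k::field univ set" where
  "algebraic_elements = {z. \<not> transcendental z}"

lemma algebraic_elements_eq: "algebraic_elements = (\<Inter>R\<in>places UNIV. R)"
  unfolding algebraic_elements_def transcendental_def using algebraic_iff_in_places by blast

lemma is_subfield_algebraic: "is_subfield (algebraic_elements :: 'k::field univ set)"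
  unfolding is_subfield_def
proof (intro conjI ballI)
  show "is_subring (algebraic_elements :: 'k univ set)"
    unfolding algebraic_elements_eq is_subring_def places_def by auto
  fix z :: "'k univ" assume z: "z \<in> algebraic_elements"
  show "inverse z \<in> algebraic_elements"
  proof (cases "z = 0")
    case False
    have "transcendental z" if "transcendental (inverse z)"
      using transcendental_reciprocal[OF that, of 1] by (simp add: emb_simps divide_inverse)
    thus ?thesis using z by (auto simp: algebraic_elements_def)
  qed (use z in simp)
qed

lemma emb_algebraic: "emb c \<in> algebraic_elements"
  using transcendental_neq_emb by (auto simp: algebraic_elements_def)

lemma sqrt_algebraic:
  fixes z :: "'k::field univ"
  shows "z\<^sup>2 \<in> algebraic_elements \<Longrightarrow> z \<in> algebraic_elements"
  unfolding algebraic_elements_eq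
proof
  fix R :: "'k univ set" assume "z\<^sup>2 \<in> (\<Inter>R\<in>places UNIV. R)" and R: "R \<in> places UNIV"
  hence z: "z * z \<in> R" by (auto simp: power2_eq_square)
  interpret place UNIV R using R by unfold_locales (simp_all add: is_subfield_UNIV)
  show "z \<in> R"
  proof (rule ccontr)
    assume "z \<notin> R"
    hence "inverse z \<in> R" "z \<noteq> 0" using R_total R_closed(2) by auto
    hence "inverse z * (z * z) \<in> R" using z R_closed by blast
    thus False using \<open>z \<notin> R\<close> \<open>z \<noteq> 0\<close> by (simp flip: mult.assoc)
  qed
qed

section \<open>Generic points of irreducible curves\<close>

text \<open>By Gauss's lemma f stays irreducible over k(x). If f does not divide g, a Bezout
  identity over k(x) with denominators cleared makes a nonzero polynomial in x alone a combination
  of f and g; it would vanish at the transcendental u.\<close>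

lemma generic_if_irreducible:
  fixes f :: "'k::field_gcd poly poly"
  assumes f: "irreducible f" "degree f > 0" and u: "transcendental u" and uv: "eval2 emb f u v = 0"
  shows "generic_point f u v"
  unfolding generic_point_def
proof (intro allI iffI)
  fix g assume "f dvd g"
  thus "eval2 emb g u v = 0" using uv by (auto simp: dvd_def eval2.hom_mult)
next
  fix g assume g: "eval2 emb g u v = 0"
  have irr: "irreducible (fract_poly f)" and cont: "content f = 1"
    using f nonconst_poly_irreducible_iff[of f] by auto
  show "f dvd g"
  proof (rule ccontr)
    assume "\<not> f dvd g"
    hence "\<not> fract_poly f dvd fract_poly g" using fract_poly_dvdD cont by blast
    hence cop: "coprime (fract_poly f) (fract_poly g)"
      using irr by (metis irreducible_imp_prime_elem prime_elem_imp_coprime)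
    obtain A B where AB: "A * fract_poly f + B * fract_poly g = 1"
      using bezout_coefficients_fst_snd[of "fract_poly f" "fract_poly g"] cop
      by (metis coprime_imp_gcd_eq_1)
    have clear: "\<exists>a A'. a \<noteq> 0 \<and> smult (to_fract a) A = fract_poly A'" for A :: "'k poly fract poly"
    proof -
      obtain c p' where A: "A = smult c (fract_poly p')" using content_decompose_fract by metis
      obtain n d where c: "c = to_fract n / to_fract d" "d \<noteq> 0"
        by (metis Fract_conv_to_fract Fract_cases)
      have "smult (to_fract d) A = fract_poly (smult n p')"
        using c by (simp add: A)
      thus ?thesis using c by blast
    qed
    obtain a A' where a: "a \<noteq> 0" "smult (to_fract a) A = fract_poly A'" using clear by blast
    obtain b B' where b: "b \<noteq> 0" "smult (to_fract b) B = fract_poly B'" using clear by blast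
    have "fract_poly [:a * b:] = smult (to_fract b) (smult (to_fract a) A) * fract_poly f
        + smult (to_fract a) (smult (to_fract b) B) * fract_poly g"
    proof -
      have "fract_poly [:a * b:] = smult (to_fract (a * b)) (A * fract_poly f + B * fract_poly g)"
        unfolding AB by (simp add: map_poly_pCons)
      thus ?thesis by (simp add: smult_add_right mult.commute)
    qed
    also have "\<dots> = fract_poly ([:b:] * A' * f + [:a:] * B' * g)"
      unfolding a b by simp
    finally have "[:a * b:] = [:b:] * A' * f + [:a:] * B' * g" by (simp only: fract_poly_eq_iff)
    hence "eval2 emb [:a * b:] u v = eval2 emb ([:b:] * A' * f + [:a:] * B' * g) u v" by simp
    hence "ev (a * b) u = 0" using uv g by (simp add: eval2.hom_add eval2.hom_mult del: mult_pCons_left)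
    thus False using a b u by (simp add: transcendental_ev_eq_0_iff)
  qed
qed

section \<open>The fibers of the pencil\<close>

lemma monic_lead_coeff_factor:
  fixes g h :: "'k::field poly poly"
  assumes "lead_coeff (g * h) = [:c:]" "c \<noteq> 0"
  shows "degree (lead_coeff g) = 0" "lead_coeff g \<noteq> 0"
proof -
  have e: "lead_coeff g * lead_coeff h = [:c:]" using assms(1) by (simp add: lead_coeff_mult)
  thus "lead_coeff g \<noteq> 0" using assms(2) by auto
  moreover have "lead_coeff h \<noteq> 0" using e assms(2) by auto
  ultimately have "degree (lead_coeff g) + degree (lead_coeff h) = degree [:c:]"
    unfolding e[symmetric] by (simp add: degree_mult_eq)
  thus "degree (lead_coeff g) = 0" by simp
qed

lemma degree_le_1D: "degree p \<le> 1 \<Longrightarrow> p = [:coeff p 0, coeff p 1:]"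
  by (rule poly_eqI) (auto simp: coeff_pCons coeff_eq_0 split: nat.splits)

text \<open>The conditions on t, t^2 + 1 and t^2 + 4 make the discriminant nonzero. The one on t^2 +
  9 serves to exclude a component y = a x + 2 with a^2 = -1.\<close>

locale fiber =
  fixes t :: "'k::{field_gcd,field_char_0}"
  assumes t_nz: "t \<noteq> 0" and s_nz: "t\<^sup>2 + 1 \<noteq> 0" and t4_nz: "t\<^sup>2 + 4 \<noteq> 0" and t9_nz: "t\<^sup>2 + 9 \<noteq> 0"
begin

definition f :: "'k poly poly" where "f = curve_C_poly t 1"

lemma f_pCons: "f = [: [:0, (t\<^sup>2 + 1)\<^sup>2, - (2 * t * (t\<^sup>2 + 1)), 2 * t\<^sup>2, - t:],
    [:0, - (2 * (t\<^sup>2 + 1)), 2 * t:], [:0, 2 * t\<^sup>2, - (2 * t):], [:2 * t:], [:- t:] :]"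
  by (simp add: f_def curve_C_poly_def quintic_def power2_eq_square numeral_poly one_pCons algebra_simps)

lemma degree_f: "degree f = 4" and lead_coeff_f: "lead_coeff f = [:- t:]"
  using t_nz by (simp_all add: f_pCons)

lemma f_no_linear_factor: "poly f l \<noteq> 0"
proof
  assume l: "poly f l = 0"
  \<comment> \<open>For degree at least 2 the term t l^4 would have larger degree than all other
    terms of f(l).\<close>
  have "degree l \<le> 1"
  proof (rule ccontr)
    assume "\<not> degree l \<le> 1"
    hence d: "degree l \<ge> 2" by simp
    have "poly f l = [:0, (t\<^sup>2 + 1)\<^sup>2, - (2 * t * (t\<^sup>2 + 1)), 2 * t\<^sup>2, - t:] + [:0, - (2 * (t\<^sup>2 + 1)), 2 * t:] * l
      + [:0, 2 * t\<^sup>2, - (2 * t):] * l ^ 2 + [:2 * t:] * l ^ 3 + [:- t:] * l ^ 4"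
      unfolding f_pCons by (simp add: algebra_simps power2_eq_square power3_eq_cube power4_eq_xxxx smult_add_right)
    hence "[:t:] * l ^ 4 = [:0, (t\<^sup>2 + 1)\<^sup>2, - (2 * t * (t\<^sup>2 + 1)), 2 * t\<^sup>2, - t:] + [:0, - (2 * (t\<^sup>2 + 1)), 2 * t:] * l
      + [:0, 2 * t\<^sup>2, - (2 * t):] * l ^ 2 + [:2 * t:] * l ^ 3"
      unfolding l by (simp add: add_eq_0_iff algebra_simps)
    moreover have "degree ([:0, (t\<^sup>2 + 1)\<^sup>2, - (2 * t * (t\<^sup>2 + 1)), 2 * t\<^sup>2, - t:] + [:0, - (2 * (t\<^sup>2 + 1)), 2 * t:] * l
      + [:0, 2 * t\<^sup>2, - (2 * t):] * l ^ 2 + [:2 * t:] * l ^ 3) \<le> 3 * degree l"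
    proof (intro degree_add_le)
      have pw: "degree (l ^ n) \<le> n * degree l" for n using degree_power_le[of l n] by (simp add: mult.commute)
      show "degree [:0, (t\<^sup>2 + 1)\<^sup>2, - (2 * t * (t\<^sup>2 + 1)), 2 * t\<^sup>2, - t:] \<le> 3 * degree l"
        using d t_nz by simp
      have "degree ([:0, - (2 * (t\<^sup>2 + 1)), 2 * t:] * l) \<le> 2 + degree l"
        by (rule order_trans[OF degree_mult_le]) (use t_nz in simp)
      thus "degree ([:0, - (2 * (t\<^sup>2 + 1)), 2 * t:] * l) \<le> 3 * degree l" using d by simp
      have "degree ([:0, 2 * t\<^sup>2, - (2 * t):] * l ^ 2) \<le> 2 + 2 * degree l"
        by (rule order_trans[OF degree_mult_le]) (use t_nz pw[of 2] in simp)
      thus "degree ([:0, 2 * t\<^sup>2, - (2 * t):] * l ^ 2) \<le> 3 * degree l" using d by simp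
      show "degree ([:2 * t:] * l ^ 3) \<le> 3 * degree l"
        by (rule order_trans[OF degree_mult_le]) (use pw[of 3] in simp)
    qed
    ultimately have "degree ([:t:] * l ^ 4) \<le> 3 * degree l" by simp
    moreover have "degree ([:t:] * l ^ 4) = 4 * degree l"
    proof -
      have "l \<noteq> 0" using d by auto
      thus ?thesis using t_nz by (subst degree_mult_eq) (auto simp: degree_power_eq)
    qed
    ultimately show False using d by simp
  qed
  then obtain b a where ab: "l = [:b, a:]"
    using degree_le_1D by blast
  have e: "poly f l = [:- t * b ^ 4 + 2 * t * b ^ 3,
      (t\<^sup>2 + 1)\<^sup>2 - 2 * (t\<^sup>2 + 1) * b + 2 * t\<^sup>2 * b\<^sup>2 + 6 * t * a * b\<^sup>2 - 4 * t * a * b ^ 3,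
      - (2 * t * (t\<^sup>2 + 1)) - 2 * (t\<^sup>2 + 1) * a + 2 * t * b + 4 * t\<^sup>2 * a * b - 2 * t * b\<^sup>2
        + 6 * t * a\<^sup>2 * b - 6 * t * a\<^sup>2 * b\<^sup>2,
      2 * t\<^sup>2 + 2 * t * a + 2 * t\<^sup>2 * a\<^sup>2 - 4 * t * a * b + 2 * t * a ^ 3 - 4 * t * a ^ 3 * b,
      - t - 2 * t * a\<^sup>2 - t * a ^ 4:]"
    unfolding ab f_pCons
    by (simp add: power2_eq_square power3_eq_cube power4_eq_xxxx algebra_simps)
  have c0: "- t * b ^ 4 + 2 * t * b ^ 3 = 0"
    and c1: "(t\<^sup>2 + 1)\<^sup>2 - 2 * (t\<^sup>2 + 1) * b + 2 * t\<^sup>2 * b\<^sup>2 + 6 * t * a * b\<^sup>2 - 4 * t * a * b ^ 3 = 0"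
    and c4: "- t - 2 * t * a\<^sup>2 - t * a ^ 4 = 0"
    using e[unfolded l, symmetric] unfolding pCons_eq_0_iff by blast+
  \<comment> \<open>The top and bottom coefficients in x leave a^2 = -1 and b = 0 or b = 2; the
    linear coefficient contradicts either value of b.\<close>
  have "t * (a\<^sup>2 + 1)\<^sup>2 = - (- t - 2 * t * a\<^sup>2 - t * a ^ 4)"
    by (simp add: power2_eq_square power4_eq_xxxx algebra_simps)
  hence "t * (a\<^sup>2 + 1)\<^sup>2 = 0" unfolding c4 by simp
  hence "a\<^sup>2 + 1 = 0" using t_nz by simp
  hence a2: "a\<^sup>2 = - 1" unfolding eq_neg_iff_add_eq_0 .
  have "t * b ^ 3 * (b - 2) = - (- t * b ^ 4 + 2 * t * b ^ 3)"
    by (simp add: power3_eq_cube power4_eq_xxxx algebra_simps)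
  hence "t * b ^ 3 * (b - 2) = 0" unfolding c0 by simp
  hence "b = 0 \<or> b = 2" using t_nz by simp
  thus False
  proof
    assume "b = 0"
    thus False using c1 s_nz by simp
  next
    assume b: "b = 2"
    have "t ^ 4 + 6 * t\<^sup>2 - 3 = 8 * t * a"
      using c1 unfolding b by (simp add: power2_eq_square power4_eq_xxxx algebra_simps)
    hence "(t ^ 4 + 6 * t\<^sup>2 - 3)\<^sup>2 = 64 * t\<^sup>2 * a\<^sup>2" by (simp add: power_mult_distrib)
    moreover have "(t ^ 4 + 6 * t\<^sup>2 - 3)\<^sup>2 + 64 * t\<^sup>2 = (t\<^sup>2 + 1) ^ 3 * (t\<^sup>2 + 9)"
      by (simp add: power2_eq_square power3_eq_cube power4_eq_xxxx algebra_simps)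
    ultimately have "(t\<^sup>2 + 1) ^ 3 * (t\<^sup>2 + 9) = 0" unfolding a2 by simp
    thus False using s_nz t9_nz by simp
  qed
qed

text \<open>Eisenstein-like: modulo \<open>x\<close> the curve is \<open>y\<^sup>3 (y - 2) = 0\<close>, and its equation has a
  nonzero linear coefficient at the origin, so one of two factors is linear in \<open>y\<close>.\<close>

lemma irreducible_f: "irreducible f"
proof -
  \<comment> \<open>If h is nonzero at the origin, y^3 divides the reduction of g modulo x, so h has
    degree at most 1 in y. As leading coefficients are constant, degree 1 would give a root of f
    that is polynomial in x.\<close>
  have main: "degree h = 0" if gh: "f = g * h" and h0: "coeff (coeff h 0) 0 \<noteq> 0" for g h
  proof (rule ccontr)
    assume dh: "degree h \<noteq> 0"
    interpret z: rhom "\<lambda>p. poly p 0 :: 'k" by standard simp_all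
    interpret Z: rhom "map_poly (\<lambda>p. poly p 0 :: 'k)" by (rule z.rhom_map_poly)
    define r where "r = map_poly (\<lambda>p. poly p 0 :: 'k)"
    have rgh: "r f = r g * r h" unfolding r_def gh by (rule Z.hom_mult)
    have rf: "r f = monom 1 3 * [:2 * t, - t:]"
      by (simp add: r_def f_pCons map_poly_pCons numeral_3_eq_3 monom_Suc monom_0)
    have lg: "degree (lead_coeff g) = 0" "lead_coeff g \<noteq> 0"
      using monic_lead_coeff_factor[of g h "- t"] lead_coeff_f t_nz by (simp_all add: gh)
    have "degree (r g) = degree g"
    proof (rule antisym)
      show "degree (r g) \<le> degree g" unfolding r_def by (rule degree_le) (simp add: coeff_map_poly coeff_eq_0)
      have "coeff (r g) (degree g) = poly (lead_coeff g) 0" by (simp add: r_def coeff_map_poly)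
      also have "\<dots> \<noteq> 0" using lg by (auto elim: degree_eq_zeroE)
      finally show "degree g \<le> degree (r g)" by (rule le_degree)
    qed
    moreover have "monom 1 3 dvd r g"
    proof -
      have cop: "coprime (monom 1 3 :: 'k poly) (r h)"
      proof -
        have "prime_elem ([:0, 1:] :: 'k poly)" by (rule prime_elem_linear_poly) simp_all
        moreover have "\<not> [:0, 1:] dvd r h"
        proof
          assume "[:0, 1:] dvd r h"
          hence "poly (r h) 0 = 0" using poly_eq_0_iff_dvd[of "r h" 0] by simp
          thus False using h0 by (simp add: r_def poly_0_coeff_0 coeff_map_poly)
        qed
        ultimately have "coprime ([:0, 1:] :: 'k poly) (r h)" by (rule prime_elem_imp_coprime)
        thus ?thesis by (simp add: monom_altdef)
      qed
      have "monom 1 3 dvd r g * r h" unfolding rgh[symmetric] rf by (rule dvd_triv_left)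
      thus ?thesis using cop coprime_dvd_mult_left_iff by blast
    qed
    moreover have rg: "r g \<noteq> 0"
    proof
      assume "r g = 0"
      hence "monom 1 3 * [:2 * t, - t:] = 0" unfolding rf[symmetric] rgh by simp
      hence "monom 1 3 = (0 :: 'k poly) \<or> [:2 * t, - t:] = 0" unfolding mult_eq_0_iff .
      thus False using t_nz by (simp add: monom_eq_0_iff)
    qed
    ultimately have "3 \<le> degree g" using dvd_imp_degree_le[of "monom 1 3" "r g"] by (simp add: degree_monom_eq)
    moreover have "degree g + degree h = 4"
      using degree_f gh degree_mult_eq[of g h] by (metis degree_0 mult_zero_left mult_zero_right zero_neq_numeral)
    ultimately have "degree h = 1" using dh by simp
    then obtain h0 h1 where h: "h = [:h0, h1:]" "h1 \<noteq> 0"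
      using degree_le_1D[of h] by (metis degree_pCons_0 le_numeral_extra(4) pCons_0_0 zero_neq_one)
    have "degree h1 = 0"
      using monic_lead_coeff_factor[of h g "- t"] lead_coeff_f t_nz h by (simp_all add: gh mult.commute)
    then obtain c where c: "h1 = [:c:]" "c \<noteq> 0" using h by (auto elim: degree_eq_zeroE)
    have "poly h (smult (- inverse c) h0) = 0" using c by (simp add: h)
    hence "poly f (smult (- inverse c) h0) = 0" by (simp add: gh)
    thus False using f_no_linear_factor by blast
  qed
  have unit: "is_unit g" if gh: "f = g * h" and dg0: "degree g = 0" for g h
  proof -
    obtain c where c: "g = [:c:]" using dg0 by (auto elim: degree_eq_zeroE)
    have "degree (lead_coeff g) = 0" "lead_coeff g \<noteq> 0"
      using monic_lead_coeff_factor[of g h "- t"] lead_coeff_f t_nz by (simp_all add: gh)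
    thus ?thesis by (auto simp: c is_unit_const_poly_iff dvd_field_iff elim!: degree_eq_zeroE)
  qed
  show ?thesis
  proof (rule irreducibleI)
    show "f \<noteq> 0" using degree_f by auto
    show "\<not> is_unit f" using degree_f by (metis is_unit_polyE degree_pCons_0 zero_neq_numeral)
    fix g h assume gh: "f = g * h"
    have "coeff (coeff g 0) 0 \<noteq> 0 \<or> coeff (coeff h 0) 0 \<noteq> 0"
    proof (rule ccontr)
      assume *: "\<not> ?thesis"
      \<comment> \<open>This coefficient is (t^2 + 1)^2, but it would be 0 if both factors vanished
        at the origin.\<close>
      have "coeff (coeff f 0) 1 = 0" using * unfolding gh by (simp add: coeff_mult)
      thus False using s_nz by (simp add: f_pCons)
    qed
    thus "is_unit g \<or> is_unit h"
    proof
      assume "coeff (coeff h 0) 0 \<noteq> 0"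
      thus ?thesis using main[OF gh] unit[of h g] gh by (simp add: mult.commute)
    next
      assume "coeff (coeff g 0) 0 \<noteq> 0"
      thus ?thesis using main[of h g] unit[of g h] gh by (simp add: mult.commute)
    qed
  qed
qed

lemma generic_exists: "\<exists>u v. generic_point f u v"
proof -
  obtain u :: "'k univ" where u: "transcendental u" using transcendental_exists by blast
  have "coeff (map_poly (\<lambda>p. ev p u) f) 4 \<noteq> 0"
    using lead_coeff_f degree_f t_nz by (simp add: coeff_map_poly emb_simps)
  hence "degree (map_poly (\<lambda>p. ev p u) f) > 0"
    using le_degree by fastforce
  then obtain v where "poly (map_poly (\<lambda>p. ev p u) f) v = 0"
    using alg_closed_imp_poly_has_root by blast
  hence "eval2 emb f u v = 0" by (simp add: eval2_def ev_def)
  thus ?thesis using generic_if_irreducible[OF irreducible_f] degree_f u by auto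
qed

end

text \<open>Inversion in the unit circle, \<open>(p, q) = (u, v) / (u\<^sup>2 + v\<^sup>2)\<close>, turns the quartic into a cubic that is
  quadratic in \<open>q\<close>; moving its point corresponding to the origin to infinity gives the Weierstrass
  form.\<close>

lemma weierstrass_coordinates:
  fixes a u v :: "'l::field_char_0"
  assumes q: "quintic a 1 u v = 0" and u: "u \<noteq> 0" and r: "u\<^sup>2 + v\<^sup>2 \<noteq> 0" and s: "a\<^sup>2 + 1 \<noteq> 0"
  defines "x' \<equiv> a * (u\<^sup>2 + v\<^sup>2 - 2 * v) / u"
  defines "x \<equiv> x' - (a\<^sup>2 - 1)"
  defines "y \<equiv> a * ((a ^ 4 + 6 * a\<^sup>2 - 3) / 2 - 2 * x') * (u\<^sup>2 + v\<^sup>2) / ((a\<^sup>2 + 1) * u)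
    - (a\<^sup>2 - 1) / 2 * x' - 2 * a\<^sup>2"
  shows "y\<^sup>2 = x ^ 3 + (a\<^sup>2 - 2) * x\<^sup>2 + (a\<^sup>2 + 1)\<^sup>2 * x"
proof -
  define r where "r = u\<^sup>2 + v\<^sup>2"
  define s where "s = a\<^sup>2 + 1"
  define p where "p = u / r"
  define q where "q = v / r"
  have nz: "r \<noteq> 0" "s \<noteq> 0" "p \<noteq> 0" using assms by (simp_all add: r_def s_def p_def)
  have uv: "u = p * r" "v = q * r" using nz by (simp_all add: p_def q_def)
  have "r * (r * (p\<^sup>2 + q\<^sup>2)) = u\<^sup>2 + v\<^sup>2" unfolding uv by (simp add: power2_eq_square algebra_simps)
  hence "r * (r * (p\<^sup>2 + q\<^sup>2)) = r" by (simp only: r_def)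
  hence pq: "r * (p\<^sup>2 + q\<^sup>2) = 1" using nz by simp
  have "0 = quintic a 1 u v" using assms by simp
  also have "\<dots> = u * s * (s - 2 * a * u - 2 * v) - a * r * (r - 2 * a * u - 2 * v)"
    by (simp add: quintic_def r_def s_def)
  also have "\<dots> = r * (p * s * (s - r * (2 * a * p + 2 * q)) - a * r * (1 - (2 * a * p + 2 * q)))"
    unfolding uv by (simp add: algebra_simps)
  finally have "p * s * (s - r * (2 * a * p + 2 * q)) - a * r * (1 - (2 * a * p + 2 * q)) = 0"
    using nz by simp
  moreover have "(p\<^sup>2 + q\<^sup>2) * (p * s * (s - r * (2 * a * p + 2 * q)) - a * r * (1 - (2 * a * p + 2 * q))) =
    (p\<^sup>2 + q\<^sup>2) * (p * s * s) - (r * (p\<^sup>2 + q\<^sup>2)) * (p * s * (2 * a * p + 2 * q) + a * (1 - (2 * a * p + 2 * q)))"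
    by (simp add: algebra_simps)
  ultimately have "(p\<^sup>2 + q\<^sup>2) * (p * s * s) - (r * (p\<^sup>2 + q\<^sup>2)) * (p * s * (2 * a * p + 2 * q) + a * (1 - (2 * a * p + 2 * q))) = 0"
    by simp
  \<comment> \<open>Replacing r (p^2 + q^2) by 1 has turned the equation of the curve into the cubic
    in p and q.\<close>
  hence E: "(p\<^sup>2 + q\<^sup>2) * (p * s * s) - (p * s * (2 * a * p + 2 * q) + a * (1 - (2 * a * p + 2 * q))) = 0"
    unfolding pq by simp
  define P where "P = (a ^ 4 + 6 * a\<^sup>2 - 3) / 2"
  define c where "c = (a\<^sup>2 - 1) / 2"
  define M where "M = a * (1 - 2 * q) - (a\<^sup>2 - 1) * p"
  define N where "N = a * P * p - 2 * a\<^sup>2 * (1 - 2 * q) - c * a * s * (1 - 2 * q) * p - 2 * a\<^sup>2 * s * p\<^sup>2"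
  have x': "x' = a * (1 - 2 * q) / p"
  proof -
    have "x' = a * (r - 2 * (q * r)) / (p * r)" unfolding x'_def r_def[symmetric] by (simp flip: uv)
    also have "\<dots> = a * (1 - 2 * q) * r / (p * r)" by (simp add: algebra_simps)
    finally show ?thesis using nz by simp
  qed
  have x: "x = M / p" using nz by (simp add: x_def x' M_def diff_divide_distrib)
  have "y = a * (P - 2 * x') / (s * p) - c * x' - 2 * a\<^sup>2"
    unfolding y_def P_def[symmetric] c_def[symmetric] s_def[symmetric] r_def[symmetric] using nz by (simp add: uv(1))
  also have "\<dots> = N / (s * p\<^sup>2)"
    using nz unfolding x' N_def by (simp add: field_simps power2_eq_square)
  finally have y: "y = N / (s * p\<^sup>2)" .
  \<comment> \<open>With x = M / p and y = N / (s p^2), the defect of the Weierstrass equation is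
    the cubic of \<open>E\<close> times an explicit cofactor. The factor 4 clears the halves in
    \<open>P\<close> and \<open>c\<close>.\<close>
  have "4 * N\<^sup>2 - 4 * (s\<^sup>2 * p * (M ^ 3 + (a\<^sup>2 - 2) * M\<^sup>2 * p + s\<^sup>2 * M * p\<^sup>2)) =
    4 * ((p\<^sup>2 + q\<^sup>2) * (p * s * s) - (p * s * (2 * a * p + 2 * q) + a * (1 - (2 * a * p + 2 * q)))) *
    (p * (a ^ 6 + 6 * a ^ 4 - 3 * a\<^sup>2) + 8 * a ^ 3 * q - 4 * a ^ 3)"
  proof -
    have N2: "2 * N = a * (a ^ 4 + 6 * a\<^sup>2 - 3) * p - 4 * a\<^sup>2 * (1 - 2 * q)
      - (a\<^sup>2 - 1) * a * s * (1 - 2 * q) * p - 4 * a\<^sup>2 * s * p\<^sup>2" (is "_ = ?N2")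
    proof -
      have "2 * N = a * (2 * P) * p - 4 * a\<^sup>2 * (1 - 2 * q) - (2 * c) * a * s * (1 - 2 * q) * p - 4 * a\<^sup>2 * s * p\<^sup>2"
        by (simp add: N_def algebra_simps)
      moreover have "2 * P = a ^ 4 + 6 * a\<^sup>2 - 3" "2 * c = a\<^sup>2 - 1" by (simp_all add: P_def c_def)
      ultimately show ?thesis by (simp only:)
    qed
    have "4 * N\<^sup>2 = (2 * N)\<^sup>2" by (simp add: power_mult_distrib)
    hence "4 * N\<^sup>2 = ?N2\<^sup>2" unfolding N2 .
    thus ?thesis unfolding M_def s_def by (simp add: algebra_simps power_numeral_reduce)
  qed
  hence "4 * (N\<^sup>2 - s\<^sup>2 * p * (M ^ 3 + (a\<^sup>2 - 2) * M\<^sup>2 * p + s\<^sup>2 * M * p\<^sup>2)) = 0"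
    unfolding E by (simp add: algebra_simps)
  hence "N\<^sup>2 = s\<^sup>2 * p * (M ^ 3 + (a\<^sup>2 - 2) * M\<^sup>2 * p + s\<^sup>2 * M * p\<^sup>2)" by simp
  hence "y\<^sup>2 = s\<^sup>2 * p * (M ^ 3 + (a\<^sup>2 - 2) * M\<^sup>2 * p + s\<^sup>2 * M * p\<^sup>2) / (s\<^sup>2 * (p ^ 3 * p))"
    by (simp add: y power_divide power_mult_distrib power2_eq_square power3_eq_cube mult.assoc)
  also have "\<dots> = (M ^ 3 + (a\<^sup>2 - 2) * M\<^sup>2 * p + s\<^sup>2 * M * p\<^sup>2) / p ^ 3"
    using nz by (simp add: mult.assoc mult.left_commute)
  also have "\<dots> = x ^ 3 + (a\<^sup>2 - 2) * x\<^sup>2 + s\<^sup>2 * x"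
    using nz by (simp add: x add_divide_distrib power_divide power2_eq_square power3_eq_cube)
  finally show ?thesis by (simp add: s_def)
qed

section \<open>The birational map between the fiber and its Weierstrass curve\<close>

locale fiber_point = fiber +
  fixes u v
  assumes gen: "generic_point f u v"
begin

abbreviation "L \<equiv> function_field u v"

lemma quintic_uv: "quintic (emb t) 1 u v = 0"
proof -
  have "eval2 emb f u v = 0" using gen by (simp add: generic_point_def)
  thus ?thesis by (simp add: f_def curve_C_poly_def eval2.hom_quintic emb_simps)
qed

lemma transc_u: "transcendental u"
  using generic_point_transcendental[OF gen] degree_f by simp

lemma eval2_nz: "g \<noteq> 0 \<Longrightarrow> degree g < 4 \<Longrightarrow> eval2 emb g u v \<noteq> 0"
  using gen degree_f dvd_imp_degree_le[of f g] by (auto simp: generic_point_def)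

definition r where "r = u\<^sup>2 + v\<^sup>2"
abbreviation "a \<equiv> emb t"
definition s where "s = a\<^sup>2 + 1"
definition x' where "x' = a * (r - 2 * v) / u"
definition x where "x = x' - (a\<^sup>2 - 1)"
definition P where "P = (a ^ 4 + 6 * a\<^sup>2 - 3) / 2"
definition c where "c = (a\<^sup>2 - 1) / 2"
definition y where "y = a * (P - 2 * x') * r / (s * u) - c * x' - 2 * a\<^sup>2"

lemma u_nz: "u \<noteq> 0"
  by (rule transcendental_nz[OF transc_u])

lemma r_nz: "r \<noteq> 0"
  using eval2_nz[of "[:[:0, 0, 1:], 0, 1:]"] by (simp add: r_def emb_simps power2_eq_square)

lemma s_emb: "s = emb (t\<^sup>2 + 1)" and P_emb: "P = emb ((t ^ 4 + 6 * t\<^sup>2 - 3) / 2)" and c_emb: "c = emb ((t\<^sup>2 - 1) / 2)"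
  by (simp_all add: s_def P_def c_def emb_simps)

lemma a_nz': "a \<noteq> 0" and s_nz': "s \<noteq> 0"
  using t_nz s_nz by (simp_all add: s_emb)

text \<open>A constant value would be a relation of degree 2 in v, whereas nonzero relations are
  multiples of f, of degree at least 4.\<close>

lemma x'_neq: "x' \<noteq> emb k"
proof
  assume "x' = emb k"
  hence "a * (r - 2 * v) - emb k * u = 0" using u_nz by (simp add: x'_def field_simps)
  moreover have "a * (r - 2 * v) - emb k * u = eval2 emb [:[:0, - k, t:], [:- (2 * t):], [:t:]:] u v"
    by (simp add: r_def emb_simps power2_eq_square algebra_simps)
  ultimately show False using eval2_nz[of "[:[:0, - k, t:], [:- (2 * t):], [:t:]:]"] t_nz by simp
qed

lemma weierstrass: "y\<^sup>2 = x ^ 3 + emb (t\<^sup>2 - 2) * x\<^sup>2 + emb ((t\<^sup>2 + 1)\<^sup>2) * x"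
  using weierstrass_coordinates[OF quintic_uv u_nz r_nz[unfolded r_def] s_nz'[unfolded s_def]]
  by (simp add: emb_simps x_def x'_def y_def r_def s_def P_def c_def)

lemma L_subfield: "is_subfield L" and u_L: "u \<in> L" and v_L: "v \<in> L" and emb_L: "emb k \<in> L"
  by (rule is_subfield_function_field function_field_gens)+

lemmas L_closed = is_subringD[OF is_subfieldD(1)[OF L_subfield]] is_subfieldD(2,3)[OF L_subfield]

lemma numeral_L: "numeral n \<in> L"
  using emb_L[of "numeral n"] by (simp add: emb_simps)

lemma r_L: "r \<in> L" and x'_L: "x' \<in> L"
  unfolding r_def x'_def by (intro L_closed u_L v_L emb_L numeral_L)+

lemma x_L: "x \<in> L" and y_L: "y \<in> L"
  unfolding x_def y_def s_emb P_emb c_emb by (intro L_closed x'_L u_L emb_L numeral_L r_L)+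

lemma denominator: "y + c * x' + 2 * a\<^sup>2 = a * (P - 2 * x') * r / (s * u)"
  by (simp add: y_def)

lemma denominator_nz: "y + c * x' + 2 * a\<^sup>2 \<noteq> 0"
proof -
  have "P / 2 = emb ((t ^ 4 + 6 * t\<^sup>2 - 3) / 2 / 2)" by (simp add: P_emb emb_simps)
  hence "P / 2 \<noteq> x'" using x'_neq by metis
  hence "P - 2 * x' \<noteq> 0" by auto
  thus ?thesis unfolding denominator using a_nz' s_nz' u_nz r_nz by simp
qed

text \<open>The formula for y determines p = u/r from x' and y, then x' = a (1 - 2q) / p determines
  q = v/r, and a second inversion returns u and v. M is arbitrary because the result is applied both
  to k(x, y) and to the field of algebraic elements.\<close>

lemma uv_from_xy:
  assumes M: "is_subfield M" "\<And>k. emb k \<in> M" "x \<in> M" "y \<in> M"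
  shows "u \<in> M \<and> v \<in> M"
proof -
  note MC = is_subringD[OF is_subfieldD(1)[OF M(1)]] is_subfieldD(2,3)[OF M(1)]
  have num: "numeral n \<in> M" for n using M(2)[of "numeral n"] by (simp add: emb_simps)
  define p where "p = a * (P - 2 * x') / (s * (y + c * x' + 2 * a\<^sup>2))"
  define q where "q = (1 - p * x' / a) / 2"
  have "x' = x + (a\<^sup>2 - 1)" by (simp add: x_def)
  moreover have "x + (a\<^sup>2 - 1) \<in> M" by (intro MC M num)
  ultimately have x': "x' \<in> M" by simp
  have pM: "p \<in> M" unfolding p_def s_emb P_emb c_emb by (intro MC M num x')
  have qM: "q \<in> M" unfolding q_def by (intro MC M num x' pM)
  have "P - 2 * x' \<noteq> 0" using denominator_nz unfolding denominator by auto
  hence p: "p = u / r" unfolding p_def denominator using a_nz' s_nz' u_nz r_nz by (simp add: field_simps)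
  have "p * x' / a = 1 - 2 * (v / r)" using a_nz' u_nz r_nz by (simp add: p x'_def diff_divide_distrib)
  hence q: "q = v / r" by (simp add: q_def)
  have pq: "p\<^sup>2 + q\<^sup>2 = 1 / r"
  proof -
    have "p\<^sup>2 + q\<^sup>2 = (u\<^sup>2 + v\<^sup>2) / (r * r)" by (simp add: p q power_divide power2_eq_square add_divide_distrib)
    thus ?thesis using r_nz by (simp flip: r_def)
  qed
  have "u = p / (p\<^sup>2 + q\<^sup>2)" "v = q / (p\<^sup>2 + q\<^sup>2)" unfolding pq using r_nz by (simp_all add: p q)
  moreover have "p / (p\<^sup>2 + q\<^sup>2) \<in> M" "q / (p\<^sup>2 + q\<^sup>2) \<in> M" by (intro MC pM qM)+
  ultimately show ?thesis by simp
qed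

lemma transc_x: "transcendental x"
proof (rule ccontr)
  assume "\<not> transcendental x"
  hence x: "x \<in> algebraic_elements" by (simp add: algebraic_elements_def)
  have "y\<^sup>2 \<in> algebraic_elements"
    unfolding weierstrass
    by (intro is_subringD[OF is_subfieldD(1)[OF is_subfield_algebraic]] x emb_algebraic)
  hence y: "y \<in> algebraic_elements" by (rule sqrt_algebraic)
  show False
    using uv_from_xy[OF is_subfield_algebraic emb_algebraic x y] transc_u by (simp add: algebraic_elements_def)
qed

lemma nonsing: "(t\<^sup>2 + 1)\<^sup>2 \<noteq> 0" "(t\<^sup>2 - 2)\<^sup>2 \<noteq> 4 * (t\<^sup>2 + 1)\<^sup>2"
proof -
  show "(t\<^sup>2 + 1)\<^sup>2 \<noteq> 0" using s_nz by simp
  have "(t\<^sup>2 - 2)\<^sup>2 - 4 * (t\<^sup>2 + 1)\<^sup>2 = - (3 * t\<^sup>2 * (t\<^sup>2 + 4))"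
    by (simp add: power2_eq_square algebra_simps)
  moreover have "3 * t\<^sup>2 * (t\<^sup>2 + 4) \<noteq> 0" using t_nz t4_nz by simp
  ultimately show "(t\<^sup>2 - 2)\<^sup>2 \<noteq> 4 * (t\<^sup>2 + 1)\<^sup>2" by auto
qed

sublocale E: elliptic "t\<^sup>2 - 2" "(t\<^sup>2 + 1)\<^sup>2" x y
  using weierstrass transc_x nonsing by unfold_locales

lemma field_xy: "function_field x y = L"
  using uv_from_xy[OF is_subfield_function_field] x_L y_L
  by (intro function_field_eqI) (auto intro: function_field_gens)

text \<open>The fiber is smooth at the origin with tangent u = 0 and parameter v, and u is a unit
  times v^3 there; hence x' = a (u^2 + v^2 - 2v) / u has a pole of order 2. Conversely, at a pole of
  x the inverse formulas force u and v to vanish.\<close>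

lemma places_origin:
  assumes R: "R \<in> places L"
  shows "u \<in> max_ideal R \<and> v \<in> max_ideal R \<longleftrightarrow> x \<notin> R"
proof -
  interpret place L R using R by unfold_locales (rule L_subfield)
  have aR: "a \<in> R" "inverse a \<in> R" and sR: "s \<in> R" "s \<notin> m" and PR: "P \<in> R" and cR: "c \<in> R"
    using emb_R emb_unit[of "t\<^sup>2 + 1"] s_nz by (simp_all add: s_emb P_emb c_emb flip: emb_inverse)
  have aU: "a \<notin> m" using emb_unit t_nz by simp
  show ?thesis
  proof
    assume "u \<in> m \<and> v \<in> m"
    hence um: "u \<in> m" and vm: "v \<in> m" by auto
    note uR = m_R[OF um] and vR = m_R[OF vm]
    define w where "w = v * (v - 2) + u * (u - 2 * a)"
    define k where "k = s * s - s * (2 * a * u + 2 * v) - a * u * w"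
    have wm: "w \<in> m" unfolding w_def by (intro m_add m_mult' um vm R_closed uR vR numeral_R aR)
    have "s * (2 * a * u + 2 * v) + a * u * w \<in> m"
      by (intro m_add m_mult um vm wm R_closed uR vR numeral_R aR sR)
    from unit_add[OF _ _ m_uminus[OF this], of "s * s"] have k: "k \<in> R" "k \<notin> m"
      using unit_mult[OF sR sR] by (simp_all add: k_def algebra_simps)
    \<comment> \<open>The equation of the fiber with all terms divisible by u collected on the left;
      k is the unit s^2 up to an element of the maximal ideal.\<close>
    have "u * k = a * v\<^sup>2 * w"
      using quintic_uv unfolding quintic_def k_def w_def s_def by (simp add: power2_eq_square algebra_simps)
    hence u: "u = a * inverse k * v\<^sup>2 * w" using unitD[OF k] by (simp add: field_simps)
    define e where "e = a * inverse k"
    have e: "e \<in> R" "e \<notin> m" using unit_mult[OF aR(1) aU] unitD[OF k] by (auto simp: e_def)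
    define h where "h = (v - 2) + e * v * w * (u - 2 * a)"
    have two: "-2 \<in> R" "-2 \<notin> m" using emb_R[of "-2"] emb_unit[of "-2"] by (simp_all add: emb_simps)
    have "v + e * v * w * (u - 2 * a) \<in> m"
      by (intro m_add vm m_mult'[OF m_mult[OF wm]] R_closed e uR vR numeral_R aR)
    from unit_add[OF two this] have h: "h \<in> R" "h \<notin> m" by (simp_all add: h_def algebra_simps)
    have "v - 2 \<in> R \<and> v - 2 \<notin> m" using unit_add[OF two vm] by simp
    have "v * h = v * (v - 2) + (a * inverse k * v\<^sup>2 * w) * (u - 2 * a)"
      by (simp add: h_def e_def algebra_simps power2_eq_square)
    hence w: "w = v * h" unfolding u[symmetric] by (simp add: w_def)
    have u': "u = e * h * v\<^sup>2 * v" by (subst u, subst w) (simp add: e_def algebra_simps)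
    have v0: "v \<noteq> 0" using u' u_nz by auto
    have eh: "e * h \<in> R" "e * h \<notin> m" using unit_mult[OF e h] by auto
    have "x' = a * u + a * ((v - 2) / (e * h * v\<^sup>2))"
    proof -
      have "x' = a * u + a * (v * (v - 2)) / u" using u_nz by (simp add: x'_def r_def field_simps power2_eq_square)
      also have "a * (v * (v - 2)) / u = a * ((v - 2) / (e * h * v\<^sup>2))"
        using v0 unitD[OF eh] by (subst u') (simp add: field_simps)
      finally show ?thesis .
    qed
    hence eq: "(x + (a\<^sup>2 - 1) - a * u) * (inverse a * (e * h)) * v\<^sup>2 = v - 2"
      using v0 unitD[OF eh] a_nz' by (simp add: x_def field_simps)
    show "x \<notin> R"
    proof
      assume "x \<in> R"
      hence "(x + (a\<^sup>2 - 1) - a * u) * (inverse a * (e * h)) * v\<^sup>2 \<in> m"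
        unfolding power2_eq_square by (intro m_mult m_mult' vm R_closed uR vR aR eh)
      thus False using unit_add[OF two vm] unfolding eq by simp
    qed
  next
    assume xR: "x \<notin> R"
    have x'R: "x' \<notin> R"
    proof
      assume "x' \<in> R"
      hence "x \<in> R" unfolding x_def by (intro R_closed aR)
      thus False using xR by simp
    qed
    define \<rho> where "\<rho> = inverse x'"
    have x'0: "x' \<noteq> 0" using x'R R_closed by auto
    have \<rho>: "\<rho> \<in> m" unfolding \<rho>_def by (rule inverse_m[OF x'_L x'R])
    note \<rho>R = m_R[OF \<rho>]
    define k where "k = 1 - (a\<^sup>2 - 1) * \<rho>"
    have kR: "k \<in> R" unfolding k_def by (intro R_closed aR \<rho>R)
    have xk: "x * \<rho> = k" using x'0 by (simp add: x_def k_def \<rho>_def field_simps)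
    \<comment> \<open>The pole of y is weaker than that of x'^2, because y^2 is a cubic in x; this
      puts q in the maximal ideal.\<close>
    define q where "q = y * \<rho>\<^sup>2"
    have "q\<^sup>2 = (x * \<rho>) * ((x * \<rho>)\<^sup>2 + emb (t\<^sup>2 - 2) * (x * \<rho>) * \<rho> + emb ((t\<^sup>2 + 1)\<^sup>2) * \<rho>\<^sup>2) * \<rho>"
      unfolding q_def power_mult_distrib weierstrass by (simp add: algebra_simps power2_eq_square power3_eq_cube)
    also have "\<dots> \<in> m" unfolding xk by (intro m_mult \<rho> R_closed kR emb_R \<rho>R)
    finally have q2: "q\<^sup>2 \<in> m" .
    have "q \<in> L" unfolding q_def \<rho>_def by (intro L_closed y_L x'_L)
    hence q: "q \<in> m" using q2 by (rule power2_m)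
    \<comment> \<open>The quotient of r/u by x'. The formula for y multiplied by \<rho>^2 expresses
      j through q and \<rho> up to the unit P \<rho> - 2, so j vanishes at this place.\<close>
    define j where "j = r / (a * (r - 2 * v))"
    have r2v: "r - 2 * v \<noteq> 0" using x'0 by (auto simp: x'_def)
    have rj: "r / u = j * x'" using r2v a_nz' by (simp add: j_def x'_def)
    have "q + c * \<rho> + 2 * a\<^sup>2 * \<rho>\<^sup>2 = (y + c * x' + 2 * a\<^sup>2) * \<rho>\<^sup>2"
      using x'0 by (simp add: q_def \<rho>_def power2_eq_square field_simps)
    also have "\<dots> = (a / s) * (P - 2 * x') * (r / u) * \<rho>\<^sup>2" unfolding denominator by simp
    also have "\<dots> = (a / s) * (P * \<rho> - 2 * (x' * \<rho>)) * j * (x' * \<rho>)"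
      unfolding rj by (simp add: power2_eq_square algebra_simps)
    also have "x' * \<rho> = 1" using x'0 by (simp add: \<rho>_def)
    also have "(a / s) * (P * \<rho> - 2 * 1) * j * 1 = (a / s) * (P * \<rho> - 2) * j" by simp
    finally have jeq: "q + c * \<rho> + 2 * a\<^sup>2 * \<rho>\<^sup>2 = (a / s) * (P * \<rho> - 2) * j" .
    have "-2 \<in> R" "-2 \<notin> m" using emb_R[of "-2"] emb_unit[of "-2"] by (simp_all add: emb_simps)
    from unit_add[OF this m_mult[OF \<rho> PR]] have d: "P * \<rho> - 2 \<in> R" "P * \<rho> - 2 \<notin> m" by simp_all
    have "j = s * inverse a * inverse (P * \<rho> - 2) * (q + c * \<rho> + 2 * a\<^sup>2 * \<rho>\<^sup>2)"
      unfolding jeq using a_nz' s_nz' unitD[OF d] by (simp add: field_simps)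
    also have "\<dots> \<in> m"
    proof (rule m_mult)
      show "q + c * \<rho> + 2 * a\<^sup>2 * \<rho>\<^sup>2 \<in> m"
        unfolding power2_eq_square[of \<rho>] by (intro m_add m_mult q \<rho> R_closed \<rho>R cR aR numeral_R)
      show "s * inverse a * inverse (P * \<rho> - 2) \<in> R" using unitD[OF d] by (intro R_closed sR aR) auto
    qed
    finally have j: "j \<in> m" .
    \<comment> \<open>D is a unit with value -1 and equals 2v / (r - 2v). Dividing \<rho> and j by
      it shows that u/v and r/v vanish; then v vanishes because r/v = v (1 + (u/v)^2).\<close>
    define D where "D = a * j - 1"
    have "-1 \<in> R" "-1 \<notin> m" using emb_R[of "-1"] emb_unit[of "-1"] by (simp_all add: emb_simps)
    from unit_add[OF this m_mult[OF j aR(1)]] have D: "D \<in> R" "D \<notin> m" by (simp_all add: D_def)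
    have DI: "inverse D \<in> R" "D \<noteq> 0" using unitD[OF D] by auto
    have Dv: "D = 2 * v / (r - 2 * v)" using r2v a_nz' by (simp add: D_def j_def field_simps)
    have v0: "v \<noteq> 0" using DI(2) by (auto simp: Dv)
    define \<tau> where "\<tau> = u / v"
    have "\<tau> = 2 * a * inverse D * \<rho>"
      using r2v a_nz' v0 u_nz by (simp add: \<tau>_def Dv \<rho>_def x'_def field_simps)
    also have "\<dots> \<in> m" by (intro m_mult \<rho> R_closed numeral_R aR DI)
    finally have \<tau>: "\<tau> \<in> m" .
    have "r / v = 2 * a * inverse D * j"
      using r2v a_nz' v0 by (simp add: Dv j_def field_simps)
    also have "\<dots> \<in> m" by (intro m_mult j R_closed numeral_R aR DI)
    finally have rv: "r / v \<in> m" .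
    have n: "1 + \<tau>\<^sup>2 \<in> R" "1 + \<tau>\<^sup>2 \<notin> m"
      using unit_add[OF R_closed(1) one_notin_m, of "\<tau>\<^sup>2"] m_mult[OF \<tau> m_R[OF \<tau>]] by (simp_all add: power2_eq_square)
    have "r / v = v * (1 + \<tau>\<^sup>2)" using v0
      by (simp add: r_def \<tau>_def power2_eq_square add_divide_distrib distrib_left)
    hence "v = r / v * inverse (1 + \<tau>\<^sup>2)" using unitD[OF n] by (simp add: mult.assoc)
    moreover have "r / v * inverse (1 + \<tau>\<^sup>2) \<in> m" using unitD[OF n] by (intro m_mult' rv) simp
    ultimately have v: "v \<in> m" by simp
    have "u = \<tau> * v" using v0 by (simp add: \<tau>_def)
    moreover have "\<tau> * v \<in> m" by (intro m_mult v m_R \<tau>)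
    ultimately show "u \<in> m \<and> v \<in> m" using v by simp
  qed
qed

end

section \<open>Weierstrass models of a fiber and their discriminants\<close>

lemma transcendental_scale: "transcendental u \<Longrightarrow> k \<noteq> 0 \<Longrightarrow> transcendental (emb k * u)"
  using transcendental_reciprocal[OF transcendental_reciprocal[of u 1], of k]
  by (simp add: emb_simps field_class.field_divide_inverse)

text \<open>The choice k = 1/t will give a model that is regular over the point t = infinity of the
  base; k = 1 serves over the other points.\<close>

lemma (in elliptic) scale:
  assumes "k \<noteq> 0"
  shows "elliptic (k\<^sup>2 * \<alpha>) (k ^ 4 * \<beta>) (emb (k\<^sup>2) * x) (emb (k ^ 3) * y)"
    and "function_field (emb (k\<^sup>2) * x) (emb (k ^ 3) * y) = L"
proof -
  show "elliptic (k\<^sup>2 * \<alpha>) (k ^ 4 * \<beta>) (emb (k\<^sup>2) * x) (emb (k ^ 3) * y)"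
  proof
    have "(emb (k ^ 3) * y)\<^sup>2 = emb k ^ 6 * y\<^sup>2" by (simp add: power_mult_distrib emb_simps flip: power_mult)
    thus "(emb (k ^ 3) * y)\<^sup>2 = (emb (k\<^sup>2) * x) ^ 3 + emb (k\<^sup>2 * \<alpha>) * (emb (k\<^sup>2) * x)\<^sup>2 + emb (k ^ 4 * \<beta>) * (emb (k\<^sup>2) * x)"
      unfolding y2 by (simp add: emb_simps algebra_simps power_numeral_reduce)
    show "transcendental (emb (k\<^sup>2) * x)" using transcendental_scale[OF transc] assms by simp
    have "(k\<^sup>2 * \<alpha>)\<^sup>2 = k ^ 4 * \<alpha>\<^sup>2" by (simp add: power_mult_distrib flip: power_mult)
    thus "(k\<^sup>2 * \<alpha>)\<^sup>2 \<noteq> 4 * (k ^ 4 * \<beta>)" using assms nonsing(2) by simp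
  qed (use assms nonsing in simp)
  have gen: "emb c * z \<in> M \<longleftrightarrow> z \<in> M" if "c \<noteq> 0" "is_subfield M" "\<And>c. emb c \<in> M" for c z and M :: "'k univ set"
  proof
    assume "emb c * z \<in> M"
    hence "emb (inverse c) * (emb c * z) \<in> M" by (rule is_subringD(4)[OF is_subfieldD(1)[OF that(2)] that(3)])
    moreover have "emb (inverse c) * (emb c * z) = z" using that(1) by (simp add: emb_inverse)
    ultimately show "z \<in> M" by simp
  qed (rule is_subringD(4)[OF is_subfieldD(1)[OF that(2)] that(3)])
  have k: "k\<^sup>2 \<noteq> 0" "k ^ 3 \<noteq> 0" using assms by simp_all
  show "function_field (emb (k\<^sup>2) * x) (emb (k ^ 3) * y) = L"
  proof (rule function_field_eqI)
    note g = gen[OF k(1) is_subfield_function_field function_field_gens(1)]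
      gen[OF k(2) is_subfield_function_field function_field_gens(1)]
    show "emb (k\<^sup>2) * x \<in> L" by (rule iffD2[OF g(1) x_L])
    show "emb (k ^ 3) * y \<in> L" by (rule iffD2[OF g(2) y_L])
    show "x \<in> function_field (emb (k\<^sup>2) * x) (emb (k ^ 3) * y)"
      by (rule iffD1[OF g(1) function_field_gens(2)])
    show "y \<in> function_field (emb (k\<^sup>2) * x) (emb (k ^ 3) * y)"
      by (rule iffD1[OF g(2) function_field_gens(3)])
  qed
qed

context fiber
begin

lemma weierstrass_model_f:
  assumes "k \<noteq> 0"
  shows "weierstrass_model f 0 0 (Weierstrass 0 (k\<^sup>2 * (t\<^sup>2 - 2)) 0 (k ^ 4 * (t\<^sup>2 + 1)\<^sup>2) 0)"
proof -
  obtain u v where gen: "generic_point f u v" using generic_exists by blast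
  then interpret fiber_point t u v by unfold_locales
  interpret S: elliptic "k\<^sup>2 * (t\<^sup>2 - 2)" "k ^ 4 * (t\<^sup>2 + 1)\<^sup>2" "emb (k\<^sup>2) * x" "emb (k ^ 3) * y"
    by (rule E.scale(1)[OF assms])
  have "x \<in> R \<longleftrightarrow> emb (k\<^sup>2) * x \<in> R" if "R \<in> places L" for R
  proof -
    interpret place L R using that by unfold_locales (rule L_subfield)
    have "emb (inverse (k\<^sup>2)) * (emb (k\<^sup>2) * x) = x" using assms by (simp add: emb_simps)
    thus ?thesis using R_closed(4) emb_R by metis
  qed
  thus ?thesis
    unfolding weierstrass_model_def
    using gen S.generic E.scale(2)[OF assms] field_xy places_origin
    by (intro exI[of _ u] exI[of _ v] exI[of _ "emb (k\<^sup>2) * x"] exI[of _ "emb (k ^ 3) * y"]) (simp add: emb_simps)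
qed

lemma weierstrass_model_discriminant:
  assumes "weierstrass_model f 0 0 W"
  shows "\<exists>k. k \<noteq> 0 \<and> discriminant W = k ^ 12 * (- 48 * t\<^sup>2 * (t\<^sup>2 + 1) ^ 4 * (t\<^sup>2 + 4))"
proof -
  obtain u v u' v' where gen: "generic_point f u v" and W: "generic_point (weierstrass_poly W) u' v'"
    and fe: "function_field u v = function_field u' v'"
    and pl: "\<And>R. R \<in> places (function_field u v) \<Longrightarrow> u \<in> max_ideal R \<and> v \<in> max_ideal R \<longleftrightarrow> u' \<notin> R"
    using assms unfolding weierstrass_model_def by (auto simp: emb_simps)
  then interpret fiber_point t u v by unfold_locales
  interpret C: elliptic_change "t\<^sup>2 - 2" "(t\<^sup>2 + 1)\<^sup>2" x y W u' v'
    using W fe pl places_origin by unfold_locales (auto simp: field_xy)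
  have "16 * ((t\<^sup>2 + 1)\<^sup>2)\<^sup>2 * ((t\<^sup>2 - 2)\<^sup>2 - 4 * (t\<^sup>2 + 1)\<^sup>2) = - 48 * t\<^sup>2 * (t\<^sup>2 + 1) ^ 4 * (t\<^sup>2 + 4)"
  proof -
    have "(t\<^sup>2 - 2)\<^sup>2 - 4 * (t\<^sup>2 + 1)\<^sup>2 = - (3 * t\<^sup>2 * (t\<^sup>2 + 4))"
      by (simp add: power2_eq_square algebra_simps)
    thus ?thesis by (simp flip: power_mult)
  qed
  thus ?thesis using C.discriminant_change by (simp only:)
qed

end

lemma discriminant_scaled:
  "discriminant (Weierstrass 0 (k\<^sup>2 * (t\<^sup>2 - 2)) 0 (k ^ 4 * (t\<^sup>2 + 1)\<^sup>2) 0) =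
    k ^ 12 * (- 48 * t\<^sup>2 * (t\<^sup>2 + 1) ^ 4 * (t\<^sup>2 + 4) :: 'a::field_char_0)"
proof -
  define A where "A = k\<^sup>2 * (t\<^sup>2 - 2)" define B where "B = k ^ 4 * (t\<^sup>2 + 1)\<^sup>2"
  have "discriminant (Weierstrass 0 A 0 B 0) = 16 * B\<^sup>2 * (A\<^sup>2 - 4 * B)"
    by (simp add: discriminant_def power2_eq_square power3_eq_cube algebra_simps)
  also have "A\<^sup>2 - 4 * B = k ^ 4 * ((t\<^sup>2 - 2)\<^sup>2 - 4 * (t\<^sup>2 + 1)\<^sup>2)"
  proof -
    have "A\<^sup>2 = k ^ 4 * (t\<^sup>2 - 2)\<^sup>2" unfolding A_def power_mult_distrib by (simp flip: power_mult)
    thus ?thesis by (simp add: B_def right_diff_distrib)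
  qed
  also have "(t\<^sup>2 - 2)\<^sup>2 - 4 * (t\<^sup>2 + 1)\<^sup>2 = - (3 * t\<^sup>2 * (t\<^sup>2 + 4))"
    by (simp add: power2_eq_square algebra_simps)
  also have "16 * B\<^sup>2 * (k ^ 4 * - (3 * t\<^sup>2 * (t\<^sup>2 + 4))) = (k ^ 8 * k ^ 4) * (- 48 * t\<^sup>2 * (t\<^sup>2 + 1) ^ 4 * (t\<^sup>2 + 4))"
    by (simp add: B_def power_mult_distrib mult_ac flip: power_mult)
  finally show ?thesis by (simp add: A_def B_def flip: power_add)
qed

section \<open>The geometric genus of the generic fiber\<close>

lemma rhom_to_ac: "rhom (to_ac :: 'k::field \<Rightarrow> 'k alg_closure)"
  by standard simp_all

lemma map_poly_curve_C_poly: "map_poly (map_poly to_ac) (curve_C_poly a b) = curve_C_poly (to_ac a) (to_ac b)"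
proof -
  interpret h: rhom "map_poly (map_poly to_ac)"
    by (intro rhom.rhom_map_poly rhom_to_ac)
  show ?thesis
    by (simp add: curve_C_poly_def h.hom_quintic map_poly_pCons)
qed

lemma fiber_generic: "fiber (Fract [:0, 1:] 1 :: 'k::{field_gcd,field_char_0} poly fract)"
proof
  show "Fract [:0, 1:] 1 \<noteq> (0 :: 'k poly fract)" by (simp add: Zero_fract_def eq_fract)
  have "(Fract [:0, 1:] 1)\<^sup>2 + Fract [:c:] 1 \<noteq> (0 :: 'k poly fract)" for c
    by (simp add: power2_eq_square Zero_fract_def eq_fract)
  note * = this
  have num: "numeral n = (Fract (numeral n) 1 :: 'k poly fract)" for n
  proof -
    have "of_nat n = (Fract (of_nat n) 1 :: 'k poly fract)" for n
      by (induction n) (simp_all add: Zero_fract_def One_fract_def)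
    thus ?thesis by (metis of_nat_numeral)
  qed
  show "(Fract [:0, 1:] 1)\<^sup>2 + 1 \<noteq> (0 :: 'k poly fract)" using *[of 1] by (simp add: One_fract_def flip: one_pCons)
  show "(Fract [:0, 1:] 1)\<^sup>2 + 4 \<noteq> (0 :: 'k poly fract)" using *[of 4] by (simp only: num numeral_poly not_False_eq_True)
  show "(Fract [:0, 1:] 1)\<^sup>2 + 9 \<noteq> (0 :: 'k poly fract)" using *[of 9] by (simp only: num numeral_poly not_False_eq_True)
qed

lemma fiber_to_ac:
  assumes "fiber t"
  shows "fiber (to_ac t)"
proof -
  interpret fiber t by fact
  have "to_ac (t\<^sup>2 + 1) \<noteq> 0" "to_ac (t\<^sup>2 + 4) \<noteq> 0" "to_ac (t\<^sup>2 + 9) \<noteq> 0"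
    using s_nz t4_nz t9_nz by (simp_all only: to_ac_eq_0_iff not_False_eq_True)
  thus ?thesis using t_nz by unfold_locales simp_all
qed

lemma has_geometric_genus_1:
  "has_geometric_genus (generic_fiber :: 'k::{field_gcd,field_char_0} poly fract poly poly) 1"
proof -
  \<comment> \<open>Geometric genus refers to the base change to the algebraic closure of k(t),
    which again satisfies the conditions of \<open>fiber\<close>.\<close>
  define t where "t = to_ac (Fract [:0, 1:] 1 :: 'k poly fract)"
  interpret fiber t unfolding t_def by (rule fiber_to_ac[OF fiber_generic])
  have f: "map_poly (map_poly to_ac) generic_fiber = f"
    unfolding f_def unfolding generic_fiber_def map_poly_curve_C_poly t_def by simp
  obtain u v where gen: "generic_point f u v" using generic_exists by blast
  then interpret fiber_point t u v by unfold_locales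
  interpret D: elliptic_derivation "t\<^sup>2 - 2" "(t\<^sup>2 + 1)\<^sup>2" x y E.Der
    using E.derivation_Der E.Der_x by unfold_locales
  have "regular_differentials L E.Der = range emb"
    using D.regular_differentials_eq alg_closed_imp_poly_has_root unfolding field_xy by blast
  hence "vector_space.dim (\<lambda>c z. emb c * z) (regular_differentials L E.Der) = 1"
    by (simp add: dim_range_emb)
  moreover have "derivation_on L E.Der" using E.derivation_Der unfolding field_xy .
  moreover have "\<exists>z\<in>L. E.Der z \<noteq> 0" using E.Der_x D.y_nz x_L by (intro bexI[of _ x]) simp_all
  ultimately show ?thesis unfolding has_geometric_genus_def f using gen by blast
qed

section \<open>The singular fibers\<close>

lemma hom_eval_poly:
  assumes "degree p \<le> n" "b \<noteq> 0"
  shows "hom_eval n p a b = b ^ n * poly p (a / b)"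
proof -
  have "poly p (a / b) = (\<Sum>i\<le>n. coeff p i * (a / b) ^ i)"
    unfolding poly_altdef by (rule sum.mono_neutral_left) (use assms in \<open>auto simp: coeff_eq_0\<close>)
  also have "b ^ n * \<dots> = hom_eval n p a b"
    unfolding hom_eval_def sum_distrib_left
  proof (intro sum.cong refl)
    fix i assume "i \<in> {..n}"
    hence "b ^ n = b ^ i * b ^ (n - i)" by (simp flip: power_add)
    thus "b ^ n * (coeff p i * (a / b) ^ i) = coeff p i * a ^ i * b ^ (n - i)"
      using assms by (simp add: power_divide)
  qed
  finally show ?thesis by simp
qed

lemma hom_eval_infinity: "hom_eval n p a 0 = coeff p n * a ^ n"
proof -
  have "hom_eval n p a 0 = (\<Sum>i\<in>{n}. coeff p i * a ^ i * 0 ^ (n - i))"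
    unfolding hom_eval_def by (rule sum.mono_neutral_right) auto
  thus ?thesis by simp
qed

lemma hom_eval_mult:
  fixes p q :: "'k::field poly"
  assumes "degree p \<le> m" "degree q \<le> n"
  shows "hom_eval (m + n) (p * q) a b = hom_eval m p a b * hom_eval n q a b"
proof (cases "b = 0")
  case False
  have "degree (p * q) \<le> m + n" using degree_mult_le[of p q] assms by linarith
  thus ?thesis using False assms by (simp add: hom_eval_poly power_add algebra_simps)
next
  case True
  have "coeff (p * q) (m + n) = coeff p m * coeff q n"
  proof (cases "degree p = m \<and> degree q = n")
    case True
    thus ?thesis using coeff_mult_degree_sum[of p q] by simp
  next
    case False
    hence "degree p < m \<or> degree q < n" using assms by auto
    moreover from this have "degree (p * q) < m + n" using degree_mult_le[of p q] assms by linarith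
    ultimately show ?thesis by (auto simp: coeff_eq_0)
  qed
  thus ?thesis using True by (simp add: hom_eval_infinity power_add)
qed

lemma hom_eval_0 [simp]: "hom_eval n 0 a b = 0"
  by (simp add: hom_eval_def)

text \<open>Two representations of r are cross-multiplied; homogenized in degree n + m, one side is
  nonzero at (a, b) and the other is 0. This treats infinity like any other point.\<close>

lemma not_vanishes_at:
  assumes "r = Fract p q" "degree p \<le> n" "degree q \<le> n" "hom_eval n q a b \<noteq> 0" "hom_eval n p a b \<noteq> 0"
  shows "\<not> vanishes_at a b r"
proof
  assume "vanishes_at a b r"
  then obtain p' q' m where *: "r = Fract p' q'" "degree p' \<le> m" "degree q' \<le> m"
    "hom_eval m q' a b \<noteq> 0" "hom_eval m p' a b = 0"
    by (auto simp: vanishes_at_def)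
  have "q \<noteq> 0" "q' \<noteq> 0" using assms * by auto
  hence "p * q' = p' * q" using assms(1) *(1) by (simp add: eq_fract)
  hence "hom_eval (n + m) (p * q') a b = hom_eval (m + n) (p' * q) a b" by (simp add: add.commute)
  thus False using assms * by (simp add: hom_eval_mult)
qed

lemma regular_mult_vanishes:
  assumes "regular_at a b r" "vanishes_at a b w"
  shows "vanishes_at a b (r * w)"
proof -
  obtain p q n p' q' m where *: "r = Fract p q" "degree p \<le> n" "degree q \<le> n" "hom_eval n q a b \<noteq> 0"
    "w = Fract p' q'" "degree p' \<le> m" "degree q' \<le> m" "hom_eval m q' a b \<noteq> 0" "hom_eval m p' a b = 0"
    using assms by (auto simp: regular_at_def vanishes_at_def)
  have "r * w = Fract (p * p') (q * q')" using * by simp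
  moreover have "degree (p * p') \<le> n + m" "degree (q * q') \<le> n + m"
    using * degree_mult_le[of p p'] degree_mult_le[of q q'] by linarith+
  moreover have "hom_eval (n + m) (q * q') a b \<noteq> 0" "hom_eval (n + m) (p * p') a b = 0"
    using * by (simp_all add: hom_eval_mult)
  ultimately show ?thesis unfolding vanishes_at_def by blast
qed

lemma regular_at_affine: "regular_at \<tau> 1 r \<longleftrightarrow> (\<exists>p q. r = Fract p q \<and> poly q \<tau> \<noteq> 0)"
proof
  assume "\<exists>p q. r = Fract p q \<and> poly q \<tau> \<noteq> 0"
  then obtain p q where "r = Fract p q" "poly q \<tau> \<noteq> 0" by blast
  thus "regular_at \<tau> 1 r" unfolding regular_at_def
    by (intro exI[of _ p] exI[of _ q] exI[of _ "max (degree p) (degree q)"]) (simp add: hom_eval_poly)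
qed (force simp: regular_at_def hom_eval_poly)

lemma regular_at_affine_closed:
  assumes "regular_at \<tau> 1 r" "regular_at \<tau> 1 w"
  shows "regular_at \<tau> 1 (r * w)" "regular_at \<tau> 1 (r + w)" "regular_at \<tau> 1 (- r)" "regular_at \<tau> 1 (r - w)"
proof -
  obtain p q p' q' where *: "r = Fract p q" "poly q \<tau> \<noteq> 0" "w = Fract p' q'" "poly q' \<tau> \<noteq> 0"
    using assms by (auto simp: regular_at_affine)
  have nz: "q \<noteq> 0" "q' \<noteq> 0" using * by auto
  have qq: "poly (q * q') \<tau> \<noteq> 0" using * by simp
  show "regular_at \<tau> 1 (r * w)" "regular_at \<tau> 1 (r + w)" "regular_at \<tau> 1 (r - w)" "regular_at \<tau> 1 (- r)"
    unfolding regular_at_affine using * nz qq mult_fract add_fract diff_fract minus_fract by metis+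
qed

lemma regular_at_affine_poly: "regular_at \<tau> 1 (Fract p 1)"
  unfolding regular_at_affine by (metis poly_1 zero_neq_one)

lemma regular_at_affine_numeral: "regular_at \<tau> 1 (numeral n)"
proof -
  have "of_nat n = (Fract (of_nat n) 1 :: 'a poly fract)" for n
    by (induction n) (simp_all add: Zero_fract_def One_fract_def)
  thus ?thesis using regular_at_affine_poly by (metis of_nat_numeral)
qed

lemma regular_at_affine_power: "regular_at \<tau> 1 r \<Longrightarrow> regular_at \<tau> 1 (r ^ n)"
  using regular_at_affine_poly[of \<tau> 1]
  by (induction n) (simp_all add: regular_at_affine_closed flip: One_fract_def)

lemma regular_discriminant:
  assumes "regular_weierstrass_at \<tau> 1 W"
  shows "regular_at \<tau> 1 (discriminant W)"
proof -
  have "regular_at \<tau> 1 (wa1 W)" "regular_at \<tau> 1 (wa2 W)" "regular_at \<tau> 1 (wa3 W)"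
    "regular_at \<tau> 1 (wa4 W)" "regular_at \<tau> 1 (wa6 W)"
    using assms unfolding regular_weierstrass_at_def by (cases W; simp)+
  thus ?thesis
    unfolding discriminant_def Let_def
    by (intro regular_at_affine_closed regular_at_affine_power regular_at_affine_numeral)
qed

lemma regular_or_inverse_vanishes:
  fixes r :: "'k::field_gcd poly fract"
  shows "regular_at \<tau> 1 r \<or> (\<exists>p q. inverse r = Fract p q \<and> poly p \<tau> = 0 \<and> poly q \<tau> \<noteq> 0)"
proof -
  obtain p q where r: "r = Fract p q" "q \<noteq> 0" by (metis Fract_cases)
  obtain g p' q' where pq: "p = p' * g" "q = q' * g" "coprime p' q'" "g \<noteq> 0"
    using r(2) gcd_coprime_exists[of p q] by auto
  have r': "r = Fract p' q'" using pq r by (simp add: mult.commute[of _ g] mult_fract_cancel)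
  show ?thesis
  proof (cases "poly q' \<tau> = 0")
    case True
    have "poly p' \<tau> \<noteq> 0"
    proof
      assume "poly p' \<tau> = 0"
      hence "is_unit [:- \<tau>, 1:]" using True pq(3) coprime_common_divisor by (auto simp: poly_eq_0_iff_dvd)
      thus False by (simp add: is_unit_pCons_iff)
    qed
    moreover have "inverse r = Fract q' p'" by (simp add: r')
    ultimately show ?thesis using True by blast
  next
    case False
    thus ?thesis using r' by (auto simp: regular_at_affine)
  qed
qed

section \<open>Minimality of the explicit models\<close>

abbreviation weierstrass_scaled :: "'a::field \<Rightarrow> 'a \<Rightarrow> 'a weierstrass" where
  "weierstrass_scaled t k \<equiv> Weierstrass 0 (k\<^sup>2 * (t\<^sup>2 - 2)) 0 (k ^ 4 * (t\<^sup>2 + 1)\<^sup>2) 0"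

context
  fixes t :: "'k::{field_gcd,field_char_0} poly fract"
  defines "t \<equiv> Fract [:0, 1:] 1"
begin

text \<open>The zeros are 0 (order 2), the square roots of -1 (order 4 each) and of -4 (order 1
  each). The degree 12 equals the weight of the discriminant, so rescaling by 1/t leaves the value
  -48 at infinity.\<close>

definition discriminant_poly :: "'k poly" where
  "discriminant_poly = - 48 * [:0, 1:]\<^sup>2 * [:1, 0, 1:] ^ 4 * [:4, 0, 1:]"

lemma Fract_discriminant_poly: "- 48 * t\<^sup>2 * (t\<^sup>2 + 1) ^ 4 * (t\<^sup>2 + 4) = Fract discriminant_poly 1"
proof -
  interpret h: rhom "\<lambda>p. Fract p 1 :: 'k poly fract"
    by standard (simp_all add: One_fract_def)
  have "[:1, 0, 1:] = [:0, 1:]\<^sup>2 + (1 :: 'k poly)" "[:4, 0, 1:] = [:0, 1:]\<^sup>2 + (4 :: 'k poly)"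
    by (simp_all add: power2_eq_square one_pCons numeral_poly)
  thus ?thesis unfolding discriminant_poly_def t_def by (simp only: h.hom_simps)
qed

lemma degree_discriminant_poly: "degree discriminant_poly = 12" and lead_coeff_discriminant_poly: "coeff discriminant_poly 12 = - 48"
proof -
  have d: "degree ([:1, 0, 1:] ^ 4 :: 'k poly) = 8" "degree ([:0, 1:]\<^sup>2 :: 'k poly) = 2"
    "degree ([:4, 0, 1:] :: 'k poly) = 2" by (simp_all add: degree_power_eq)
  have c: "- 48 = [:- 48 :: 'k:]" by (simp add: numeral_poly)
  show "degree discriminant_poly = 12"
    unfolding discriminant_poly_def c using d by (simp add: degree_mult_eq del: mult_pCons_left mult_pCons_right)
  moreover have "lead_coeff discriminant_poly = - 48"
    unfolding discriminant_poly_def c by (simp add: lead_coeff_mult lead_coeff_power del: mult_pCons_left mult_pCons_right)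
  ultimately show "coeff discriminant_poly 12 = - 48" by simp
qed

lemma poly_discriminant_poly: "poly discriminant_poly z = - 48 * z\<^sup>2 * (z\<^sup>2 + 1) ^ 4 * (z\<^sup>2 + 4)"
  by (simp add: discriminant_poly_def power2_eq_square algebra_simps)

lemma generic_fiber_eq: "generic_fiber = fiber.f t"
  unfolding t_def generic_fiber_def by (rule fiber.f_def[OF fiber_generic, symmetric])

interpretation fiber t
  unfolding t_def by (rule fiber_generic)

lemma discriminant_poly_fract_nz: "Fract discriminant_poly 1 \<noteq> 0"
  using degree_discriminant_poly by (auto simp: Zero_fract_def eq_fract)

text \<open>The explicit model is regular at the point with nonvanishing discriminant. The
  discriminant of a minimal W divides it in the local ring, so it cannot vanish either.\<close>

lemma smooth_fiber:
  fixes a b :: 'k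
  assumes ab: "(a, b) \<noteq> (0, 0)" and nz: "a \<noteq> 0" "a\<^sup>2 + b\<^sup>2 \<noteq> 0" "a\<^sup>2 + 4 * b\<^sup>2 \<noteq> 0"
  shows "\<not> singular_fiber_at generic_fiber 0 0 a b"
proof
  assume "singular_fiber_at generic_fiber 0 0 a b"
  then obtain W where W: "minimal_weierstrass_model_at f 0 0 a b W" and van: "vanishes_at a b (discriminant W)"
    unfolding singular_fiber_at_def generic_fiber_eq by blast
  have dW: "discriminant W \<noteq> 0" using W by (simp add: minimal_weierstrass_model_at_def)
  have contra: False if k: "k \<noteq> 0" and reg: "regular_weierstrass_at a b (weierstrass_scaled t k)"
    and not_van: "\<not> vanishes_at a b (k ^ 12 * Fract discriminant_poly 1)" for k
  proof -
    have "regular_at a b (discriminant (weierstrass_scaled t k) / discriminant W)"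
      using W weierstrass_model_f[OF k] reg unfolding minimal_weierstrass_model_at_def by blast
    hence "vanishes_at a b (discriminant (weierstrass_scaled t k) / discriminant W * discriminant W)"
      using van by (rule regular_mult_vanishes)
    hence "vanishes_at a b (discriminant (weierstrass_scaled t k))" using dW by simp
    thus False using not_van unfolding discriminant_scaled Fract_discriminant_poly by simp
  qed
  have t2: "t\<^sup>2 - 2 = Fract [:-2, 0, 1:] 1" "(t\<^sup>2 + 1)\<^sup>2 = Fract ([:1, 0, 1:]\<^sup>2) 1"
  proof -
    interpret h: rhom "\<lambda>p. Fract p 1 :: 'k poly fract"
      by standard (simp_all add: One_fract_def)
    have "[:-2, 0, 1:] = [:0, 1:]\<^sup>2 - (2 :: 'k poly)" "[:1, 0, 1:] = [:0, 1:]\<^sup>2 + (1 :: 'k poly)"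
      by (simp_all add: power2_eq_square one_pCons numeral_poly)
    thus "t\<^sup>2 - 2 = Fract [:-2, 0, 1:] 1" "(t\<^sup>2 + 1)\<^sup>2 = Fract ([:1, 0, 1:]\<^sup>2) 1"
      unfolding t_def by (simp_all only: h.hom_simps)
  qed
  show False
  proof (cases "b = 0")
    case False
    have reg: "regular_at a b (Fract p 1)" for p
      unfolding regular_at_def
      by (intro exI[of _ p] exI[of _ 1] exI[of _ "degree p"]) (use False in \<open>simp add: hom_eval_poly\<close>)
    show False
    proof (rule contra[of 1])
      have "regular_at a b 0" using reg[of 0] by (simp flip: Zero_fract_def)
      thus "regular_weierstrass_at a b (weierstrass_scaled t 1)"
        unfolding regular_weierstrass_at_def t2 using reg by simp
      have "hom_eval 12 discriminant_poly a b = b ^ 12 * poly discriminant_poly (a / b)" using degree_discriminant_poly False by (simp add: hom_eval_poly)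
      also have "\<dots> \<noteq> 0"
      proof -
        define z where "z = a / b"
        have a: "a = z * b" using False by (simp add: z_def)
        have "z\<^sup>2 + 1 \<noteq> 0"
        proof
          assume "z\<^sup>2 + 1 = 0"
          moreover have "a\<^sup>2 + b\<^sup>2 = (z\<^sup>2 + 1) * b\<^sup>2" by (simp add: a algebra_simps power2_eq_square)
          ultimately show False using nz by simp
        qed
        moreover have "z\<^sup>2 + 4 \<noteq> 0"
        proof
          assume "z\<^sup>2 + 4 = 0"
          moreover have "a\<^sup>2 + 4 * b\<^sup>2 = (z\<^sup>2 + 4) * b\<^sup>2" by (simp add: a algebra_simps power2_eq_square)
          ultimately show False using nz by simp
        qed
        moreover have "z \<noteq> 0" using nz False by (simp add: z_def)
        ultimately show ?thesis using False by (simp add: poly_discriminant_poly flip: z_def)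
      qed
      finally show "\<not> vanishes_at a b (1 ^ 12 * Fract discriminant_poly 1)"
        using degree_discriminant_poly False by (intro not_vanishes_at[where p = discriminant_poly and q = 1 and n = 12]) (simp_all add: hom_eval_poly)
    qed simp
  next
    case True
    have a: "a \<noteq> 0" using nz by simp
    \<comment> \<open>At infinity the coefficients, of degrees 2 and 4 in t, become regular on
      division by t^2 and t^4.\<close>
    have ti: "inverse t ^ n = Fract 1 (monom 1 n)" for n
    proof -
      have "t ^ n = Fract (monom 1 n) 1"
        by (induction n) (simp_all add: t_def One_fract_def monom_Suc)
      thus ?thesis by (simp add: power_inverse inverse_fract)
    qed
    show False
    proof (rule contra[of "inverse t"])
      show "inverse t \<noteq> 0" using t_nz by simp
      have reg: "regular_at a b (Fract p (monom 1 n))" if "degree p \<le> n" for p n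
        unfolding regular_at_def
        by (intro exI[of _ p] exI[of _ "monom 1 n"] exI[of _ n])
          (use that True a in \<open>simp add: hom_eval_infinity degree_monom_le\<close>)
      have "regular_at a b 0" using reg[of 0 0] by (simp add: monom_0 Zero_fract_def flip: one_pCons)
      moreover have "degree ([:1, 0, 1:]\<^sup>2 :: 'k poly) = 4" by (simp add: degree_power_eq)
      ultimately show "regular_weierstrass_at a b (weierstrass_scaled t (inverse t))"
        unfolding regular_weierstrass_at_def t2 ti using reg by simp
      show "\<not> vanishes_at a b (inverse t ^ 12 * Fract discriminant_poly 1)"
        unfolding ti using degree_discriminant_poly True a lead_coeff_discriminant_poly
        by (intro not_vanishes_at[where p = discriminant_poly and q = "monom 1 12" and n = 12])
          (simp_all add: hom_eval_infinity degree_monom_le)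
    qed
  qed
qed

text \<open>A competing regular model has discriminant c^12 times the explicit one. If c were not
  regular at \<tau>, then 1/c would vanish there and (t - \<tau>)^12 would divide the explicit
  discriminant.\<close>

lemma singular_fiber:
  fixes \<iota> \<tau> :: 'k
  assumes \<iota>: "\<iota>\<^sup>2 = -1" and root: "poly discriminant_poly \<tau> = 0"
  shows "singular_fiber_at generic_fiber 0 0 \<tau> 1"
proof -
  have D: "discriminant (weierstrass_scaled t 1) = Fract discriminant_poly 1" unfolding discriminant_scaled Fract_discriminant_poly by simp
  have not_dvd: "\<not> [:- \<tau>, 1:] ^ 12 dvd discriminant_poly * q" if q: "poly q \<tau> \<noteq> 0" for q
  proof
    assume dvd: "[:- \<tau>, 1:] ^ 12 dvd discriminant_poly * q"
    have "prime_elem [:- \<tau>, 1:]" by (rule prime_elem_linear_poly) simp_all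
    hence "coprime [:- \<tau>, 1:] q" using q by (intro prime_elem_imp_coprime) (simp_all add: poly_eq_0_iff_dvd)
    hence "coprime ([:- \<tau>, 1:] ^ 12) q" by simp
    hence "[:- \<tau>, 1:] ^ 12 dvd discriminant_poly" using dvd coprime_dvd_mult_left_iff by blast
    then obtain h where h: "discriminant_poly = [:- \<tau>, 1:] ^ 12 * h" by (auto simp: dvd_def)
    \<comment> \<open>The twelfth power would exhaust the degree and leave \<tau> as the only root,
      whereas 0 and \<iota> are both roots.\<close>
    hence "h \<noteq> 0" using degree_discriminant_poly by auto
    hence "degree discriminant_poly = 12 + degree h" unfolding h by (subst degree_mult_eq) (auto simp: degree_power_eq)
    then obtain c where c: "h = [:c:]" using degree_discriminant_poly by (auto elim: degree_eq_zeroE)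
    have "c \<noteq> 0" using \<open>h \<noteq> 0\<close> c by simp
    have "z = \<tau>" if "poly discriminant_poly z = 0" for z
      using that \<open>c \<noteq> 0\<close> unfolding h c by (simp add: poly_power)
    hence "0 = \<tau>" "\<iota> = \<tau>" using \<iota> by (simp_all add: poly_discriminant_poly)
    thus False using \<iota> by simp
  qed
  have "regular_at \<tau> 1 (discriminant W / Fract discriminant_poly 1)"
    if W: "weierstrass_model f 0 0 W" "regular_weierstrass_at \<tau> 1 W" for W
  proof -
    obtain c where c: "c \<noteq> 0" "discriminant W = c ^ 12 * Fract discriminant_poly 1"
      using weierstrass_model_discriminant[OF W(1)] unfolding Fract_discriminant_poly by blast
    obtain p q where pq: "discriminant W = Fract p q" "poly q \<tau> \<noteq> 0"
      using regular_discriminant[OF W(2)] by (auto simp: regular_at_affine)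
    have "regular_at \<tau> 1 c"
    proof (rule ccontr)
      assume "\<not> regular_at \<tau> 1 c"
      then obtain m n where mn: "inverse c = Fract m n" "poly m \<tau> = 0" "poly n \<tau> \<noteq> 0"
        using regular_or_inverse_vanishes by blast
      have frac_pow: "Fract m n ^ i = Fract (m ^ i) (n ^ i)" for i
        by (induction i) (simp_all add: One_fract_def)
      have "Fract discriminant_poly 1 = discriminant W * inverse c ^ 12" using c by (simp add: power_inverse)
      also have "\<dots> = Fract (p * m ^ 12) (q * n ^ 12)" unfolding pq mn frac_pow by simp
      finally have "discriminant_poly * (q * n ^ 12) = p * m ^ 12"
        using pq mn by (subst (asm) eq_fract) auto
      moreover have "[:- \<tau>, 1:] ^ 12 dvd m ^ 12" using mn(2) by (intro dvd_power_same) (simp add: poly_eq_0_iff_dvd)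
      ultimately have "[:- \<tau>, 1:] ^ 12 dvd discriminant_poly * (q * n ^ 12)" by simp
      thus False using not_dvd[of "q * n ^ 12"] pq mn by simp
    qed
    hence "regular_at \<tau> 1 (c ^ 12)" by (rule regular_at_affine_power)
    thus ?thesis using c discriminant_poly_fract_nz by simp
  qed
  moreover have "regular_weierstrass_at \<tau> 1 (weierstrass_scaled t 1)"
  proof -
    have "regular_at \<tau> 1 t" "regular_at \<tau> 1 (0 :: 'k poly fract)" "regular_at \<tau> 1 (1 :: 'k poly fract)"
      using regular_at_affine_poly[of \<tau> 0] regular_at_affine_poly[of \<tau> 1] regular_at_affine_poly[of \<tau> "[:0, 1:]"]
      by (simp_all add: t_def Zero_fract_def One_fract_def)
    thus ?thesis unfolding regular_weierstrass_at_def
      by (simp add: regular_at_affine_closed regular_at_affine_power regular_at_affine_numeral)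
  qed
  ultimately have "minimal_weierstrass_model_at f 0 0 \<tau> 1 (weierstrass_scaled t 1)"
    unfolding minimal_weierstrass_model_at_def D using weierstrass_model_f[of 1] discriminant_poly_fract_nz by simp
  moreover have "vanishes_at \<tau> 1 (discriminant (weierstrass_scaled t 1))"
    unfolding D vanishes_at_def using root degree_discriminant_poly
    by (intro exI[of _ discriminant_poly] exI[of _ 1] exI[of _ 12]) (simp add: hom_eval_poly)
  ultimately show ?thesis unfolding singular_fiber_at_def generic_fiber_eq by blast
qed

end

section \<open>Projective sets defined by forms\<close>

lemma form_cast: "form A d F \<Longrightarrow> d = e \<Longrightarrow> (\<And>v. F v = G v) \<Longrightarrow> form A e G"
proof -
  assume "form A d F" "d = e" "\<And>v. F v = G v"
  moreover from this have "F = G" by blast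
  ultimately show ?thesis by simp
qed

lemma form_scale: "form A d F \<Longrightarrow> c \<in> A \<Longrightarrow> form A d (\<lambda>v. c * F v)"
  using form_mult[OF form_const, of c A d F] by simp

lemma form_diff: "form A d F \<Longrightarrow> form A d G \<Longrightarrow> -1 \<in> A \<Longrightarrow> form A d (\<lambda>v. F v - G v)"
  by (rule form_cast[OF form_add[OF _ form_scale[of A d G "-1"]]]) auto

lemma form_homogeneous: "form A d F \<Longrightarrow> F (c *s v) = c ^ d * F v"
  by (induction rule: form.induct) (simp_all add: algebra_simps power_add)

lemma form_compose:
  fixes \<Phi> :: "'k::field ^ 'm \<Rightarrow> 'k ^ 'n"
  assumes "form A d F" "\<And>i. form A e (\<lambda>v. \<Phi> v $ i)"
  shows "form A (d * e) (\<lambda>v. F (\<Phi> v))"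
  using assms(1)
proof (induction rule: form.induct)
  case (form_var i)
  thus ?case using assms(2)[of i] by simp
qed (auto intro: form.intros simp: add_mult_distrib)

text \<open>Forms are mere functions; restricted to polynomial arcs they become polynomials, to
  which counting of roots applies.\<close>

lemma form_polynomial_arc:
  assumes "form A d F"
  shows "\<exists>P. \<forall>t. F (\<chi> i. poly (g i) t) = poly P t"
  using assms
proof (induction rule: form.induct)
  case (form_const c)
  thus ?case by (intro exI[of _ "[:c:]"]) simp
next
  case (form_var i)
  thus ?case by (intro exI[of _ "g i"]) simp
next
  case (form_add d F G)
  then obtain P P' where "\<forall>t. F (\<chi> i. poly (g i) t) = poly P t" "\<forall>t. G (\<chi> i. poly (g i) t) = poly P' t" by blast
  thus ?case by (intro exI[of _ "P + P'"]) simp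
next
  case (form_mult d F e G)
  then obtain P P' where "\<forall>t. F (\<chi> i. poly (g i) t) = poly P t" "\<forall>t. G (\<chi> i. poly (g i) t) = poly P' t" by blast
  thus ?case by (intro exI[of _ "P * P'"]) simp
qed

abbreviation poly2 :: "'k::field poly poly \<Rightarrow> 'k \<Rightarrow> 'k \<Rightarrow> 'k" where
  "poly2 f t z \<equiv> poly (poly f [:z:]) t"

lemma form_polynomial_family:
  assumes "form A d F"
  shows "\<exists>P. \<forall>t z. F (\<chi> i. poly2 (g i) t z) = poly2 P t z"
  using assms
proof (induction rule: form.induct)
  case (form_const c)
  thus ?case by (intro exI[of _ "[:[:c:]:]"]) simp
next
  case (form_var i)
  thus ?case by (intro exI[of _ "g i"]) simp
next
  case (form_add d F G)
  then obtain P P' where "\<forall>t z. F (\<chi> i. poly2 (g i) t z) = poly2 P t z" "\<forall>t z. G (\<chi> i. poly2 (g i) t z) = poly2 P' t z" by blast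
  thus ?case by (intro exI[of _ "P + P'"]) simp
next
  case (form_mult d F e G)
  then obtain P P' where "\<forall>t z. F (\<chi> i. poly2 (g i) t z) = poly2 P t z" "\<forall>t z. G (\<chi> i. poly2 (g i) t z) = poly2 P' t z" by blast
  thus ?case by (intro exI[of _ "P * P'"]) simp
qed

lemma poly_eq_0_if_cofinite:
  fixes P :: "'k::field_char_0 poly"
  assumes "finite S" "\<And>t. t \<notin> S \<Longrightarrow> poly P t = 0"
  shows "P = 0"
proof (rule ccontr)
  assume "P \<noteq> 0"
  hence "finite {t. poly P t = 0}" by (rule poly_roots_finite)
  hence "finite (S \<union> {t. poly P t = 0})" using assms(1) by simp
  moreover have "S \<union> {t. poly P t = 0} = UNIV" using assms(2) by auto
  ultimately show False using infinite_UNIV_char_0[where 'a = 'k] by simp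
qed

text \<open>On the line through a point where F is nonzero and one where G is, both restrict to
  nonzero polynomials in one variable.\<close>

lemma form_mult_eq_0:
  fixes F G :: "'k::field_char_0 ^ 'n \<Rightarrow> 'k"
  assumes F: "form UNIV d F" and G: "form UNIV e G" and z: "\<And>v. F v * G v = 0"
  shows "(\<forall>v. F v = 0) \<or> (\<forall>v. G v = 0)"
proof (rule ccontr)
  assume "\<not> ?thesis"
  then obtain v w where vw: "F v \<noteq> 0" "G w \<noteq> 0" by blast
  define g where "g i = [:v $ i, w $ i - v $ i:]" for i
  obtain P P' where P: "\<forall>t. F (\<chi> i. poly (g i) t) = poly P t" and P': "\<forall>t. G (\<chi> i. poly (g i) t) = poly P' t"
    using form_polynomial_arc[OF F] form_polynomial_arc[OF G] by metis
  have "(\<chi> i. poly (g i) 0) = v" "(\<chi> i. poly (g i) 1) = w" by (simp_all add: g_def vec_eq_iff)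
  hence "poly P 0 \<noteq> 0" "poly P' 1 \<noteq> 0" using P P' vw by metis+
  hence "P \<noteq> 0" "P' \<noteq> 0" by auto
  moreover have "P * P' = 0"
    by (rule poly_eq_0_if_cofinite[of "{}"]) (use P P' z in \<open>simp_all flip: P P'\<close>)
  ultimately show False by simp
qed

text \<open>Roots in \<open>A\<close> may be repeated, up to \<open>size A\<close> times, hence the
  exponent.\<close>

lemma linear_factors_dvd_power:
  fixes g :: "'k::field poly"
  assumes "\<And>z. z \<in># A \<Longrightarrow> poly g z = 0"
  shows "(\<Prod>z\<in>#A. [:- z, 1:]) dvd g ^ size A"
  using assms
proof (induction A)
  case (add z A)
  have "[:- z, 1:] dvd g" using add.prems[of z] by (simp add: poly_eq_0_iff_dvd)
  moreover have "(\<Prod>z\<in>#A. [:- z, 1:]) dvd g ^ size A" using add by simp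
  ultimately have "[:- z, 1:] * (\<Prod>z\<in>#A. [:- z, 1:]) dvd g * g ^ size A" by (rule mult_dvd_mono)
  thus ?case by (simp del: mult_pCons_left)
qed simp

text \<open>If \<open>F\<close> vanishes on almost all members of a family of finite sets whose cardinality is constant
  (counting multiplicity), then it vanishes on all of them: \<open>F\<^sup>n\<close> is a multiple of \<open>f\<close>.\<close>

lemma vanishing_specializes:
  fixes f F :: "'k::{alg_closed_field,field_char_0} poly poly"
  assumes fin: "finite S" and van: "\<And>t z. t \<notin> S \<Longrightarrow> poly2 f t z = 0 \<Longrightarrow> poly2 F t z = 0"
    and lc: "poly (lead_coeff f) t0 \<noteq> 0" and z0: "poly2 f t0 z0 = 0"
  shows "poly2 F t0 z0 = 0"
proof -
  define n where "n = degree f"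
  have f0: "f \<noteq> 0" using lc by auto
  define sp where "sp h t = map_poly (\<lambda>p. poly p t) h" for h :: "'k poly poly" and t :: 'k
  have sp: "poly (sp h t) z = poly2 h t z" for h t z
  proof (induction h)
    case (pCons p h)
    thus ?case by (simp add: sp_def map_poly_pCons)
  qed (simp add: sp_def)
  have coeff_sp: "coeff (sp h t) i = poly (coeff h i) t" for h t i by (simp add: sp_def coeff_map_poly)
  \<comment> \<open>Division of F^n by f up to a power of the leading coefficient. For almost all t
    the specialized f divides F^n, hence also the remainder, which has smaller degree; so each
    coefficient of r vanishes for almost all t.\<close>
  obtain q r where qr: "pseudo_divmod (F ^ n) f = (q, r)" by (metis surj_pair)
  define k where "k = Suc (degree (F ^ n)) - degree f"
  have eq: "smult (lead_coeff f ^ k) (F ^ n) = f * q + r" and r: "r = 0 \<or> degree r < degree f"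
    using pseudo_divmod[OF f0 qr] by (simp_all add: k_def)
  have peq: "poly (lead_coeff f) t ^ k * poly2 F t z ^ n = poly2 f t z * poly2 q t z + poly2 r t z" for t z
    using arg_cong[OF eq, of "\<lambda>h. poly2 h t z"] by (simp add: poly_power)
  have "coeff r i = 0" for i
  proof (rule poly_eq_0_if_cofinite)
    show "finite (S \<union> {t. poly (lead_coeff f) t = 0})" using fin f0 poly_roots_finite[of "lead_coeff f"] by simp
    fix t assume t: "t \<notin> S \<union> {t. poly (lead_coeff f) t = 0}"
    have deg: "degree (sp f t) = n"
    proof (rule antisym)
      show "degree (sp f t) \<le> n" by (rule degree_le) (simp add: coeff_sp n_def coeff_eq_0)
      show "n \<le> degree (sp f t)" by (rule le_degree) (use t in \<open>simp add: coeff_sp n_def\<close>)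
    qed
    have "sp f t \<noteq> 0" using t by (auto simp: poly_eq_iff coeff_sp dest: spec[of _ n])
    then obtain A where A: "size A = n" "sp f t = smult (lead_coeff (sp f t)) (\<Prod>z\<in>#A. [:- z, 1:])"
      using alg_closed_imp_factorization[of "sp f t"] deg by auto
    have "poly (sp F t) z = 0" if "z \<in># A" for z
    proof -
      have "[:- z, 1:] dvd (\<Prod>z\<in>#A. [:- z, 1:])" using that by (intro dvd_prod_mset) simp
      hence "[:- z, 1:] dvd sp f t" by (subst A(2)) (rule dvd_smult)
      hence "poly (sp f t) z = 0" by (simp add: poly_eq_0_iff_dvd)
      thus ?thesis using van t by (simp add: sp)
    qed
    from linear_factors_dvd_power[of A "sp F t", OF this] have "(\<Prod>z\<in>#A. [:- z, 1:]) dvd sp F t ^ n" by (simp add: A)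
    moreover have "lead_coeff (sp f t) \<noteq> 0" using \<open>sp f t \<noteq> 0\<close> by simp
    ultimately have "sp f t dvd sp F t ^ n" by (subst A(2)) (simp add: smult_dvd_iff)
    moreover have "sp r t = smult (poly (lead_coeff f) t ^ k) (sp F t ^ n) - sp f t * sp q t"
      by (rule iffD1[OF poly_eq_poly_eq_iff], rule ext) (simp add: sp poly_power peq)
    ultimately have "sp f t dvd sp r t" by (simp add: dvd_smult)
    moreover have "degree (sp r t) < n \<or> sp r t = 0"
    proof (cases "r = 0")
      case False
      have "degree (sp r t) \<le> degree r" by (rule degree_le) (simp add: coeff_sp coeff_eq_0)
      thus ?thesis using False r by (simp add: n_def)
    qed (simp add: sp_def)
    ultimately have "sp r t = 0" using dvd_imp_degree_le[of "sp f t" "sp r t"] deg by (metis leD)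
    thus "poly (coeff r i) t = 0" by (metis coeff_sp coeff_0)
  qed
  hence "r = 0" by (simp add: poly_eq_iff)
  hence "poly2 F t0 z0 ^ n = 0" using peq[of t0 z0] lc z0 by simp
  moreover have "n \<noteq> 0"
  proof
    assume "n = 0"
    then obtain c where "f = [:c:]" unfolding n_def by (auto elim: degree_eq_zeroE)
    thus False using lc z0 by simp
  qed
  ultimately show ?thesis by simp
qed

lemma proj_pt_self: "v \<in> proj_pt v"
  unfolding proj_pt_def by (intro CollectI exI[of _ 1]) simp

lemma proj_pt_scale: "c \<noteq> 0 \<Longrightarrow> proj_pt (c *s v) = proj_pt v"
proof -
  assume c: "c \<noteq> 0"
  have "\<exists>k. k \<noteq> 0 \<and> d *s v = (k * c) *s v" if "d \<noteq> 0" for d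
    using c that by (intro exI[of _ "d / c"]) simp
  thus ?thesis using c unfolding proj_pt_def by (force simp: vector_smult_assoc)
qed

lemma proj_pt_eq_iff: "proj_pt v = proj_pt w \<longleftrightarrow> (\<exists>c. c \<noteq> 0 \<and> v = c *s w)"
proof
  assume "proj_pt v = proj_pt w"
  thus "\<exists>c. c \<noteq> 0 \<and> v = c *s w" using proj_pt_self[of v] by (auto simp: proj_pt_def)
qed (auto simp: proj_pt_scale)

lemma proj_pt_in_iff:
  assumes "form A d F"
  shows "proj_pt w \<in> {proj_pt v | v. v \<noteq> 0 \<and> F v = 0} \<longleftrightarrow> w \<noteq> 0 \<and> F w = 0"
proof
  assume "proj_pt w \<in> {proj_pt v | v. v \<noteq> 0 \<and> F v = 0}"
  then obtain v c where "v \<noteq> 0" "F v = 0" "c \<noteq> 0" "w = c *s v" by (auto simp: proj_pt_eq_iff)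
  thus "w \<noteq> 0 \<and> F w = 0" using form_homogeneous[OF assms, of c v] by simp
qed blast

lemma zariski_closed_form: "form UNIV d F \<Longrightarrow> zariski_closed {proj_pt v | v. v \<noteq> 0 \<and> F v = 0}"
  unfolding zariski_closed_def by (intro exI[of _ "{F}"]) auto

lemma proj_space_eq: "proj_pt w \<in> proj_space \<longleftrightarrow> w \<noteq> 0"
proof
  assume "proj_pt w \<in> proj_space"
  then obtain v c where "v \<noteq> 0" "c \<noteq> 0" "w = c *s v" by (auto simp: proj_space_def proj_pt_eq_iff)
  thus "w \<noteq> 0" by simp
qed (auto simp: proj_space_def)

section \<open>The surface\<close>

lemma vector_4 [simp]:
  fixes a b x y :: "'a::zero"
  shows "(vector [a, b, x, y] :: 'a ^ 4) $ 1 = a" "(vector [a, b, x, y] :: 'a ^ 4) $ 2 = b"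
    "(vector [a, b, x, y] :: 'a ^ 4) $ 3 = x" "(vector [a, b, x, y] :: 'a ^ 4) $ 4 = y"
  by (simp_all add: vector_def)

lemma vector_4_eta:
  fixes v :: "'a::zero ^ 4"
  shows "vector [v $ 1, v $ 2, v $ 3, v $ 4] = v"
  by (simp add: vec_eq_iff forall_4)

definition surface_form :: "'k::field ^ 4 \<Rightarrow> 'k" where
  "surface_form v = quintic (v $ 1) (v $ 2) (v $ 3) (v $ 4)"

definition base_norm :: "'k::field ^ 4 \<Rightarrow> 'k" where
  "base_norm v = (v $ 1)\<^sup>2 + (v $ 2)\<^sup>2"

text \<open>The pair to which \<open>(a, b)\<close> is proportional on the surface where \<open>(x + iy) / (a + ib)\<close> is \<open>(p + iq) / o\<close>,
  for the point \<open>(o, p, q)\<close> of the plane.\<close>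

definition par_a :: "'k::field ^ 3 \<Rightarrow> 'k" where
  "par_a w = (w $ 1 - 2 * w $ 2) * w $ 3 * (w $ 1)\<^sup>2"

definition par_b :: "'k::field ^ 3 \<Rightarrow> 'k" where
  "par_b w = (w $ 1 - 2 * w $ 2) * w $ 2 * (w $ 1)\<^sup>2
    - ((w $ 2)\<^sup>2 + (w $ 3)\<^sup>2) * ((w $ 2)\<^sup>2 + (w $ 3)\<^sup>2 - 2 * (w $ 2 * w $ 1))"

text \<open>Homogeneous coordinates of (x + iy) / (a + ib) = (x + iy)(a - ib) / (a^2 + b^2):
  denominator, real part, imaginary part of the numerator.\<close>

definition to_plane :: "'k::field ^ 4 \<Rightarrow> 'k ^ 3" where
  "to_plane v = vector [base_norm v, v $ 1 * v $ 3 + v $ 2 * v $ 4, v $ 1 * v $ 4 - v $ 2 * v $ 3]"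

text \<open>The last two entries are the real and imaginary parts of (a + ib)(p + iq), with
  \<open>par_a\<close> and \<open>par_b\<close> as a and b; the factor \<open>w $ 1\<close> in the
  first two is the denominator o.\<close>

definition from_plane :: "'k::field ^ 3 \<Rightarrow> 'k ^ 4" where
  "from_plane w = vector [w $ 1 * par_a w, w $ 1 * par_b w,
     par_a w * w $ 2 - par_b w * w $ 3, par_a w * w $ 3 + par_b w * w $ 2]"

lemma form_plus: "form A d F \<Longrightarrow> form A e G \<Longrightarrow> d = e \<Longrightarrow> form A d (\<lambda>v. F v + G v)"
  by (auto intro: form_add)

context
  fixes A :: "'k::field set"
  assumes A: "1 \<in> A" "-1 \<in> A" "2 \<in> A"
begin

lemma form_minus: "form A d F \<Longrightarrow> form A e G \<Longrightarrow> d = e \<Longrightarrow> form A d (\<lambda>v. F v - G v)"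
  using A by (auto intro: form_diff)

lemma form_double: "form A d F \<Longrightarrow> form A d (\<lambda>v. 2 * F v)"
  using A by (auto intro: form_scale)

lemma form_square: "form A d F \<Longrightarrow> form A (d + d) (\<lambda>v. (F v)\<^sup>2)"
  unfolding power2_eq_square by (rule form_mult)

lemmas fv = form_var[of A]

lemma form_base_norm: "form A 2 (base_norm :: 'k ^ 4 \<Rightarrow> 'k)"
  by (rule form_cast[OF form_plus[OF form_square[OF fv[of 1]] form_square[OF fv[of 2]]]]) (simp_all add: base_norm_def)

lemma form_surface_form: "form A 5 (surface_form :: 'k ^ 4 \<Rightarrow> 'k)"
proof -
  have r: "form A 2 (\<lambda>v :: 'k ^ 4. (v $ 3)\<^sup>2 + (v $ 4)\<^sup>2)"
    by (rule form_cast[OF form_plus[OF form_square[OF fv[of 3]] form_square[OF fv[of 4]]]]) simp_all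
  have l: "form A 2 (\<lambda>v :: 'k ^ 4. 2 * (v $ 1 * v $ 3) + 2 * (v $ 2 * v $ 4))"
    by (rule form_cast[OF form_plus[OF form_double[OF form_mult[OF fv[of 1] fv[of 3]]] form_double[OF form_mult[OF fv[of 2] fv[of 4]]]]]) simp_all
  show ?thesis
    by (rule form_cast[OF form_minus[OF
        form_mult[OF form_mult[OF fv[of 3] form_base_norm] form_minus[OF form_base_norm l]]
        form_mult[OF form_mult[OF fv[of 1] r] form_minus[OF r l]]]])
      (simp_all add: surface_form_def base_norm_def quintic_def algebra_simps)
qed

lemma form_par_a: "form A 4 (par_a :: 'k ^ 3 \<Rightarrow> 'k)"
  by (rule form_cast[OF form_mult[OF form_mult[OF form_minus[OF fv[of 1] form_double[OF fv[of 2]]] fv[of 3]] form_square[OF fv[of 1]]]])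
    (simp_all add: par_a_def)

lemma form_par_b: "form A 4 (par_b :: 'k ^ 3 \<Rightarrow> 'k)"
proof -
  have n: "form A 2 (\<lambda>v :: 'k ^ 3. (v $ 2)\<^sup>2 + (v $ 3)\<^sup>2)"
    by (rule form_cast[OF form_plus[OF form_square[OF fv[of 2]] form_square[OF fv[of 3]]]]) simp_all
  have l: "form A 2 (\<lambda>v :: 'k ^ 3. 2 * (v $ 2 * v $ 1))"
    by (rule form_cast[OF form_double[OF form_mult[OF fv[of 2] fv[of 1]]]]) simp_all
  show ?thesis
    by (rule form_cast[OF form_minus[OF form_mult[OF form_mult[OF form_minus[OF fv[of 1] form_double[OF fv[of 2]]] fv[of 2]] form_square[OF fv[of 1]]]
        form_mult[OF n form_minus[OF n l]]]])
      (simp_all add: par_b_def)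
qed

lemma form_to_plane: "form A 2 (\<lambda>v :: 'k ^ 4. to_plane v $ i)"
proof -
  have "form A 2 (\<lambda>v :: 'k ^ 4. v $ 1 * v $ 3 + v $ 2 * v $ 4)"
    by (rule form_cast[OF form_plus[OF form_mult[OF fv[of 1] fv[of 3]] form_mult[OF fv[of 2] fv[of 4]]]]) simp_all
  moreover have "form A 2 (\<lambda>v :: 'k ^ 4. v $ 1 * v $ 4 - v $ 2 * v $ 3)"
    by (rule form_cast[OF form_minus[OF form_mult[OF fv[of 1] fv[of 4]] form_mult[OF fv[of 2] fv[of 3]]]]) simp_all
  ultimately have "\<forall>i. form A 2 (\<lambda>v :: 'k ^ 4. to_plane v $ i)"
    unfolding forall_3 to_plane_def by (simp add: form_base_norm[unfolded base_norm_def] base_norm_def)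
  thus ?thesis ..
qed

lemma form_from_plane: "form A 5 (\<lambda>w :: 'k ^ 3. from_plane w $ i)"
proof -
  have 1: "form A 5 (\<lambda>w :: 'k ^ 3. w $ 1 * par_a w)"
    by (rule form_cast[OF form_mult[OF fv[of 1] form_par_a]]) simp_all
  have 2: "form A 5 (\<lambda>w :: 'k ^ 3. w $ 1 * par_b w)"
    by (rule form_cast[OF form_mult[OF fv[of 1] form_par_b]]) simp_all
  have 3: "form A 5 (\<lambda>w :: 'k ^ 3. par_a w * w $ 2 - par_b w * w $ 3)"
    by (rule form_cast[OF form_minus[OF form_mult[OF form_par_a fv[of 2]] form_mult[OF form_par_b fv[of 3]]]]) simp_all
  have 4: "form A 5 (\<lambda>w :: 'k ^ 3. par_a w * w $ 3 + par_b w * w $ 2)"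
    by (rule form_cast[OF form_plus[OF form_mult[OF form_par_a fv[of 3]] form_mult[OF form_par_b fv[of 2]]]]) simp_all
  have "\<forall>i. form A 5 (\<lambda>w :: 'k ^ 3. from_plane w $ i)"
    unfolding forall_4 from_plane_def using 1 2 3 4 by simp
  thus ?thesis ..
qed

end

lemmas forms_UNIV [simplified] = form_surface_form[of UNIV] form_base_norm[of UNIV] form_par_a[of UNIV] form_par_b[of UNIV]
  form_to_plane[of UNIV] form_from_plane[of UNIV]

lemma base_norm_from_plane: "base_norm (from_plane w) = (w $ 1)\<^sup>2 * ((par_a w)\<^sup>2 + (par_b w)\<^sup>2)"
  by (simp add: base_norm_def from_plane_def power_mult_distrib algebra_simps)

lemma to_plane_from_plane:
  "to_plane (from_plane w) = (w $ 1 * ((par_a w)\<^sup>2 + (par_b w)\<^sup>2)) *s w"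
  unfolding vec_eq_iff forall_3
  by (simp add: to_plane_def base_norm_from_plane) (simp add: from_plane_def power2_eq_square algebra_simps)

text \<open>With p = ax + by and q = ay - bx one has a p - b q = s x and p^2 + q^2 = s r. This makes
  the equation of X linear in (a, b), with coefficients that depend only on the point of the
  plane.\<close>

lemma par_relation:
  "v $ 1 * par_b (to_plane v) - v $ 2 * par_a (to_plane v) = (base_norm v)\<^sup>2 * surface_form v"
proof -
  obtain a b x y where v: "v = vector [a, b, x, y]"
    using vector_4_eta[of v] by metis
  define s where "s = a\<^sup>2 + b\<^sup>2"
  define p where "p = a * x + b * y"
  define q where "q = a * y - b * x"
  define r where "r = x\<^sup>2 + y\<^sup>2"
  have pq: "a * p - b * q = s * x" and n: "p\<^sup>2 + q\<^sup>2 = s * r"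
    by (simp_all add: s_def p_def q_def r_def power2_eq_square algebra_simps)
  have "v $ 1 * par_b (to_plane v) - v $ 2 * par_a (to_plane v) =
    (s - 2 * p) * s\<^sup>2 * (a * p - b * q) - a * (p\<^sup>2 + q\<^sup>2) * (p\<^sup>2 + q\<^sup>2 - 2 * (p * s))"
    by (simp add: v par_a_def par_b_def to_plane_def base_norm_def algebra_simps flip: s_def p_def q_def)
  also have "\<dots> = s\<^sup>2 * (x * s * (s - 2 * p) - a * r * (r - 2 * p))"
    unfolding pq n by (simp add: power2_eq_square algebra_simps)
  also have "\<dots> = s\<^sup>2 * quintic a b x y"
    by (simp add: quintic_def s_def r_def p_def algebra_simps)
  finally show ?thesis by (simp add: v surface_form_def base_norm_def s_def)
qed

definition par_factor :: "'k::field ^ 4 \<Rightarrow> 'k" where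
  "par_factor v = v $ 1 * par_a (to_plane v) + v $ 2 * par_b (to_plane v)"

lemma par_eq_factor:
  assumes "surface_form v = 0"
  shows "base_norm v * par_a (to_plane v) = par_factor v * v $ 1" "base_norm v * par_b (to_plane v) = par_factor v * v $ 2"
proof -
  have e: "v $ 1 * par_b (to_plane v) = v $ 2 * par_a (to_plane v)" using par_relation[of v] assms by simp
  have "base_norm v * par_a (to_plane v) = v $ 1 * (v $ 1 * par_a (to_plane v)) + v $ 2 * (v $ 2 * par_a (to_plane v))"
    by (simp add: base_norm_def power2_eq_square algebra_simps)
  also have "\<dots> = par_factor v * v $ 1" unfolding e[symmetric] by (simp add: par_factor_def algebra_simps)
  finally show "base_norm v * par_a (to_plane v) = par_factor v * v $ 1" .
  have "base_norm v * par_b (to_plane v) = v $ 1 * (v $ 1 * par_b (to_plane v)) + v $ 2 * (v $ 2 * par_b (to_plane v))"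
    by (simp add: base_norm_def power2_eq_square algebra_simps)
  also have "\<dots> = par_factor v * v $ 2" unfolding e by (simp add: par_factor_def algebra_simps)
  finally show "base_norm v * par_b (to_plane v) = par_factor v * v $ 2" .
qed

lemma from_plane_to_plane:
  assumes "surface_form v = 0" "base_norm v \<noteq> 0"
  shows "from_plane (to_plane v) = par_factor v *s v"
proof -
  note e = par_eq_factor[OF assms(1)]
  have "base_norm v * from_plane (to_plane v) $ i = base_norm v * (par_factor v *s v) $ i" for i
  proof -
    have 3: "v $ 1 * to_plane v $ 2 - v $ 2 * to_plane v $ 3 = base_norm v * v $ 3"
      and 4: "v $ 1 * to_plane v $ 3 + v $ 2 * to_plane v $ 2 = base_norm v * v $ 4" and 1: "to_plane v $ 1 = base_norm v"
      by (simp_all add: to_plane_def base_norm_def power2_eq_square algebra_simps)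
    have "base_norm v * from_plane (to_plane v) $ 3 = (base_norm v * par_a (to_plane v)) * to_plane v $ 2 - (base_norm v * par_b (to_plane v)) * to_plane v $ 3"
      by (simp add: from_plane_def algebra_simps)
    also have "\<dots> = par_factor v * (v $ 1 * to_plane v $ 2 - v $ 2 * to_plane v $ 3)" unfolding e by (simp add: algebra_simps)
    finally have c3: "base_norm v * from_plane (to_plane v) $ 3 = base_norm v * (par_factor v * v $ 3)" unfolding 3 by (simp add: algebra_simps)
    have "base_norm v * from_plane (to_plane v) $ 4 = (base_norm v * par_a (to_plane v)) * to_plane v $ 3 + (base_norm v * par_b (to_plane v)) * to_plane v $ 2"
      by (simp add: from_plane_def algebra_simps)
    also have "\<dots> = par_factor v * (v $ 1 * to_plane v $ 3 + v $ 2 * to_plane v $ 2)" unfolding e by (simp add: algebra_simps)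
    finally have c4: "base_norm v * from_plane (to_plane v) $ 4 = base_norm v * (par_factor v * v $ 4)" unfolding 4 by (simp add: algebra_simps)
    have c1: "base_norm v * from_plane (to_plane v) $ 1 = base_norm v * (par_factor v * v $ 1)"
      and c2: "base_norm v * from_plane (to_plane v) $ 2 = base_norm v * (par_factor v * v $ 2)"
      using e by (simp_all add: from_plane_def 1)
    have "\<forall>i. base_norm v * from_plane (to_plane v) $ i = base_norm v * (par_factor v *s v) $ i"
      unfolding forall_4 using c1 c2 c3 c4 by simp
    thus ?thesis ..
  qed
  thus ?thesis using assms(2) by (simp add: vec_eq_iff)
qed

text \<open>\<open>to_plane\<close> returns a multiple of w, and \<open>par_a\<close> and
  \<open>par_b\<close> are homogeneous of the same degree, so the two terms of
  \<open>par_relation\<close> cancel.\<close>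

lemma surface_form_from_plane:
  assumes "base_norm (from_plane w) \<noteq> 0"
  shows "surface_form (from_plane w) = 0"
proof -
  define c where "c = w $ 1 * ((par_a w)\<^sup>2 + (par_b w)\<^sup>2)"
  have "(base_norm (from_plane w))\<^sup>2 * surface_form (from_plane w) = w $ 1 * par_a w * par_b (c *s w) - w $ 1 * par_b w * par_a (c *s w)"
    unfolding par_relation[symmetric] to_plane_from_plane c_def[symmetric] by (simp add: from_plane_def)
  also have "\<dots> = 0"
    using form_homogeneous[OF forms_UNIV(3), of c w] form_homogeneous[OF forms_UNIV(4), of c w] by simp
  finally show ?thesis using assms by simp
qed

section \<open>Density of the chart in the surface\<close>

definition chart_form :: "'k::field ^ 4 \<Rightarrow> 'k" where
  "chart_form v = base_norm v * base_norm (from_plane (to_plane v))"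

lemma form_chart_form: "form UNIV 22 chart_form"
  unfolding chart_form_def
  by (rule form_cast[OF form_mult[OF forms_UNIV(2) form_compose[OF form_compose[OF forms_UNIV(2) forms_UNIV(6)] forms_UNIV(5)]]])
    simp_all

lemma form_plane_denominator: "form UNIV 11 (\<lambda>w. w $ 1 * base_norm (from_plane w))"
  by (rule form_cast[OF form_mult[OF form_var[of _ 1] form_compose[OF forms_UNIV(2) forms_UNIV(6)]]]) simp_all

lemma chart_form_nz:
  assumes "surface_form v = 0" "base_norm v \<noteq> 0" "par_a (to_plane v) \<noteq> 0 \<or> par_b (to_plane v) \<noteq> 0"
  shows "chart_form v \<noteq> 0"
proof -
  have "par_factor v \<noteq> 0"
  proof
    assume "par_factor v = 0"
    hence "base_norm v * par_a (to_plane v) = 0" "base_norm v * par_b (to_plane v) = 0" using par_eq_factor[OF assms(1)] by simp_all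
    thus False using assms by simp
  qed
  moreover have "base_norm (par_factor v *s v) = (par_factor v)\<^sup>2 * base_norm v" by (simp add: base_norm_def power_mult_distrib algebra_simps)
  ultimately show ?thesis using assms by (simp add: chart_form_def from_plane_to_plane)
qed

lemma surface_X_eq: "surface_X = {proj_pt v | v. v \<noteq> 0 \<and> surface_form v = 0}"
proof -
  have "\<exists>a b x y. v = vector [a, b, x, y]" for v :: "'a ^ 4"
    using vector_4_eta[of v] by metis
  thus ?thesis unfolding surface_X_def surface_form_def by (metis (mono_tags, opaque_lifting) vector_4)
qed

text \<open>What elimination of y yields for points of X with a nonzero outside the chart. The
  factor x and the cubic come from ay = bx, the last two factors from a^2 + b^2 = 2 (ax + by) with
  x^2 + y^2 equal to 0 or to a^2 + b^2.\<close>

definition base_locus_poly :: "'r::comm_ring_1 \<Rightarrow> 'r \<Rightarrow> 'r \<Rightarrow> 'r" where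
  "base_locus_poly a b x = (a\<^sup>2 + b\<^sup>2) * x * (x ^ 3 - 2 * x\<^sup>2 * a + 2 * x * a\<^sup>2 - a ^ 3)
    * ((2 * x - a)\<^sup>2 + b\<^sup>2) * ((2 * x - a)\<^sup>2 - 3 * b\<^sup>2)"

lemma chart_form_nz_generic:
  fixes a b x y :: "'k::field_char_0"
  assumes q: "quintic a b x y = 0" and a: "a \<noteq> 0" and H: "base_locus_poly a b x \<noteq> 0"
  shows "chart_form (vector [a, b, x, y]) \<noteq> 0"
proof (rule chart_form_nz)
  define s where "s = a\<^sup>2 + b\<^sup>2"
  define p where "p = a * x + b * y"
  define q where "q = a * y - b * x"
  define r where "r = x\<^sup>2 + y\<^sup>2"
  have s: "s \<noteq> 0" using H by (auto simp: base_locus_poly_def s_def)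
  thus "base_norm (vector [a, b, x, y]) \<noteq> 0" by (simp add: base_norm_def s_def)
  show "surface_form (vector [a, b, x, y]) = 0" using assms(1) by (simp add: surface_form_def)
  have pa: "par_a (to_plane (vector [a, b, x, y])) = (s - 2 * p) * q * s\<^sup>2"
    and pb: "par_b (to_plane (vector [a, b, x, y])) = (s - 2 * p) * p * s\<^sup>2 - (p\<^sup>2 + q\<^sup>2) * (p\<^sup>2 + q\<^sup>2 - 2 * (p * s))"
    by (simp_all add: par_a_def par_b_def to_plane_def base_norm_def flip: s_def p_def q_def)
  show "par_a (to_plane (vector [a, b, x, y])) \<noteq> 0 \<or> par_b (to_plane (vector [a, b, x, y])) \<noteq> 0"
  proof (rule ccontr)
    assume "\<not> ?thesis"
    hence A: "(s - 2 * p) * q * s\<^sup>2 = 0"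
      and B: "(s - 2 * p) * p * s\<^sup>2 - (p\<^sup>2 + q\<^sup>2) * (p\<^sup>2 + q\<^sup>2 - 2 * (p * s)) = 0"
      unfolding pa pb by simp_all
    from A s consider "q = 0" | "s = 2 * p" by auto
    thus False
    proof cases
      case 1
      have ap: "a * p = s * x"
        using 1 unfolding s_def p_def q_def by (simp add: power2_eq_square algebra_simps)
      have "a ^ 4 * ((s - 2 * p) * p * s\<^sup>2 - p\<^sup>2 * (p\<^sup>2 - 2 * (p * s))) =
        (a * s - 2 * (a * p)) * (a * p) * a\<^sup>2 * s\<^sup>2 - (a * p)\<^sup>2 * ((a * p)\<^sup>2 - 2 * ((a * p) * (a * s)))"
        by (simp add: algebra_simps power_numeral_reduce)
      also have "\<dots> = - (s ^ 4 * x * (x ^ 3 - 2 * x\<^sup>2 * a + 2 * x * a\<^sup>2 - a ^ 3))"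
        unfolding ap by (simp add: algebra_simps power_numeral_reduce)
      finally have "s ^ 4 * x * (x ^ 3 - 2 * x\<^sup>2 * a + 2 * x * a\<^sup>2 - a ^ 3) = 0"
        using B 1 by simp
      thus False using H s by (simp add: base_locus_poly_def)
    next
      case 2
      have n: "p\<^sup>2 + q\<^sup>2 = s * r"
        by (simp add: s_def p_def q_def r_def power2_eq_square algebra_simps)
      have ps: "2 * (p * s) = s * s" "s - 2 * p = 0" using 2 by simp_all
      have "(s * r) * (s * r - s * s) = 0" using B unfolding n ps by simp
      hence r: "r = 0 \<or> r = s" using s by auto
      have by2: "2 * (b * y) = s - 2 * a * x" using 2 by (simp add: p_def algebra_simps)
      have "4 * b\<^sup>2 * r = 4 * b\<^sup>2 * x\<^sup>2 + (2 * (b * y))\<^sup>2"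
        by (simp add: r_def power_mult_distrib algebra_simps)
      also have "\<dots> = s * ((2 * x - a)\<^sup>2 + b\<^sup>2)"
        unfolding by2 by (simp add: s_def power2_eq_square algebra_simps)
      finally have e: "4 * b\<^sup>2 * r = s * ((2 * x - a)\<^sup>2 + b\<^sup>2)" .
      from r show False
      proof
        assume "r = 0"
        thus False using e s H by (simp add: base_locus_poly_def)
      next
        assume "r = s"
        hence "s * (4 * b\<^sup>2) = s * ((2 * x - a)\<^sup>2 + b\<^sup>2)" using e by (simp add: mult.commute)
        hence "4 * b\<^sup>2 = (2 * x - a)\<^sup>2 + b\<^sup>2" using s by (simp only: mult_cancel_left) simp
        hence "(2 * x - a)\<^sup>2 - 3 * b\<^sup>2 = 0" by (simp add: algebra_simps)
        thus False using H unfolding base_locus_poly_def by simp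
      qed
    qed
  qed
qed

lemma quintic_pCons_y:
  "quintic [:a:] [:b:] [:x:] [:0, 1:] = [: x * (a\<^sup>2 + b\<^sup>2) * (a\<^sup>2 + b\<^sup>2 - 2 * a * x) - a * x\<^sup>2 * (x\<^sup>2 - 2 * a * x),
     - (2 * b * x * (a\<^sup>2 + b\<^sup>2)) + 2 * a * b * x\<^sup>2, 2 * a\<^sup>2 * x - 2 * a * x\<^sup>2, 2 * a * b, - a:]"
  by (simp add: quintic_def power2_eq_square numeral_poly algebra_simps)

lemma quintic_pCons_b:
  "quintic [:a:] [:0, 1:] [:x:] [:y:] = [: x * a\<^sup>2 * (a\<^sup>2 - 2 * a * x) - a * (x\<^sup>2 + y\<^sup>2) * (x\<^sup>2 + y\<^sup>2 - 2 * a * x),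
     2 * a * y * (x\<^sup>2 + y\<^sup>2) - 2 * x * y * a\<^sup>2, 2 * a\<^sup>2 * x - 2 * a * x\<^sup>2, - (2 * x * y), x:]"
  by (simp add: quintic_def power2_eq_square numeral_poly algebra_simps)

lemma poly_base_locus_poly:
  "poly (base_locus_poly a b x) t = base_locus_poly (poly a t) (poly b t) (poly x t)"
  by (simp add: base_locus_poly_def)

lemma poly2_quintic: "poly2 (quintic a b x y) t z = quintic (poly2 a t z) (poly2 b t z) (poly2 x t z) (poly2 y t z)"
  by (simp add: quintic_def)

context
  fixes F :: "'k::{alg_closed_field,field_char_0} ^ 4 \<Rightarrow> 'k" and d
  assumes F: "form UNIV d F" and van: "\<And>v. surface_form v = 0 \<Longrightarrow> chart_form v \<noteq> 0 \<Longrightarrow> F v = 0"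
begin

lemma family: "\<exists>P. \<forall>t z. F (vector [poly2 a t z, poly2 b t z, poly2 x t z, poly2 y t z]) = poly2 P t z"
proof -
  define g where "g = (\<lambda>i. (vector [a, b, x, y] :: 'k poly poly ^ 4) $ i)"
  have "(\<chi> i. poly2 (g i) t z) = vector [poly2 a t z, poly2 b t z, poly2 x t z, poly2 y t z]" for t z
    by (simp add: vec_eq_iff forall_4 g_def)
  thus ?thesis using form_polynomial_family[OF F, of g] by simp
qed

lemma vanishes_on_arc:
  assumes "finite B" and "\<And>t. t \<notin> B \<Longrightarrow> F (vector [poly a t, poly b t, poly x t, poly y t]) = 0"
  shows "F (vector [poly a t, poly b t, poly x t, poly y t]) = 0"
proof -
  define g where "g = (\<lambda>i. (vector [a, b, x, y] :: 'k poly ^ 4) $ i)"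
  have g: "(\<chi> i. poly (g i) t) = vector [poly a t, poly b t, poly x t, poly y t]" for t
    by (simp add: vec_eq_iff forall_4 g_def)
  obtain P where P: "\<forall>t. F (vector [poly a t, poly b t, poly x t, poly y t]) = poly P t"
    using form_polynomial_arc[OF F, of g] unfolding g by blast
  have "P = 0" by (rule poly_eq_0_if_cofinite[OF assms(1)]) (use P assms(2) in simp)
  thus ?thesis using P by simp
qed

lemma vanishes_a:
  assumes q: "quintic a b x y = 0" and a: "a \<noteq> 0"
  shows "F (vector [a, b, x, y]) = 0"
proof -
  \<comment> \<open>The leading coefficient -(a + t) in y is nonzero at t = 0. The direction (1, 0,
    2) for (a, b, x) is chosen because \<open>base_locus_poly\<close> is nonzero at it, hence not
    identically zero along the line; (1, 0, 1) would be a zero of the cubic factor.\<close>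
  define f where "f = quintic [:[:a, 1:]:] [:[:b:]:] [:[:x, 2:]:] [:0, 1:]"
  obtain P where P: "\<forall>t z. F (vector [a + t, b, x + 2 * t, z]) = poly2 P t z"
    using family[of "[:[:a, 1:]:]" "[:[:b:]:]" "[:[:x, 2:]:]" "[:0, 1:]"] by (auto simp: mult.commute)
  have f: "poly2 f t z = quintic (a + t) b (x + 2 * t) z" for t z
    unfolding f_def poly2_quintic by (simp add: mult.commute)
  define H where "H = base_locus_poly [:a, 1:] [:b:] [:x, 2:]"
  have H: "poly H t = base_locus_poly (a + t) b (x + 2 * t)" for t
    by (simp add: H_def poly_base_locus_poly mult.commute)
  have "H \<noteq> 0"
  proof -
    have "[:a, 1:]\<^sup>2 + [:b:]\<^sup>2 \<noteq> 0" by (simp add: power2_eq_square)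
    moreover have "[:x, 2:] ^ 3 - 2 * [:x, 2:]\<^sup>2 * [:a, 1:] + 2 * [:x, 2:] * [:a, 1:]\<^sup>2 - [:a, 1:] ^ 3 \<noteq> 0"
      by (simp add: power2_eq_square power3_eq_cube numeral_poly)
    moreover have "(2 * [:x, 2:] - [:a, 1:])\<^sup>2 + [:b:]\<^sup>2 \<noteq> 0"
      by (simp add: power2_eq_square numeral_poly)
    moreover have "(2 * [:x, 2:] - [:a, 1:])\<^sup>2 - 3 * [:b:]\<^sup>2 \<noteq> 0"
      by (simp add: power2_eq_square numeral_poly)
    ultimately show ?thesis unfolding H_def base_locus_poly_def by (simp only: mult_eq_0_iff) simp
  qed
  have "poly2 P 0 y = 0"
  proof (rule vanishing_specializes)
    show "finite ({t. poly H t = 0} \<union> {- a})" using \<open>H \<noteq> 0\<close> poly_roots_finite by blast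
    fix t z assume t: "t \<notin> {t. poly H t = 0} \<union> {- a}" and "poly2 f t z = 0"
    hence q': "quintic (a + t) b (x + 2 * t) z = 0" by (simp add: f)
    have "a + t \<noteq> 0" using t by (auto simp: add_eq_0_iff)
    hence "chart_form (vector [a + t, b, x + 2 * t, z]) \<noteq> 0" using t q' by (intro chart_form_nz_generic) (simp_all add: H)
    thus "poly2 P t z = 0" unfolding P[rule_format, symmetric] using q' by (intro van) (simp_all add: surface_form_def)
  next
    have "lead_coeff f = - [:a, 1:]" unfolding f_def quintic_pCons_y by simp
    thus "poly (lead_coeff f) 0 \<noteq> 0" using a by simp
    show "poly2 f 0 y = 0" using q by (simp add: f)
  qed
  thus ?thesis using P[rule_format, of 0 y] by simp
qed

lemma par_0:
  "par_a (to_plane (vector [0, b, x, y])) = - (b\<^sup>2 - 2 * (b * y)) * (b * x) * b ^ 4"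
  "par_b (to_plane (vector [0, b, x, y])) = b ^ 4 * ((b - 2 * y) * y * b\<^sup>2 - (x\<^sup>2 + y\<^sup>2) * (x\<^sup>2 + y\<^sup>2 - 2 * b * y))" for b x y :: 'k
  by (simp_all add: par_a_def par_b_def to_plane_def base_norm_def power2_eq_square power4_eq_xxxx algebra_simps)

text \<open>For a = 0 the equation is x b^3 (b - 2y) = 0. On each of the two lines, points where the
  polynomial B in the parameter is nonzero belong to the chart.\<close>

lemma vanishes_b:
  assumes q: "quintic 0 b x y = 0" and b: "b \<noteq> 0"
  shows "F (vector [0, b, x, y]) = 0"
proof -
  have arc: "F (vector [0, b, x', y']) = 0"
    if "quintic 0 b x' y' = 0" "(b - 2 * y') * y' * b\<^sup>2 - (x'\<^sup>2 + y'\<^sup>2) * (x'\<^sup>2 + y'\<^sup>2 - 2 * b * y') \<noteq> 0" for x' y'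
    by (rule van, use that(1) in \<open>simp add: surface_form_def\<close>, rule chart_form_nz)
      (use that b in \<open>simp_all add: surface_form_def base_norm_def par_0\<close>)
  have "x = 0 \<or> b = 2 * y" using q b by (simp add: quintic_def power2_eq_square)
  thus ?thesis
  proof
    assume x: "x = 0"
    define B where "B = ([:b:] - 2 * [:y, 1:]) * [:y, 1:] * [:b:]\<^sup>2 - [:y, 1:]\<^sup>2 * ([:y, 1:]\<^sup>2 - 2 * [:b:] * [:y, 1:])"
    have Bt: "poly B t = (b - 2 * (y + t)) * (y + t) * b\<^sup>2 - (y + t)\<^sup>2 * ((y + t)\<^sup>2 - 2 * b * (y + t))" for t
      unfolding B_def by (simp only: poly_diff poly_mult poly_power poly_pCons poly_0 poly_numeral) (simp add: algebra_simps)
    have "B \<noteq> 0" by (simp add: B_def power2_eq_square numeral_poly)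
    have "F (vector [poly [:0:] t, poly [:b:] t, poly [:0:] t, poly [:y, 1:] t]) = 0" for t
    proof (rule vanishes_on_arc)
      show "finite {t. poly B t = 0}" using \<open>B \<noteq> 0\<close> by (rule poly_roots_finite)
      fix t assume "t \<notin> {t. poly B t = 0}"
      thus "F (vector [poly [:0:] t, poly [:b:] t, poly [:0:] t, poly [:y, 1:] t]) = 0"
        using arc[of 0 "y + t"] by (simp add: Bt quintic_def)
    qed
    from this[of 0] show ?thesis by (simp add: x)
  next
    assume y: "b = 2 * y"
    define B where "B = - (([:x, 1:]\<^sup>2 + [:y:]\<^sup>2) * ([:x, 1:]\<^sup>2 + [:y:]\<^sup>2 - 2 * [:b:] * [:y:]))"
    have Bt: "poly B t = (b - 2 * y) * y * b\<^sup>2 - ((x + t)\<^sup>2 + y\<^sup>2) * ((x + t)\<^sup>2 + y\<^sup>2 - 2 * b * y)" for t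
      by (simp add: B_def y)
    have "[:x, 1:]\<^sup>2 + [:y:]\<^sup>2 \<noteq> 0" "[:x, 1:]\<^sup>2 + [:y:]\<^sup>2 - 2 * [:b:] * [:y:] \<noteq> 0"
      by (simp_all add: power2_eq_square numeral_poly)
    hence "B \<noteq> 0" unfolding B_def by (simp only: neg_equal_0_iff_equal mult_eq_0_iff) simp
    have "F (vector [poly [:0:] t, poly [:b:] t, poly [:x, 1:] t, poly [:y:] t]) = 0" for t
    proof (rule vanishes_on_arc)
      show "finite {t. poly B t = 0}" using \<open>B \<noteq> 0\<close> by (rule poly_roots_finite)
      fix t assume "t \<notin> {t. poly B t = 0}"
      thus "F (vector [poly [:0:] t, poly [:b:] t, poly [:x, 1:] t, poly [:y:] t]) = 0"
        using arc[of "x + t" y] by (simp add: Bt) (simp add: quintic_def y power2_eq_square)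
    qed
    from this[of 0] show ?thesis by simp
  qed
qed

text \<open>For fixed x and y the equation is quartic in b with leading coefficient x, so [0:0:x:y]
  is a specialization of points with a = t nonzero, where \<open>vanishes_a\<close> applies.\<close>

lemma vanishes_x:
  assumes x: "x \<noteq> 0"
  shows "F (vector [0, 0, x, y]) = 0"
proof -
  define f where "f = quintic [:[:0, 1:]:] [:0, 1:] [:[:x:]:] [:[:y:]:]"
  obtain P where P: "\<forall>t z. F (vector [t, z, x, y]) = poly2 P t z"
    using family[of "[:[:0, 1:]:]" "[:0, 1:]" "[:[:x:]:]" "[:[:y:]:]"] by auto
  have f: "poly2 f t z = quintic t z x y" for t z
    unfolding f_def poly2_quintic by simp
  have "poly2 P 0 0 = 0"
  proof (rule vanishing_specializes)
    show "finite {0 :: 'k}" by simp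
    show "poly2 P t z = 0" if "t \<notin> {0}" "poly2 f t z = 0" for t z
      unfolding P[rule_format, symmetric] using vanishes_a[of t z x y] that by (simp add: f)
    show "poly (lead_coeff f) 0 \<noteq> 0" unfolding f_def quintic_pCons_b using x by simp
    show "poly2 f 0 0 = 0" unfolding f by (simp add: quintic_def)
  qed
  thus ?thesis using P[rule_format, of 0 0] by simp
qed

lemma vanishes_on_X: "surface_form v = 0 \<Longrightarrow> F v = 0"
proof -
  assume "surface_form v = 0"
  obtain a b x y where v: "v = vector [a, b, x, y]" using vector_4_eta[of v] by metis
  have q: "quintic a b x y = 0" using \<open>surface_form v = 0\<close> by (simp add: v surface_form_def)
  consider "a \<noteq> 0" | "a = 0" "b \<noteq> 0" | "a = 0" "b = 0" "x \<noteq> 0" | "a = 0" "b = 0" "x = 0" by blast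
  thus ?thesis
  proof cases
    case 1
    thus ?thesis unfolding v using q by (rule vanishes_a[rotated])
  next
    case 2
    thus ?thesis unfolding v using q vanishes_b by simp
  next
    case 3
    thus ?thesis unfolding v using vanishes_x by simp
  next
    case 4
    \<comment> \<open>The point [0:0:0:y] is approached along [0:0:t:y].\<close>
    have "F (vector [poly [:0:] 0, poly [:0:] 0, poly [:0, 1:] 0, poly [:y:] 0]) = 0"
      by (rule vanishes_on_arc[of "{0}"]) (simp_all add: vanishes_x)
    thus ?thesis by (simp add: v 4)
  qed
qed

end

section \<open>Irreducibility and rationality of the surface\<close>

lemma from_plane_nz: "\<exists>w :: 'k::field_char_0 ^ 3. w $ 1 * base_norm (from_plane w) \<noteq> 0"
  by (rule exI[of _ "vector [1, 0, 1]"]) (simp add: base_norm_from_plane par_a_def par_b_def)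

text \<open>If neither closed set contains X, each has a form that vanishes on it but not on X. The
  product of the pullbacks to the plane vanishes, so one pullback is zero; then that form vanishes
  on the chart and, by \<open>vanishes_on_X\<close>, on X.\<close>

lemma irreducible_surface_X:
  "irreducible_closed (surface_X :: ('k::{alg_closed_field,field_char_0} ^ 4) set set)"
  unfolding irreducible_closed_def
proof (intro conjI allI impI)
  show "zariski_closed (surface_X :: ('k ^ 4) set set)"
    unfolding surface_X_eq by (rule zariski_closed_form[OF forms_UNIV(1)])
  have "(vector [1, 0, 0, 0] :: 'k ^ 4) \<noteq> 0" by (simp add: vec_eq_iff forall_4)
  moreover have "surface_form (vector [1, 0, 0, 0] :: 'k ^ 4) = 0" by (simp add: surface_form_def quintic_def)
  ultimately show "surface_X \<noteq> ({} :: ('k ^ 4) set set)" unfolding surface_X_eq by blast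
next
  fix Y' Z' :: "('k ^ 4) set set"
  assume Y: "zariski_closed Y'" and Z: "zariski_closed Z'" and YZ: "surface_X = Y' \<union> Z'"
  show "surface_X = Y' \<or> surface_X = Z'"
  proof (rule ccontr)
    assume "\<not> ?thesis"
    hence "\<not> surface_X \<subseteq> Y'" "\<not> surface_X \<subseteq> Z'" using YZ by auto
    have sep: "\<exists>F d v. form UNIV d F \<and> surface_form v = 0 \<and> F v \<noteq> 0 \<and> (\<forall>w. w \<noteq> 0 \<longrightarrow> proj_pt w \<in> C \<longrightarrow> F w = 0)"
      if C: "zariski_closed C" "\<not> surface_X \<subseteq> C" for C :: "('k ^ 4) set set"
    proof -
      obtain Fs where Fs: "\<forall>F\<in>Fs. \<exists>d. form UNIV d F" "C = {proj_pt v | v. v \<noteq> 0 \<and> (\<forall>F\<in>Fs. F v = 0)}"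
        using C(1) by (auto simp: zariski_closed_def)
      obtain v where v: "v \<noteq> 0" "surface_form v = 0" "proj_pt v \<notin> C" using C(2) unfolding surface_X_eq by blast
      then obtain F where F: "F \<in> Fs" "F v \<noteq> 0" unfolding Fs(2) by blast
      obtain d where d: "form UNIV d F" using Fs(1) F(1) by blast
      have "F w = 0" if w: "w \<noteq> 0" "proj_pt w \<in> C" for w
      proof -
        have "proj_pt w \<in> {proj_pt v | v. v \<noteq> 0 \<and> F v = 0}" using w(2) F(1) unfolding Fs(2) by blast
        thus ?thesis by (simp only: proj_pt_in_iff[OF d])
      qed
      thus ?thesis using d v F by blast
    qed
    obtain F d v where F: "form UNIV d F" "surface_form v = 0" "F v \<noteq> 0" "\<forall>w. w \<noteq> 0 \<longrightarrow> proj_pt w \<in> Y' \<longrightarrow> F w = 0"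
      using sep[OF Y \<open>\<not> surface_X \<subseteq> Y'\<close>] by blast
    obtain E e u where E: "form UNIV e E" "surface_form u = 0" "E u \<noteq> 0" "\<forall>w. w \<noteq> 0 \<longrightarrow> proj_pt w \<in> Z' \<longrightarrow> E w = 0"
      using sep[OF Z \<open>\<not> surface_X \<subseteq> Z'\<close>] by blast
    have FE: "F w * E w = 0" if w: "w \<noteq> 0" "surface_form w = 0" for w
    proof -
      have "proj_pt w \<in> surface_X" using w unfolding surface_X_eq by blast
      thus ?thesis using F(4) E(4) w(1) unfolding YZ by auto
    qed
    have pull: "\<not> (\<forall>w. H (from_plane w) = 0)" if H: "form UNIV n H" "surface_form z = 0" "H z \<noteq> 0" for H n and z :: "'k ^ 4"
    proof
      assume all: "\<forall>w. H (from_plane w) = 0"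
      have "H v = 0" if v: "surface_form v = 0" "chart_form v \<noteq> 0" for v
      proof -
        have base_norm: "base_norm v \<noteq> 0" using v(2) by (auto simp: chart_form_def)
        have "H (par_factor v *s v) = 0" using all from_plane_to_plane[OF v(1) base_norm] by metis
        hence "par_factor v ^ n * H v = 0" by (simp add: form_homogeneous[OF H(1)])
        moreover have "par_factor v \<noteq> 0"
        proof
          assume "par_factor v = 0"
          hence "from_plane (to_plane v) = 0" using from_plane_to_plane[OF v(1) base_norm] by simp
          thus False using v(2) by (simp add: chart_form_def base_norm_def)
        qed
        ultimately show ?thesis by simp
      qed
      thus False using vanishes_on_X[OF H(1)] H by blast
    qed
    \<comment> \<open>The extra factor covers those w for which \<open>from_plane w\<close> is not
      known to lie on X.\<close>
    define f3 where "f3 = (\<lambda>w :: 'k ^ 3. w $ 1 * base_norm (from_plane w))"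
    have f3: "form UNIV 11 f3" unfolding f3_def by (rule form_plane_denominator)
    have f1: "form UNIV (d * 5) (\<lambda>w. F (from_plane w))" and f2: "form UNIV (e * 5) (\<lambda>w. E (from_plane w))"
      by (rule form_compose[OF F(1) forms_UNIV(6)], rule form_compose[OF E(1) forms_UNIV(6)])
    have "F (from_plane w) * E (from_plane w) * f3 w = 0" for w
    proof (cases "base_norm (from_plane w) = 0")
      case False
      hence "from_plane w \<noteq> 0" by (auto simp: base_norm_def)
      thus ?thesis using FE[of "from_plane w"] surface_form_from_plane[OF False] by simp
    qed (simp add: f3_def)
    from form_mult_eq_0[OF form_mult[OF f1 f2] f3 this]
    have "\<forall>w. F (from_plane w) * E (from_plane w) = 0"
      using from_plane_nz unfolding f3_def by blast
    hence "(\<forall>w. F (from_plane w) = 0) \<or> (\<forall>w. E (from_plane w) = 0)"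
      by (intro form_mult_eq_0[OF f1 f2]) blast
    thus False using pull[OF F(1-3)] pull[OF E(1-3)] by blast
  qed
qed

text \<open>Each map undoes the other up to a scalar, and U and V are cut out so that these scalars
  are nonzero. The coefficients 1, -1, 2 from which both maps are built lie in the base
  field.\<close>

lemma rational_surface_X:
  "rational_surface_over (range to_ac) (surface_X :: ('k::field_char_0 alg_closure ^ 4) set set)"
  unfolding rational_surface_over_def
proof (rule conjI[OF irreducible_surface_X])
  let ?A = "range to_ac :: 'k alg_closure set"
  have A: "1 \<in> ?A" "-1 \<in> ?A" "2 \<in> ?A"
    using rangeI[of to_ac 1] rangeI[of to_ac "-1"] rangeI[of to_ac 2] by simp_all
  let ?X = "surface_X :: ('k alg_closure ^ 4) set set" and ?P = "proj_space :: ('k alg_closure ^ 3) set set"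
  define U where "U = ?X - {proj_pt v | v. v \<noteq> 0 \<and> chart_form v = 0}"
  define V where "V = ?P - {proj_pt w | w. w \<noteq> 0 \<and> w $ 1 * base_norm (from_plane w) = 0}"
  have U: "proj_pt v \<in> U \<longleftrightarrow> v \<noteq> 0 \<and> surface_form v = 0 \<and> chart_form v \<noteq> 0" for v
    unfolding U_def surface_X_eq Diff_iff proj_pt_in_iff[OF forms_UNIV(1)] proj_pt_in_iff[OF form_chart_form] by blast
  have V: "proj_pt w \<in> V \<longleftrightarrow> w \<noteq> 0 \<and> w $ 1 * base_norm (from_plane w) \<noteq> 0" for w
    unfolding V_def Diff_iff proj_pt_in_iff[OF form_plane_denominator] proj_space_eq by blast
  have there: "proj_pt (to_plane v) \<in> V \<and> proj_pt (from_plane (to_plane v)) = proj_pt v" if "proj_pt v \<in> U" for v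
  proof -
    have v: "surface_form v = 0" "base_norm v \<noteq> 0" "base_norm (from_plane (to_plane v)) \<noteq> 0" using that unfolding U by (auto simp: chart_form_def)
    have "to_plane v $ 1 = base_norm v" by (simp add: to_plane_def)
    moreover from this have "to_plane v \<noteq> 0" using v by auto
    moreover have "par_factor v \<noteq> 0"
    proof
      assume "par_factor v = 0"
      hence "from_plane (to_plane v) = 0" using from_plane_to_plane[OF v(1,2)] by simp
      thus False using v(3) by (simp add: base_norm_def)
    qed
    ultimately show ?thesis using v unfolding V by (simp add: from_plane_to_plane proj_pt_scale)
  qed
  have returning: "proj_pt (from_plane w) \<in> U \<and> proj_pt (to_plane (from_plane w)) = proj_pt w" if "proj_pt w \<in> V" for w
  proof -
    have w: "w $ 1 \<noteq> 0" "base_norm (from_plane w) \<noteq> 0" using that unfolding V by auto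
    define c where "c = w $ 1 * ((par_a w)\<^sup>2 + (par_b w)\<^sup>2)"
    have c: "c \<noteq> 0" using w by (auto simp: c_def base_norm_from_plane)
    have tf: "to_plane (from_plane w) = c *s w" unfolding c_def by (rule to_plane_from_plane)
    have "base_norm (from_plane (c *s w)) = c ^ (2 * 5) * base_norm (from_plane w)"
      using form_homogeneous[OF form_compose[OF forms_UNIV(2) forms_UNIV(6)]] .
    hence "chart_form (from_plane w) \<noteq> 0" unfolding chart_form_def tf using w c by simp
    moreover have "from_plane w \<noteq> 0" using w by (auto simp: base_norm_def)
    ultimately show ?thesis using surface_form_from_plane[OF w(2)] c unfolding U tf by (simp add: proj_pt_scale)
  qed
  obtain w0 :: "'k alg_closure ^ 3" where w0: "w0 $ 1 * base_norm (from_plane w0) \<noteq> 0" using from_plane_nz by blast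
  hence w0V: "proj_pt w0 \<in> V" unfolding V by auto
  show "birational_over ?A ?X ?P"
    unfolding birational_over_def
  proof (intro exI conjI allI)
    show "form ?A 2 (\<lambda>v. to_plane v $ i)" for i by (rule form_to_plane[OF A])
    show "form ?A 5 (\<lambda>w. from_plane w $ i)" for i by (rule form_from_plane[OF A])
    show "nonempty_open_in ?X U" unfolding nonempty_open_in_def
      using returning[OF w0V] zariski_closed_form[OF form_chart_form] unfolding U_def by blast
    show "nonempty_open_in ?P V" unfolding nonempty_open_in_def
      using w0V zariski_closed_form[OF form_plane_denominator] unfolding V_def by blast
  qed (use there returning in blast)+
qed

section \<open>The pencil and its section\<close>

lemma proj_pt_image: "proj_pt v = (\<lambda>c. c *s v) ` (- {0})"
  by (auto simp: proj_pt_def)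

lemma pencil_map_proj_pt: "pencil_map (proj_pt (vector [a, b, x, y])) = proj_pt (vector [a, b])"
  unfolding pencil_map_def proj_pt_image image_image
  by (rule image_cong) (simp_all add: vec_eq_iff forall_2)

lemma zero_section_proj_pt: "zero_section (proj_pt (vector [a, b])) = proj_pt (vector [a, b, 0, 0])"
  unfolding zero_section_def proj_pt_image image_image
  by (rule image_cong) (simp_all add: vec_eq_iff forall_4)

lemma vector_2_eta:
  fixes v :: "'a::zero ^ 2"
  shows "vector [v $ 1, v $ 2] = v"
  by (simp add: vec_eq_iff forall_2)

lemma vector_2_nz: "(vector [a, b] :: 'a::zero ^ 2) \<noteq> 0 \<longleftrightarrow> (a, b) \<noteq> (0, 0)"
  by (auto simp: vec_eq_iff forall_2)

lemma proj_pt_surface_X: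
  "proj_pt (vector [a, b, x, y]) \<in> surface_X \<longleftrightarrow> (vector [a, b, x, y] :: 'a::field ^ 4) \<noteq> 0 \<and> quintic a b x y = 0"
  unfolding surface_X_eq proj_pt_in_iff[OF forms_UNIV(1)] by (simp add: surface_form_def)

lemma pencil_fiber:
  fixes a b :: "'k::field"
  assumes "(a, b) \<noteq> (0, 0)"
  shows "{P \<in> surface_X. pencil_map P = proj_pt (vector [a, b])} =
    {proj_pt (vector [a, b, x, y]) | x y. (x, y) \<in> curve_C a b}"
proof (intro equalityI subsetI)
  fix P :: "('k ^ 4) set" assume "P \<in> {P \<in> surface_X. pencil_map P = proj_pt (vector [a, b])}"
  then obtain a' b' x y where P: "P = proj_pt (vector [a', b', x, y])" "quintic a' b' x y = 0"
    "proj_pt (vector [a', b']) = proj_pt (vector [a, b] :: 'k ^ 2)"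
    unfolding surface_X_def by (auto simp: pencil_map_proj_pt)
  then obtain c where c: "c \<noteq> 0" "vector [a, b] = c *s (vector [a', b'] :: 'k ^ 2)"
    by (metis proj_pt_eq_iff)
  hence ab: "a = c * a'" "b = c * b'" by (simp_all add: vec_eq_iff forall_2)
  have e: "vector [a, b, c * x, c * y] = c *s (vector [a', b', x, y] :: 'k ^ 4)"
    by (simp add: vec_eq_iff forall_4 ab)
  have "surface_form (vector [a, b, c * x, c * y]) = 0"
    unfolding e form_homogeneous[OF forms_UNIV(1)] using P(2) by (simp add: surface_form_def)
  hence "quintic a b (c * x) (c * y) = 0" by (simp add: surface_form_def)
  moreover have "P = proj_pt (vector [a, b, c * x, c * y])" unfolding e P(1) by (simp add: proj_pt_scale c)
  ultimately show "P \<in> {proj_pt (vector [a, b, x, y]) | x y. (x, y) \<in> curve_C a b}"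
    unfolding curve_C_def by blast
next
  fix P :: "('k ^ 4) set" assume "P \<in> {proj_pt (vector [a, b, x, y]) | x y. (x, y) \<in> curve_C a b}"
  then obtain x y where P: "P = proj_pt (vector [a, b, x, y])" "quintic a b x y = 0" by (auto simp: curve_C_def)
  moreover have "(vector [a, b, x, y] :: 'k ^ 4) \<noteq> 0" using assms by (auto simp: vec_eq_iff forall_4)
  ultimately show "P \<in> {P \<in> surface_X. pencil_map P = proj_pt (vector [a, b])}"
    by (simp add: proj_pt_surface_X pencil_map_proj_pt)
qed

lemma zero_section_in_X:
  fixes p :: "('k::field ^ 2) set"
  assumes "p \<in> proj_space"
  shows "zero_section p \<in> surface_X" "pencil_map (zero_section p) = p"
proof -
  obtain w where w: "w \<noteq> 0" "p = proj_pt w" using assms by (auto simp: proj_space_def)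
  obtain a b where ab: "w = vector [a, b]" using vector_2_eta[of w] by metis
  have "(vector [a, b, 0, 0] :: 'k ^ 4) \<noteq> 0" using w(1) unfolding ab vector_2_nz by (auto simp: vec_eq_iff forall_4)
  thus "zero_section p \<in> surface_X"
    by (simp add: w ab zero_section_proj_pt proj_pt_surface_X quintic_def)
  show "pencil_map (zero_section p) = p" by (simp add: w ab zero_section_proj_pt pencil_map_proj_pt)
qed

text \<open>Both terms of the equation vanish to order 3 at this point, because a^2 + b^2 = 0
  there.\<close>

lemma singular_point:
  assumes "\<iota>\<^sup>2 = -1"
  shows "singular_point_X \<iota> 1 0 0"
  unfolding singular_point_X_def
  using assms by (auto simp: vec_eq_iff quintic_def pderiv_mult pderiv_diff pderiv_add pderiv_pCons
      power2_eq_square forall_4)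

lemma singular_fibers:
  fixes \<iota> :: "'k::{field_gcd,field_char_0}"
  assumes \<iota>: "\<iota>\<^sup>2 = -1"
  shows "{proj_pt (vector [a, b] :: 'k ^ 2) | a b. (a, b) \<noteq> (0, 0) \<and> singular_fiber_at generic_fiber 0 0 a b} =
    {proj_pt (vector [0, 1]), proj_pt (vector [\<iota>, 1]), proj_pt (vector [- \<iota>, 1]),
     proj_pt (vector [2 * \<iota>, 1]), proj_pt (vector [- 2 * \<iota>, 1])}"
proof (intro equalityI subsetI)
  fix P :: "('k ^ 2) set"
  assume "P \<in> {proj_pt (vector [a, b]) | a b. (a, b) \<noteq> (0, 0) \<and> singular_fiber_at generic_fiber 0 0 a b}"
  then obtain a b where P: "P = proj_pt (vector [a, b])" and ab: "(a, b) \<noteq> (0, 0)"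
    and sing: "singular_fiber_at generic_fiber 0 0 a b" by blast
  have sq: "z = c * b \<or> z = - (c * b)" if "z\<^sup>2 = (c * b)\<^sup>2" for z c
    using that power2_eq_iff by blast
  have \<iota>2: "(\<iota> * b)\<^sup>2 = - b\<^sup>2" "(2 * \<iota> * b)\<^sup>2 = - (4 * b\<^sup>2)" by (simp_all add: power_mult_distrib \<iota>)
  from smooth_fiber[OF ab] sing consider "a = 0" | "a\<^sup>2 + b\<^sup>2 = 0" | "a\<^sup>2 + 4 * b\<^sup>2 = 0" by blast
  hence "\<exists>c\<in>{0, \<iota>, - \<iota>, 2 * \<iota>, - 2 * \<iota>}. a = c * b"
  proof cases
    case 2
    hence "a\<^sup>2 = (\<iota> * b)\<^sup>2" unfolding \<iota>2 eq_neg_iff_add_eq_0 .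
    thus ?thesis using sq by fastforce
  next
    case 3
    hence "a\<^sup>2 = (2 * \<iota> * b)\<^sup>2" unfolding \<iota>2 eq_neg_iff_add_eq_0 .
    thus ?thesis using sq by fastforce
  qed simp
  then obtain c where c: "c \<in> {0, \<iota>, - \<iota>, 2 * \<iota>, - 2 * \<iota>}" "a = c * b" by blast
  have "b \<noteq> 0" using ab c(2) by auto
  moreover have "vector [a, b] = b *s (vector [c, 1] :: 'k ^ 2)" by (simp add: vec_eq_iff forall_2 c(2))
  ultimately have "P = proj_pt (vector [c, 1])" unfolding P by (simp add: proj_pt_scale)
  thus "P \<in> {proj_pt (vector [0, 1]), proj_pt (vector [\<iota>, 1]), proj_pt (vector [- \<iota>, 1]),
     proj_pt (vector [2 * \<iota>, 1]), proj_pt (vector [- 2 * \<iota>, 1])}" using c(1) by blast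
next
  fix P :: "('k ^ 2) set"
  assume "P \<in> {proj_pt (vector [0, 1]), proj_pt (vector [\<iota>, 1]), proj_pt (vector [- \<iota>, 1]),
     proj_pt (vector [2 * \<iota>, 1]), proj_pt (vector [- 2 * \<iota>, 1])}"
  then obtain c where c: "c \<in> {0, \<iota>, - \<iota>, 2 * \<iota>, - 2 * \<iota>}" "P = proj_pt (vector [c, 1])" by blast
  have "poly discriminant_poly c = 0" using c(1) by (auto simp: poly_discriminant_poly power_mult_distrib \<iota>)
  hence "singular_fiber_at generic_fiber 0 0 c 1" by (rule singular_fiber[OF \<iota>])
  thus "P \<in> {proj_pt (vector [a, b]) | a b. (a, b) \<noteq> (0, 0) \<and> singular_fiber_at generic_fiber 0 0 a b}"
    unfolding c(2) by (intro CollectI exI[of _ c] exI[of _ 1]) simp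
qed

theorem theorem1p2:
  fixes \<iota> :: "rat alg_closure"
  assumes "\<iota>^2 = -1"
  shows
    \<comment> \<open>a singular rational surface, over \<open>\<rat>\<close>\<close>
    "rational_surface_over (range to_ac) (surface_X :: (rat alg_closure ^ 4) set set) \<and>
     (\<exists>a b x y :: rat alg_closure. singular_point_X a b x y) \<and>
    \<comment> \<open>the fibers of the map to the projective line\<close>
     (\<forall>a b :: rat alg_closure. (a, b) \<noteq> (0, 0) \<longrightarrow>
        {P \<in> surface_X. pencil_map P = proj_pt (vector [a, b])} =
        {proj_pt (vector [a, b, x, y]) | x y. (x, y) \<in> curve_C a b}) \<and>
    \<comment> \<open>the identity section\<close>
     (\<forall>p \<in> (proj_space :: (rat alg_closure ^ 2) set set).
        zero_section p \<in> surface_X \<and> pencil_map (zero_section p) = p) \<and>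
    \<comment> \<open>the generic fiber, over \<open>\<rat>(t)\<close>\<close>
     has_geometric_genus (generic_fiber :: rat poly fract poly poly) 1 \<and>
    \<comment> \<open>the singular fibers over the algebraic closure of \<open>\<rat>\<close>\<close>
     {proj_pt (vector [a, b] :: rat alg_closure ^ 2) | a b.
        (a, b) \<noteq> (0, 0) \<and> singular_fiber_at generic_fiber 0 0 a b} =
     {proj_pt (vector [0, 1]),
      proj_pt (vector [\<iota>, 1]), proj_pt (vector [- \<iota>, 1]),
      proj_pt (vector [2 * \<iota>, 1]), proj_pt (vector [- 2 * \<iota>, 1])}"
proof (intro conjI)
  show "rational_surface_over (range to_ac) (surface_X :: (rat alg_closure ^ 4) set set)"
    by (rule rational_surface_X)
  show "\<exists>a b x y :: rat alg_closure. singular_point_X a b x y"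
    using singular_point[OF assms] by blast
  show "\<forall>a b :: rat alg_closure. (a, b) \<noteq> (0, 0) \<longrightarrow>
      {P \<in> surface_X. pencil_map P = proj_pt (vector [a, b])} =
      {proj_pt (vector [a, b, x, y]) | x y. (x, y) \<in> curve_C a b}"
    using pencil_fiber by blast
  show "\<forall>p \<in> (proj_space :: (rat alg_closure ^ 2) set set).
      zero_section p \<in> surface_X \<and> pencil_map (zero_section p) = p"
    using zero_section_in_X by blast
  show "has_geometric_genus (generic_fiber :: rat poly fract poly poly) 1"
    by (rule has_geometric_genus_1)
qed (rule singular_fibers[OF assms])

end
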